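(* Let $\theta>0$. Let $\mathbf{W}=(W_{n,k})_{n\in\mathbb{N},k\in[n]}$ be non-negative real random variables with $0=:W_{n,0}\le W_{n,1}\le\dots\le W_{n,n}=:W_{\max}^{(n)}$ and $\mathbb{E}[W_{\max}^{(n)}]<\infty$ for every $n$. Assume that $\mathbf{W}$ is independent of the sequence $(X_k)_{k\in\mathbb{N}}$, and that $(X_k)_{k\in\mathbb{N}}$ are mutually independent non-negative integer-valued random variables with $\lambda_k:=\mathbb{E}[X_k]<\infty$. Let $S_n=\sum_{k=1}^nW_{n,k}X_k$ and $$\varepsilon_n:=\delta_n+\frac2\theta D_n^*+\frac2\theta\sum_{k=1}^n\lambda_kW_{n,k}\frac{d_{TV}(X_k^*,X_k+1)}{\mathbb{P}(X_k=x_{\min}^{(k)})}+|W_{\max}^{(n)}-1|.$$ Let $$C_1:=2\theta^2+(6\theta+10\theta\,\zeta(1+\theta))\max\Big\{\frac{e^{-\theta\gamma}}{\Gamma(\theta)},k_\theta\Big\},\qquad C_2:=3\,(2\theta+4\theta\,\zeta(1+\theta))^{\theta}.$$ Then for every $n\in\mathbb{N}$, $$d_K(S_n,D_\theta)\le\begin{cases}C_1\,\mathbb{E}[\varepsilon_n],&\theta\ge1,\\2\theta^2\,\mathbb{E}[\varepsilon_n]+C_2\,(\mathbb{E}[\varepsilon_n])^\theta,&\theta\in(0,1).\end{cases}$$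
   Context: $[n]=\{1,\dots,n\}$. $D_\theta$ has the generalized Dickman distribution with mean $\theta$: the unique non-negative solution (in law) of $D\stackrel{d}{=}U^{1/\theta}(D+1)$ with $U$ uniform on $[0,1]$ independent of $D$. Let $p_\theta$ be its density; $k_\theta>0$ is a constant with $p_\theta(x)\le k_\theta$ for all $x\ge1$ (such a constant exists). $\gamma$ is the Euler–Mascheroni constant, $\zeta$ the Riemann zeta function. $d_K(X,Y)=\sup_{t\ge0}|\mathbb{P}(X\le t)-\mathbb{P}(Y\le t)|$ for non-negative $X,Y$; $d_{TV}$ is total variation distance (supremum over events of the difference of probabilities). $\Delta_{n,k}:=\theta(W_{n,k}-W_{n,k-1})$, $D_{n,k}:=\sum_{j=1}^k(\lambda_jW_{n,j}-\Delta_{n,j})$, $\delta_n:=\max_{k\in[n]}(W_{n,k}-W_{n,k-1})$, $D_n^*:=\max_{k\in[n]}|D_{n,k}|$. $x_{\min}^{(k)}:=\min\{x\in\mathbb{N}_0:\mathbb{P}(X_k=x)>0\}$. $X_k^*$ has the size-biased law of $X_k$: $\mathbb{E}[X_kf(X_k)]=\lambda_k\mathbb{E}[f(X_k^* )]$ for all $f$ for which the expectations exist. A summand with $\lambda_k=0$ is read as $0$. *)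

theory Defs
  imports "HOL-Probability.Probability"
begin

(* Only meaningful for s > 1, where the Dirichlet series converges. *)
definition zeta_real :: "real \<Rightarrow> real" where
  "zeta_real s = (\<Sum>n. 1 / real (Suc n) powr s)"

(* Distances are functions of the laws, so that the two random variables
   may live on different probability spaces. *)
definition kolmogorov_dist :: "real measure \<Rightarrow> real measure \<Rightarrow> real" where
  "kolmogorov_dist \<mu> \<nu> = (SUP t\<in>{0..}. \<bar>measure \<mu> {..t} - measure \<nu> {..t}\<bar>)"

definition tv_dist :: "'b measure \<Rightarrow> 'b measure \<Rightarrow> real" where
  "tv_dist \<mu> \<nu> = (SUP A\<in>sets \<mu>. \<bar>measure \<mu> A - measure \<nu> A\<bar>)"

(* The law mu of D solves D = U^(1/theta) (D + 1) in distribution, with U uniform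
   on [0,1] and independent of D: hence the product measure on the left. *)
definition gen_dickman :: "real \<Rightarrow> real measure \<Rightarrow> bool" where
  "gen_dickman \<theta> \<mu> \<longleftrightarrow>
     prob_space \<mu> \<and> sets \<mu> = sets borel \<and> (AE x in \<mu>. 0 \<le> x) \<and>
     distr (uniform_measure lborel {0..1} \<Otimes>\<^sub>M \<mu>) borel
           (\<lambda>(u, d). u powr (1 / \<theta>) * (d + 1)) = \<mu>"

definition size_biased :: "'a measure \<Rightarrow> ('a \<Rightarrow> nat) \<Rightarrow> nat measure \<Rightarrow> bool" where
  "size_biased M Y \<nu> \<longleftrightarrow>
     prob_space \<nu> \<and> sets \<nu> = sets (count_space UNIV) \<and>
     (\<forall>f :: nat \<Rightarrow> real.
        integrable M (\<lambda>\<omega>. real (Y \<omega>) * f (Y \<omega>)) \<longrightarrow> integrable \<nu> f \<longrightarrow>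
        (\<integral>\<omega>. real (Y \<omega>) * f (Y \<omega>) \<partial>M) = (\<integral>\<omega>. real (Y \<omega>) \<partial>M) * (\<integral>x. f x \<partial>\<nu>))"

definition tri_index :: "(nat \<times> nat) set" where
  "tri_index = {(n, k). 1 \<le> k \<and> k \<le> n}"

(* Independence of the sigma-algebras generated by the whole array and by the whole
   sequence; indep_var is not applicable since the value types differ. *)
definition array_indep_seq ::
  "'a measure \<Rightarrow> (nat \<Rightarrow> nat \<Rightarrow> 'a \<Rightarrow> real) \<Rightarrow> (nat \<Rightarrow> 'a \<Rightarrow> nat) \<Rightarrow> bool" where
  "array_indep_seq M W X \<longleftrightarrow>
     prob_space.indep_set M
       (sets (vimage_algebra (space M) (\<lambda>\<omega>. \<lambda>(n, k)\<in>tri_index. W n k \<omega>)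
          (Pi\<^sub>M tri_index (\<lambda>_. borel))))
       (sets (vimage_algebra (space M) (\<lambda>\<omega>. \<lambda>k\<in>{1..}. X k \<omega>)
          (Pi\<^sub>M {1..} (\<lambda>_. count_space UNIV))))"

definition lam :: "'a measure \<Rightarrow> (nat \<Rightarrow> 'a \<Rightarrow> nat) \<Rightarrow> nat \<Rightarrow> real" where
  "lam M X k = (\<integral>\<omega>. real (X k \<omega>) \<partial>M)"

definition wsum :: "(nat \<Rightarrow> nat \<Rightarrow> 'a \<Rightarrow> real) \<Rightarrow> (nat \<Rightarrow> 'a \<Rightarrow> nat) \<Rightarrow> nat \<Rightarrow> 'a \<Rightarrow> real" where
  "wsum W X n \<omega> = (\<Sum>k=1..n. W n k \<omega> * real (X k \<omega>))"

definition Delta :: "real \<Rightarrow> (nat \<Rightarrow> nat \<Rightarrow> 'a \<Rightarrow> real) \<Rightarrow> nat \<Rightarrow> nat \<Rightarrow> 'a \<Rightarrow> real" where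
  "Delta \<theta> W n k \<omega> = \<theta> * (W n k \<omega> - W n (k - 1) \<omega>)"

definition Dpart ::
  "'a measure \<Rightarrow> real \<Rightarrow> (nat \<Rightarrow> nat \<Rightarrow> 'a \<Rightarrow> real) \<Rightarrow> (nat \<Rightarrow> 'a \<Rightarrow> nat)
     \<Rightarrow> nat \<Rightarrow> nat \<Rightarrow> 'a \<Rightarrow> real" where
  "Dpart M \<theta> W X n k \<omega> = (\<Sum>j=1..k. lam M X j * W n j \<omega> - Delta \<theta> W n j \<omega>)"

definition max_gap :: "(nat \<Rightarrow> nat \<Rightarrow> 'a \<Rightarrow> real) \<Rightarrow> nat \<Rightarrow> 'a \<Rightarrow> real" where
  "max_gap W n \<omega> = Max ((\<lambda>k. W n k \<omega> - W n (k - 1) \<omega>) ` {1..n})"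

definition Dstar ::
  "'a measure \<Rightarrow> real \<Rightarrow> (nat \<Rightarrow> nat \<Rightarrow> 'a \<Rightarrow> real) \<Rightarrow> (nat \<Rightarrow> 'a \<Rightarrow> nat)
     \<Rightarrow> nat \<Rightarrow> 'a \<Rightarrow> real" where
  "Dstar M \<theta> W X n \<omega> = Max ((\<lambda>k. \<bar>Dpart M \<theta> W X n k \<omega>\<bar>) ` {1..n})"

definition x_min :: "'a measure \<Rightarrow> ('a \<Rightarrow> nat) \<Rightarrow> nat" where
  "x_min M Y = (LEAST x. measure M {\<omega> \<in> space M. Y \<omega> = x} > 0)"

(* Xs k is the law of the size-biased version of X k. If lam M X k = 0, the k-th
   summand is 0 whatever Xs k is. *)
definition eps ::
  "'a measure \<Rightarrow> real \<Rightarrow> (nat \<Rightarrow> nat \<Rightarrow> 'a \<Rightarrow> real) \<Rightarrow> (nat \<Rightarrow> 'a \<Rightarrow> nat)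
     \<Rightarrow> (nat \<Rightarrow> nat measure) \<Rightarrow> nat \<Rightarrow> 'a \<Rightarrow> real" where
  "eps M \<theta> W X Xs n \<omega> =
     max_gap W n \<omega> + 2 / \<theta> * Dstar M \<theta> W X n \<omega>
     + 2 / \<theta> * (\<Sum>k=1..n. lam M X k * W n k \<omega> *
           (tv_dist (Xs k) (distr M (count_space UNIV) (\<lambda>\<omega>'. X k \<omega>' + 1))
            / measure M {\<omega>' \<in> space M. X k \<omega>' = x_min M (X k)}))
     + \<bar>W n n \<omega> - 1\<bar>"

definition C1 :: "real \<Rightarrow> real \<Rightarrow> real" where
  "C1 \<theta> \<kappa> = 2 * \<theta>\<^sup>2 + (6 * \<theta> + 10 * \<theta> * zeta_real (1 + \<theta>)) *
     max (exp (- \<theta> * euler_mascheroni) / Gamma \<theta>) \<kappa>"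

definition C2 :: "real \<Rightarrow> real" where
  "C2 \<theta> = 3 * (2 * \<theta> + 4 * \<theta> * zeta_real (1 + \<theta>)) powr \<theta>"

end

theory Submission
  imports Defs
begin

text \<open>
  Conditioning on the weights reduces the claim to deterministic ones. For the test function
  \<open>h = 1{x \<le> t}\<close>, the Stein equation \<open>(x/\<theta>) f'(x) + f(x) - f(x+1) = h(x) - P(D \<le> t)\<close> is solved by
  \<open>- f' = \<phi> = \<Sum>n. T^n \<phi>0\<close>, where \<open>\<phi>0(x) = \<theta> t^\<theta> x^(-\<theta>-1) 1{x > t}\<close>,
  \<open>T u(x) = E[V u(V x + 1)]\<close> and \<open>V = U^(1/\<theta>)\<close>. On each half-line \<open>[s, \<infinity>)\<close> the function \<open>\<phi>\<close> is a difference
  of nondecreasing functions with values in \<open>[0, \<theta>^2 + env(s)]\<close>, where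
  \<open>env(s)\<close> is the supremum of \<open>\<phi>0\<close> over \<open>[s, \<infinity>)\<close>. Summation by parts, a Riemann
  sum estimate and the size-biased laws then give
  \<open>|P(S \<le> t) - P(D \<le> t)| \<le> \<epsilon> (\<theta>^2 + E[env(S)])\<close>. Splitting \<open>env\<close> over the intervals
  \<open>(j t, (j+1) t]\<close> bounds \<open>E[env(S)]\<close> by interval probabilities of \<open>D\<close> plus multiples of the
  Kolmogorov distance itself (this is where \<open>\<zeta>(1+\<theta>)\<close> comes from), and for \<open>t\<close> of order at least \<open>\<epsilon>\<close>
  the distance on the right is absorbed into the left-hand side.
\<close>

section \<open>The Stein equation\<close>

text \<open>Let F(x) be the integral of \<phi> over (0,x). Integrated from 0, the Stein equation
  reads F(x) + (x/\<theta>) F'(x) = g(x), where g(x) is 1{x > t} plus the integral of \<phi> over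
  (1,x+1). The operator on the left is inverted by averaging, F(x) = E[g(V x)]. Differentiation
  turns the indicator into \<phi>0 and the remaining integral into T \<phi>, so that \<phi> =
  \<phi>0 + T \<phi>. Since E[V] = \<theta>/(\<theta>+1) < 1, the series converges, and its terms
  after \<phi>0 sum to at most \<theta> times the sum of (\<theta>/(\<theta>+1))^n over n >= 1,
  which is \<theta>^2. The obstacle is the jump of the test function: \<phi>0 jumps by \<theta>/t at
  t, so there is no Lipschitz bound for \<phi>, and the supremum of \<phi>0 is useless for small t.
  The splitting into bounded monotone functions replaces the Lipschitz property. Keeping env at the
  random point S, instead of its supremum \<theta>/t, lets the small probability that S is of order
  t compensate the height of the jump.\<close>

lemma nn_integral_Ioo_has_integral:
  fixes f :: "real \<Rightarrow> real"
  assumes [measurable]: "f \<in> borel_measurable borel"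
    and I: "(f has_integral I) {a..b}"
    and nn: "\<And>x. a < x \<Longrightarrow> x < b \<Longrightarrow> 0 \<le> f x"
  shows "(\<integral>\<^sup>+x. ennreal (f x) * indicator {a<..<b} x \<partial>lborel) = ennreal I"
proof -
  have "(f has_integral I) {a<..<b}"
    using I by (simp add: has_integral_Icc_iff_Ioo)
  then have I': "((\<lambda>x. indicator {a<..<b} x * f x) has_integral I) UNIV"
    by (subst (asm) has_integral_restrict_UNIV[symmetric])
       (auto simp: indicator_def intro: has_integral_cong[THEN iffD1, rotated])
  have "integral\<^sup>N lborel (\<lambda>x. ennreal (indicator {a<..<b} x * f x)) = ennreal I"
    by (rule nn_integral_has_integral_lborel[OF _ _ I']) (use nn in \<open>auto simp: indicator_def\<close>)
  moreover have "(\<integral>\<^sup>+x. ennreal (f x) * indicator {a<..<b} x \<partial>lborel)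
      = integral\<^sup>N lborel (\<lambda>x. ennreal (indicator {a<..<b} x * f x))"
    by (intro nn_integral_cong) (auto simp: indicator_def)
  ultimately show ?thesis by simp
qed

lemma nn_integral_FTC_Ioo:
  fixes f F :: "real \<Rightarrow> real"
  assumes "f \<in> borel_measurable borel" "a \<le> b" "continuous_on {a..b} F"
    and "\<And>x. a < x \<Longrightarrow> x < b \<Longrightarrow> (F has_real_derivative f x) (at x)"
    and "\<And>x. a < x \<Longrightarrow> x < b \<Longrightarrow> 0 \<le> f x"
  shows "(\<integral>\<^sup>+x. ennreal (f x) * indicator {a<..<b} x \<partial>lborel) = ennreal (F b - F a)"
  using assms
  by (intro nn_integral_Ioo_has_integral fundamental_theorem_of_calculus_interior)
     (auto simp: has_real_derivative_iff_has_vector_derivative[symmetric])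

text \<open>Endpoints that vary with the argument are covered because the Fubini steps below
  integrate over regions such as 0 < y < v x.\<close>

lemma borel_measurable_indicator_Ioi [measurable]:
  fixes f h :: "'b \<Rightarrow> real"
  assumes [measurable]: "f \<in> borel_measurable N" "h \<in> borel_measurable N"
  shows "(\<lambda>x. indicator {f x<..} (h x) :: ennreal) \<in> borel_measurable N"
  unfolding indicator_def greaterThan_iff by measurable

lemma borel_measurable_indicator_Ioc [measurable]:
  fixes f g h :: "'b \<Rightarrow> real"
  assumes [measurable]: "f \<in> borel_measurable N" "g \<in> borel_measurable N" "h \<in> borel_measurable N"
  shows "(\<lambda>x. indicator {f x<..g x} (h x) :: ennreal) \<in> borel_measurable N"
  unfolding indicator_def greaterThanAtMost_iff by measurable

lemma borel_measurable_indicator_Ioo [measurable]: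
  fixes f g h :: "'b \<Rightarrow> real"
  assumes [measurable]: "f \<in> borel_measurable N" "g \<in> borel_measurable N" "h \<in> borel_measurable N"
  shows "(\<lambda>x. indicator {f x<..<g x} (h x) :: ennreal) \<in> borel_measurable N"
  unfolding indicator_def greaterThanLessThan_iff by measurable

section \<open>The averaging operator built from V and its integral identity\<close>

text \<open>The density of \<open>U^(1/\<theta>)\<close>.\<close>

definition Vdens :: "real \<Rightarrow> real \<Rightarrow> ennreal" where
  "Vdens \<theta> v = ennreal (\<theta> * v powr (\<theta> - 1)) * indicator {0<..<1} v"

lemma Vdens_measurable [measurable]: "Vdens \<theta> \<in> borel_measurable borel"
  unfolding Vdens_def[abs_def] by measurable

lemma nn_integral_powr_Ioo:
  fixes \<theta> :: real
  assumes "\<theta> > 0" "0 \<le> a" "a \<le> b"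
  shows "(\<integral>\<^sup>+v. ennreal (\<theta> * v powr (\<theta> - 1)) * indicator {a<..<b} v \<partial>lborel)
    = ennreal (b powr \<theta> - a powr \<theta>)"
proof (rule nn_integral_FTC_Ioo[where F = "\<lambda>v. v powr \<theta>"])
  show "continuous_on {a..b} (\<lambda>v. v powr \<theta>)"
    using assms by (intro continuous_on_powr' continuous_intros) auto
  show "((\<lambda>v. v powr \<theta>) has_real_derivative \<theta> * x powr (\<theta> - 1)) (at x)" if "a < x" "x < b" for x
    using that assms by (intro has_real_derivative_powr) auto
qed (use assms in auto)

lemma nn_integral_Vdens_gt:
  assumes "\<theta> > 0" "0 \<le> a" "a \<le> 1"
  shows "(\<integral>\<^sup>+v. Vdens \<theta> v * indicator {a<..} v \<partial>lborel) = ennreal (1 - a powr \<theta>)"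
proof -
  have "(\<integral>\<^sup>+v. Vdens \<theta> v * indicator {a<..} v \<partial>lborel)
      = (\<integral>\<^sup>+v. ennreal (\<theta> * v powr (\<theta> - 1)) * indicator {a<..<1} v \<partial>lborel)"
    using assms by (intro nn_integral_cong) (auto simp: Vdens_def indicator_def)
  also have "\<dots> = ennreal (1 - a powr \<theta>)"
    using nn_integral_powr_Ioo[of \<theta> a 1] assms by simp
  finally show ?thesis .
qed

text \<open>E[V] < 1 is the contraction factor of \<open>dickman_op\<close> on constants; the
  convergence of the series for \<phi> rests on it.\<close>

lemma nn_integral_Vdens_mean:
  assumes "\<theta> > 0"
  shows "(\<integral>\<^sup>+v. Vdens \<theta> v * ennreal v \<partial>lborel) = ennreal (\<theta> / (\<theta> + 1))"
proof -
  have "(\<integral>\<^sup>+v. Vdens \<theta> v * ennreal v \<partial>lborel)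
      = (\<integral>\<^sup>+v. ennreal (\<theta> * v powr \<theta>) * indicator {0<..<1} v \<partial>lborel)"
    using assms
    by (intro nn_integral_cong)
       (auto simp: Vdens_def indicator_def ennreal_mult[symmetric] powr_diff)
  also have "\<dots> = ennreal (\<theta> / (\<theta> + 1) * 1 powr (\<theta> + 1) - \<theta> / (\<theta> + 1) * 0 powr (\<theta> + 1))"
  proof (rule nn_integral_FTC_Ioo[where F = "\<lambda>v. \<theta> / (\<theta> + 1) * v powr (\<theta> + 1)"])
    show "continuous_on {0..1} (\<lambda>v. \<theta> / (\<theta> + 1) * v powr (\<theta> + 1))"
      using assms by (intro continuous_on_mult continuous_on_powr' continuous_intros) auto
    show "((\<lambda>v. \<theta> / (\<theta> + 1) * v powr (\<theta> + 1)) has_real_derivative \<theta> * x powr \<theta>) (at x)"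
      if "0 < x" "x < 1" for x
      using that assms by (auto intro!: derivative_eq_intros)
  qed (use assms in auto)
  finally show ?thesis using assms by simp
qed

text \<open>\<open>E[V u(V x + 1)]\<close> for \<open>V = U^(1/\<theta>)\<close>.\<close>

definition dickman_op :: "real \<Rightarrow> (real \<Rightarrow> ennreal) \<Rightarrow> real \<Rightarrow> ennreal" where
  "dickman_op \<theta> u x = (\<integral>\<^sup>+v. Vdens \<theta> v * (ennreal v * u (v * x + 1)) \<partial>lborel)"

lemma dickman_op_measurable [measurable]:
  assumes [measurable]: "u \<in> borel_measurable borel"
  shows "dickman_op \<theta> u \<in> borel_measurable borel"
  unfolding dickman_op_def[abs_def] by measurable

text \<open>For \<open>x \<ge> 0\<close> the operator only sees \<open>u\<close> on \<open>[1, \<infinity>)\<close>, where \<open>stein_phi0\<close> is bounded by \<open>\<theta>\<close>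
  whatever \<open>t\<close> is.\<close>

lemma dickman_op_mono:
  assumes "\<And>y. 1 \<le> y \<Longrightarrow> u y \<le> u' y" "0 \<le> x"
  shows "dickman_op \<theta> u x \<le> dickman_op \<theta> u' x"
  unfolding dickman_op_def
proof (rule nn_integral_mono)
  fix v :: real
  show "Vdens \<theta> v * (ennreal v * u (v * x + 1)) \<le> Vdens \<theta> v * (ennreal v * u' (v * x + 1))"
    using assms by (cases "0 < v") (auto simp: Vdens_def intro!: mult_left_mono)
qed

lemma dickman_op_cong:
  assumes "\<And>y. 1 \<le> y \<Longrightarrow> u y = u' y" "0 \<le> x"
  shows "dickman_op \<theta> u x = dickman_op \<theta> u' x"
  using assms by (intro antisym dickman_op_mono) auto

lemma dickman_op_mono_arg:
  assumes "\<And>y z. 1 \<le> y \<Longrightarrow> y \<le> z \<Longrightarrow> u y \<le> u z" "0 \<le> x" "x \<le> x'"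
  shows "dickman_op \<theta> u x \<le> dickman_op \<theta> u x'"
  unfolding dickman_op_def
proof (rule nn_integral_mono)
  fix v :: real
  show "Vdens \<theta> v * (ennreal v * u (v * x + 1)) \<le> Vdens \<theta> v * (ennreal v * u (v * x' + 1))"
    using assms by (cases "0 < v") (auto simp: Vdens_def intro!: mult_left_mono)
qed

lemma dickman_op_const: "\<theta> > 0 \<Longrightarrow> dickman_op \<theta> (\<lambda>_. c) x = c * ennreal (\<theta> / (\<theta> + 1))"
  unfolding dickman_op_def mult.assoc[symmetric]
  by (subst nn_integral_multc) (simp_all add: nn_integral_Vdens_mean mult.commute[of c])

lemma dickman_op_add:
  assumes [measurable]: "u \<in> borel_measurable borel" "u' \<in> borel_measurable borel"
  shows "dickman_op \<theta> (\<lambda>y. u y + u' y) x = dickman_op \<theta> u x + dickman_op \<theta> u' x"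
  unfolding dickman_op_def by (subst nn_integral_add[symmetric]) (auto simp: distrib_left)

lemma dickman_op_suminf:
  assumes [measurable]: "\<And>n. u n \<in> borel_measurable borel"
  shows "dickman_op \<theta> (\<lambda>y. \<Sum>n. u n y) x = (\<Sum>n. dickman_op \<theta> (u n) x)"
  unfolding dickman_op_def by (subst nn_integral_suminf[symmetric]) auto

text \<open>Both terms on the left become integrals of u(y + 1) over 0 < y < x, with the weights 1 -
  (y/x)^\<theta> and (y/x)^\<theta>, which add up to 1.\<close>

lemma dickman_op_identity:
  fixes u :: "real \<Rightarrow> ennreal"
  assumes [measurable]: "u \<in> borel_measurable borel" and "\<theta> > 0" "x > 0"
  shows "(\<integral>\<^sup>+s. dickman_op \<theta> u s * indicator {0<..<x} s \<partial>lborel) + ennreal (x / \<theta>) * dickman_op \<theta> u x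
    = (\<integral>\<^sup>+y. u (y + 1) * indicator {0<..<x} y \<partial>lborel)"
proof -
  have "(\<integral>\<^sup>+s. dickman_op \<theta> u s * indicator {0<..<x} s \<partial>lborel)
     = (\<integral>\<^sup>+s. \<integral>\<^sup>+v. Vdens \<theta> v * (ennreal v * u (v * s + 1)) * indicator {0<..<x} s \<partial>lborel \<partial>lborel)"
    unfolding dickman_op_def by (simp add: nn_integral_multc)
  also have "\<dots> = (\<integral>\<^sup>+v. \<integral>\<^sup>+s. Vdens \<theta> v * (ennreal v * u (v * s + 1)) * indicator {0<..<x} s \<partial>lborel \<partial>lborel)"
    by (rule lborel_pair.Fubini') simp
  \<comment> \<open>Substitution y = v s: the factor v of the operator is absorbed by dy = v
    ds.\<close>
  also have "\<dots> = (\<integral>\<^sup>+v. \<integral>\<^sup>+y. Vdens \<theta> v * u (y + 1) * indicator {0<..<v * x} y \<partial>lborel \<partial>lborel)"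
  proof (rule nn_integral_cong)
    fix v :: real
    show "(\<integral>\<^sup>+s. Vdens \<theta> v * (ennreal v * u (v * s + 1)) * indicator {0<..<x} s \<partial>lborel)
      = (\<integral>\<^sup>+y. Vdens \<theta> v * u (y + 1) * indicator {0<..<v * x} y \<partial>lborel)"
    proof (cases "0 < v \<and> v < 1")
      case True
      then have "(\<integral>\<^sup>+y. Vdens \<theta> v * u (y + 1) * indicator {0<..<v * x} y \<partial>lborel)
        = ennreal v * (\<integral>\<^sup>+s. Vdens \<theta> v * u (v * s + 1) * indicator {0<..<v * x} (v * s) \<partial>lborel)"
        by (subst nn_integral_real_affine[where c = v and t = 0]) auto
      also have "\<dots> = (\<integral>\<^sup>+s. ennreal v * (Vdens \<theta> v * u (v * s + 1) * indicator {0<..<v * x} (v * s)) \<partial>lborel)"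
        by (rule nn_integral_cmult[symmetric]) simp
      also have "\<dots> = (\<integral>\<^sup>+s. Vdens \<theta> v * (ennreal v * u (v * s + 1)) * indicator {0<..<x} s \<partial>lborel)"
        using True by (intro nn_integral_cong) (auto simp: indicator_def zero_less_mult_iff mult_ac)
      finally show ?thesis by simp
    qed (auto simp: Vdens_def)
  qed
  also have "\<dots> = (\<integral>\<^sup>+y. \<integral>\<^sup>+v. Vdens \<theta> v * u (y + 1) * indicator {0<..<v * x} y \<partial>lborel \<partial>lborel)"
    by (rule lborel_pair.Fubini'[symmetric]) simp
  \<comment> \<open>For fixed y in (0,x) the remaining condition on V is V > y/x, an event of
    probability 1 - (y/x)^\<theta>.\<close>
  also have "\<dots> = (\<integral>\<^sup>+y. u (y + 1) * indicator {0<..<x} y * ennreal (1 - (y / x) powr \<theta>) \<partial>lborel)"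
  proof (rule nn_integral_cong)
    fix y :: real
    have "(\<integral>\<^sup>+v. Vdens \<theta> v * u (y + 1) * indicator {0<..<v * x} y \<partial>lborel)
      = (\<integral>\<^sup>+v. u (y + 1) * indicator {0<..<x} y * (Vdens \<theta> v * indicator {y / x<..} v) \<partial>lborel)"
      using assms
      by (intro nn_integral_cong)
         (auto simp: indicator_def Vdens_def field_simps intro: less_le_trans less_trans)
    also have "\<dots> = u (y + 1) * indicator {0<..<x} y * (\<integral>\<^sup>+v. Vdens \<theta> v * indicator {y / x<..} v \<partial>lborel)"
      by (rule nn_integral_cmult) simp
    also have "\<dots> = u (y + 1) * indicator {0<..<x} y * ennreal (1 - (y / x) powr \<theta>)"
      using assms nn_integral_Vdens_gt[of \<theta> "y / x"] by (cases "0 < y \<and> y < x") auto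
    finally show "(\<integral>\<^sup>+v. Vdens \<theta> v * u (y + 1) * indicator {0<..<v * x} y \<partial>lborel)
      = u (y + 1) * indicator {0<..<x} y * ennreal (1 - (y / x) powr \<theta>)" .
  qed
  finally have 1: "(\<integral>\<^sup>+s. dickman_op \<theta> u s * indicator {0<..<x} s \<partial>lborel)
    = (\<integral>\<^sup>+y. u (y + 1) * indicator {0<..<x} y * ennreal (1 - (y / x) powr \<theta>) \<partial>lborel)" .
  \<comment> \<open>The complementary weight comes from the second term by substituting y = x v in
    the definition of the operator at the fixed point x.\<close>
  have "(\<integral>\<^sup>+y. u (y + 1) * indicator {0<..<x} y * ennreal ((y / x) powr \<theta>) \<partial>lborel)
    = ennreal x * (\<integral>\<^sup>+v. u (v * x + 1) * indicator {0<..<x} (x * v) * ennreal ((x * v / x) powr \<theta>) \<partial>lborel)"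
    using assms by (subst nn_integral_real_affine[where c = x and t = 0]) (auto simp: mult.commute)
  also have "(\<integral>\<^sup>+v. u (v * x + 1) * indicator {0<..<x} (x * v) * ennreal ((x * v / x) powr \<theta>) \<partial>lborel)
    = (\<integral>\<^sup>+v. ennreal (1 / \<theta>) * (Vdens \<theta> v * (ennreal v * u (v * x + 1))) \<partial>lborel)"
  proof (rule nn_integral_cong)
    fix v :: real
    show "u (v * x + 1) * indicator {0<..<x} (x * v) * ennreal ((x * v / x) powr \<theta>)
      = ennreal (1 / \<theta>) * (Vdens \<theta> v * (ennreal v * u (v * x + 1)))"
    proof (cases "0 < v \<and> v < 1")
      case True
      have "ennreal (v powr \<theta>) = ennreal (1 / \<theta> * (\<theta> * v powr (\<theta> - 1) * v))"
        using True assms by (simp add: powr_diff)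
      also have "\<dots> = ennreal (1 / \<theta>) * ennreal (\<theta> * v powr (\<theta> - 1) * v)"
        using True assms by (intro ennreal_mult) auto
      also have "ennreal (\<theta> * v powr (\<theta> - 1) * v) = ennreal (\<theta> * v powr (\<theta> - 1)) * ennreal v"
        using True assms by (intro ennreal_mult) auto
      finally have "ennreal (v powr \<theta>) = ennreal (1 / \<theta>) * (ennreal (\<theta> * v powr (\<theta> - 1)) * ennreal v)" .
      with True assms show ?thesis by (simp add: Vdens_def mult_ac)
    qed (use assms in \<open>auto simp: Vdens_def indicator_def zero_less_mult_iff\<close>)
  qed
  also have "\<dots> = ennreal (1 / \<theta>) * dickman_op \<theta> u x"
    unfolding dickman_op_def by (rule nn_integral_cmult) simp
  finally have 2: "(\<integral>\<^sup>+y. u (y + 1) * indicator {0<..<x} y * ennreal ((y / x) powr \<theta>) \<partial>lborel)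
    = ennreal (x / \<theta>) * dickman_op \<theta> u x"
    using assms by (simp add: mult.assoc[symmetric] ennreal_mult[symmetric])
  show ?thesis unfolding 1 2[symmetric]
  proof (subst nn_integral_add[symmetric], simp, simp, intro nn_integral_cong)
    fix y :: real
    show "u (y + 1) * indicator {0<..<x} y * ennreal (1 - (y / x) powr \<theta>)
        + u (y + 1) * indicator {0<..<x} y * ennreal ((y / x) powr \<theta>)
      = u (y + 1) * indicator {0<..<x} y"
    proof (cases "0 < y \<and> y < x")
      case True
      then have "(y / x) powr \<theta> \<le> 1" using assms by (intro powr_le1) auto
      then have "ennreal (1 - (y / x) powr \<theta>) + ennreal ((y / x) powr \<theta>) = 1"
        by (subst ennreal_plus[symmetric]) auto
      then show ?thesis by (simp add: distrib_left[symmetric])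
    qed auto
  qed
qed

text \<open>Away from t this is the derivative of x -> P(V x > t), which is 1 - (t/x)^\<theta> for x
  > t and 0 for smaller positive x.\<close>

definition stein_phi0 :: "real \<Rightarrow> real \<Rightarrow> real \<Rightarrow> real" where
  "stein_phi0 \<theta> t x = (if t < x then \<theta> * t powr \<theta> * x powr (- \<theta> - 1) else 0)"

text \<open>May be infinite for negative arguments, which never matter.\<close>

definition stein_Psi :: "real \<Rightarrow> real \<Rightarrow> real \<Rightarrow> ennreal" where
  "stein_Psi \<theta> t x = (\<Sum>n. (dickman_op \<theta> ^^ Suc n) (\<lambda>y. ennreal (stein_phi0 \<theta> t y)) x)"

definition stein_phi :: "real \<Rightarrow> real \<Rightarrow> real \<Rightarrow> real" where
  "stein_phi \<theta> t x = stein_phi0 \<theta> t x + enn2real (stein_Psi \<theta> t x)"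

text \<open>The value \<theta>/t is the limit of \<open>stein_phi0\<close> at t from the right, that
  is, the height of the jump.\<close>

definition stein_env :: "real \<Rightarrow> real \<Rightarrow> real \<Rightarrow> real" where
  "stein_env \<theta> t y = (if t < y then stein_phi0 \<theta> t y else \<theta> / t)"

section \<open>Size and monotone decomposition of the Stein solution\<close>

lemma stein_phi0_measurable [measurable]: "stein_phi0 \<theta> t \<in> borel_measurable borel"
  unfolding stein_phi0_def[abs_def] by measurable

lemma stein_env_measurable [measurable]: "stein_env \<theta> t \<in> borel_measurable borel"
  unfolding stein_env_def[abs_def] by measurable

lemma dickman_op_iter_measurable [measurable]:
  "u \<in> borel_measurable borel \<Longrightarrow> (dickman_op \<theta> ^^ n) u \<in> borel_measurable borel"
  by (induction n) auto

lemma stein_Psi_measurable [measurable]: "stein_Psi \<theta> t \<in> borel_measurable borel"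
  unfolding stein_Psi_def[abs_def] by measurable

lemma stein_phi_measurable [measurable]: "stein_phi \<theta> t \<in> borel_measurable borel"
  unfolding stein_phi_def[abs_def] by measurable

lemma stein_phi0_nonneg: "\<theta> > 0 \<Longrightarrow> 0 \<le> stein_phi0 \<theta> t x"
  by (simp add: stein_phi0_def)

lemma stein_phi_nonneg: "\<theta> > 0 \<Longrightarrow> 0 \<le> stein_phi \<theta> t x"
  by (simp add: stein_phi_def stein_phi0_nonneg)

lemma stein_phi0_antimono:
  assumes "\<theta> > 0" "t > 0" "t < x" "x \<le> y"
  shows "stein_phi0 \<theta> t y \<le> stein_phi0 \<theta> t x"
  using assms by (auto simp: stein_phi0_def intro!: mult_left_mono powr_mono2')

lemma stein_phi0_le:
  assumes "\<theta> > 0" "t > 0"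
  shows "stein_phi0 \<theta> t x \<le> \<theta> / t"
proof (cases "t < x")
  case True
  have "x powr (- \<theta> - 1) \<le> t powr (- \<theta> - 1)"
    using assms True by (intro powr_mono2') auto
  then have "stein_phi0 \<theta> t x \<le> \<theta> * t powr \<theta> * t powr (- \<theta> - 1)"
    using assms True by (auto simp: stein_phi0_def intro!: mult_left_mono)
  also have "\<dots> = \<theta> / t"
    using assms by (simp add: powr_diff powr_minus field_simps)
  finally show ?thesis .
qed (use assms in \<open>auto simp: stein_phi0_def\<close>)

text \<open>For t < 1 both powers are at most 1; for larger t the bound is the height of the jump.
  This level is the constant against which \<phi>0 is split in
  \<open>stein_Psi_decomp\<close>.\<close>

lemma stein_phi0_le_of_ge_1:
  assumes "\<theta> > 0" "t > 0" "1 \<le> x"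
  shows "stein_phi0 \<theta> t x \<le> \<theta> / max 1 t"
proof (cases "t \<ge> 1")
  case False
  have "t powr \<theta> \<le> 1" using assms False by (intro powr_le1) auto
  moreover have "x powr (- \<theta> - 1) \<le> 1 powr (- \<theta> - 1)" using assms by (intro powr_mono2') auto
  ultimately have "\<theta> * (t powr \<theta> * x powr (- \<theta> - 1)) \<le> \<theta> * (1 * 1)"
    using assms by (intro mult_left_mono mult_mono) auto
  then show ?thesis using assms False by (auto simp: stein_phi0_def mult.assoc)
qed (use stein_phi0_le[OF assms(1,2)] in auto)

lemma stein_env_antimono:
  assumes "\<theta> > 0" "t > 0" "x \<le> y"
  shows "stein_env \<theta> t y \<le> stein_env \<theta> t x"
  using assms stein_phi0_antimono[of \<theta> t x y] stein_phi0_le[of \<theta> t] by (auto simp: stein_env_def)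

lemma stein_phi0_le_env: "\<theta> > 0 \<Longrightarrow> t > 0 \<Longrightarrow> stein_phi0 \<theta> t x \<le> stein_env \<theta> t x"
  using stein_phi0_le[of \<theta> t x] by (auto simp: stein_env_def)

lemma stein_env_nonneg: "\<theta> > 0 \<Longrightarrow> t > 0 \<Longrightarrow> 0 \<le> stein_env \<theta> t x"
  by (auto simp: stein_env_def stein_phi0_nonneg)

lemma stein_env_le: "\<theta> > 0 \<Longrightarrow> t > 0 \<Longrightarrow> stein_env \<theta> t x \<le> \<theta> / t"
  by (auto simp: stein_env_def stein_phi0_le)

text \<open>The series is shifted by one index, and the operator passes through the sum because all
  terms are nonnegative.\<close>

lemma stein_Psi_fixpoint:
  "stein_Psi \<theta> t x = dickman_op \<theta> (\<lambda>y. ennreal (stein_phi0 \<theta> t y) + stein_Psi \<theta> t y) x"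
proof -
  let ?p = "\<lambda>y. ennreal (stein_phi0 \<theta> t y)"
  have "(\<lambda>n. (dickman_op \<theta> ^^ n) ?p y) sums (stein_Psi \<theta> t y + (dickman_op \<theta> ^^ 0) ?p y)" for y
    unfolding stein_Psi_def by (intro sums_Suc summable_sums summableI)
  then have "(\<Sum>n. (dickman_op \<theta> ^^ n) ?p y) = ?p y + stein_Psi \<theta> t y" for y
    by (simp add: sums_iff add.commute)
  moreover have "stein_Psi \<theta> t x = dickman_op \<theta> (\<lambda>y. \<Sum>n. (dickman_op \<theta> ^^ n) ?p y) x"
    unfolding stein_Psi_def by (subst dickman_op_suminf) auto
  ultimately show ?thesis by simp
qed

text \<open>The exponent \<open>Suc n\<close> matters: u is controlled on [1, \<infinity>) only, and
  one application of the operator extends this to [0, \<infinity>).\<close>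

lemma dickman_op_iter_mono:
  assumes "\<And>y z. 1 \<le> y \<Longrightarrow> y \<le> z \<Longrightarrow> u y \<le> u z" "0 \<le> x" "x \<le> x'"
  shows "(dickman_op \<theta> ^^ Suc n) u x \<le> (dickman_op \<theta> ^^ Suc n) u x'"
  using assms(2,3)
proof (induction n arbitrary: x x')
  case 0
  then show ?case using dickman_op_mono_arg[OF assms(1)] by simp
next
  case (Suc n)
  have "dickman_op \<theta> ((dickman_op \<theta> ^^ Suc n) u) x \<le> dickman_op \<theta> ((dickman_op \<theta> ^^ Suc n) u) x'"
    by (rule dickman_op_mono_arg) (use Suc in auto)
  then show ?case by simp
qed

lemma dickman_op_iter_le:
  assumes "\<theta> > 0" "\<And>y. 1 \<le> y \<Longrightarrow> u y \<le> ennreal c" "c \<ge> 0" "0 \<le> x"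
  shows "(dickman_op \<theta> ^^ Suc n) u x \<le> ennreal (c * (\<theta> / (\<theta> + 1)) ^ Suc n)"
  using assms(4)
proof (induction n arbitrary: x)
  case 0
  have "dickman_op \<theta> u x \<le> dickman_op \<theta> (\<lambda>_. ennreal c) x"
    by (rule dickman_op_mono) (use assms 0 in auto)
  also have "\<dots> = ennreal (c * (\<theta> / (\<theta> + 1)))"
    using assms by (subst dickman_op_const) (auto simp: ennreal_mult simp del: times_divide_eq_right)
  finally show ?case by simp
next
  case (Suc n)
  let ?c = "c * (\<theta> / (\<theta> + 1)) ^ Suc n"
  have "dickman_op \<theta> ((dickman_op \<theta> ^^ Suc n) u) x \<le> dickman_op \<theta> (\<lambda>_. ennreal ?c) x"
    by (rule dickman_op_mono) (use Suc in auto)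
  also have "\<dots> = ennreal (?c * (\<theta> / (\<theta> + 1)))"
    using assms by (subst dickman_op_const) (auto simp: ennreal_mult[symmetric] simp del: times_divide_eq_right)
  finally show ?case by (simp add: mult_ac)
qed

lemma dickman_op_iter_add:
  assumes [measurable]: "u \<in> borel_measurable borel" "u' \<in> borel_measurable borel"
    and "\<And>y. 1 \<le> y \<Longrightarrow> u y + u' y = u'' y" "0 \<le> x"
  shows "(dickman_op \<theta> ^^ Suc n) u x + (dickman_op \<theta> ^^ Suc n) u' x = (dickman_op \<theta> ^^ Suc n) u'' x"
  using assms(4)
proof (induction n arbitrary: x)
  case 0
  then show ?case
    using dickman_op_cong[of "\<lambda>y. u y + u' y" u'' x \<theta>] assms(3) by (simp add: dickman_op_add)
next
  case (Suc n)
  have "dickman_op \<theta> ((dickman_op \<theta> ^^ Suc n) u) x + dickman_op \<theta> ((dickman_op \<theta> ^^ Suc n) u') x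
    = dickman_op \<theta> (\<lambda>y. (dickman_op \<theta> ^^ Suc n) u y + (dickman_op \<theta> ^^ Suc n) u' y) x"
    by (rule dickman_op_add[symmetric]) measurable
  also have "\<dots> = dickman_op \<theta> ((dickman_op \<theta> ^^ Suc n) u'') x"
    by (rule dickman_op_cong) (use Suc in auto)
  finally show ?case by simp
qed

text \<open>The operator preserves monotonicity and sums, so it is enough to split \<phi>0 on [1,
  \<infinity>). There \<phi>0 vanishes up to t, jumps and then decreases: it is the step function
  \<open>A0\<close> minus \<open>B0\<close>, where \<open>B0\<close> is nondecreasing because it is
  a constant minus \<phi>0 after the jump. The relation is stated as a sum since subtraction in
  \<open>ennreal\<close> is truncated.\<close>

lemma stein_Psi_decomp:
  assumes "\<theta> > 0" "t > 0"
  obtains a b :: "real \<Rightarrow> ennreal" where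
    "\<And>x y. 0 \<le> x \<Longrightarrow> x \<le> y \<Longrightarrow> a x \<le> a y"
    "\<And>x y. 0 \<le> x \<Longrightarrow> x \<le> y \<Longrightarrow> b x \<le> b y"
    "\<And>x. 0 \<le> x \<Longrightarrow> stein_Psi \<theta> t x + b x = a x"
    "\<And>x. 0 \<le> x \<Longrightarrow> a x \<le> ennreal (\<theta>\<^sup>2)"
proof -
  define A0 where "A0 = (\<lambda>y. ennreal (if t < y then \<theta> / max 1 t else 0))"
  define B0 where "B0 = (\<lambda>y. ennreal (if t < y then \<theta> / max 1 t - stein_phi0 \<theta> t y else 0))"
  have [measurable]: "A0 \<in> borel_measurable borel" "B0 \<in> borel_measurable borel"
    unfolding A0_def B0_def by measurable
  have A0_mono: "A0 y \<le> A0 z" if "1 \<le> y" "y \<le> z" for y z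
    using that assms by (auto simp: A0_def)
  have B0_mono: "B0 y \<le> B0 z" if "1 \<le> y" "y \<le> z" for y z
    using that assms stein_phi0_antimono[of \<theta> t y z] by (auto simp: B0_def intro!: ennreal_leI)
  have AB: "ennreal (stein_phi0 \<theta> t y) + B0 y = A0 y" if "1 \<le> y" for y
    using stein_phi0_le_of_ge_1[OF assms that] stein_phi0_nonneg[OF assms(1), of t y]
    by (auto simp: A0_def B0_def ennreal_plus[symmetric] stein_phi0_def simp del: ennreal_plus)
  have A0_le: "A0 y \<le> ennreal \<theta>" for y
    using assms by (auto simp: A0_def divide_le_eq intro!: ennreal_leI mult_left_le)
  define a where "a x = (\<Sum>n. (dickman_op \<theta> ^^ Suc n) A0 x)" for x
  define b where "b x = (\<Sum>n. (dickman_op \<theta> ^^ Suc n) B0 x)" for x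
  show thesis
  proof (rule that[of a b])
    fix x y :: real assume "0 \<le> x" "x \<le> y"
    then show "a x \<le> a y"
      unfolding a_def by (intro suminf_le dickman_op_iter_mono A0_mono summableI) auto
    show "b x \<le> b y"
      unfolding b_def using \<open>0 \<le> x\<close> \<open>x \<le> y\<close>
      by (intro suminf_le dickman_op_iter_mono B0_mono summableI) auto
  next
    fix x :: real assume x: "0 \<le> x"
    show "stein_Psi \<theta> t x + b x = a x"
      unfolding a_def b_def stein_Psi_def
      by (subst suminf_add[OF summableI summableI], intro suminf_cong dickman_op_iter_add AB x) auto
    \<comment> \<open>Each further iterate gains the factor r = E[V], so the sum is bounded by
      \<theta> r / (1 - r) = \<theta>^2.\<close>
    define r where "r = \<theta> / (\<theta> + 1)"
    have r: "0 \<le> r" "r < 1" using assms by (auto simp: r_def)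
    have "a x \<le> (\<Sum>n. ennreal (\<theta> * r * r ^ n))"
      unfolding a_def
    proof (intro suminf_le summableI)
      show "(dickman_op \<theta> ^^ Suc n) A0 x \<le> ennreal (\<theta> * r * r ^ n)" for n
        using dickman_op_iter_le[of \<theta> A0 \<theta> x n] A0_le x assms by (simp add: r_def mult_ac)
    qed
    also have "\<dots> = ennreal (\<Sum>n. \<theta> * r * r ^ n)"
      using r assms by (intro suminf_ennreal2 summable_mult summable_geometric) auto
    also have "(\<Sum>n. \<theta> * r * r ^ n) = \<theta> * r * (1 / (1 - r))"
      using r by (simp add: suminf_mult suminf_geometric summable_geometric)
    also have "\<dots> = \<theta>\<^sup>2"
      using assms by (simp add: r_def field_simps power2_eq_square)
    finally show "a x \<le> ennreal (\<theta>\<^sup>2)" .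
  qed
qed

lemma stein_Psi_le:
  assumes "\<theta> > 0" "t > 0" "0 \<le> x"
  shows "stein_Psi \<theta> t x \<le> ennreal (\<theta>\<^sup>2)"
proof (rule stein_Psi_decomp[OF assms(1,2)])
  fix a b :: "real \<Rightarrow> ennreal"
  assume "\<And>x. 0 \<le> x \<Longrightarrow> stein_Psi \<theta> t x + b x = a x" "\<And>x. 0 \<le> x \<Longrightarrow> a x \<le> ennreal (\<theta>\<^sup>2)"
  then have *: "stein_Psi \<theta> t x + b x = a x" "a x \<le> ennreal (\<theta>\<^sup>2)" using assms(3) by auto
  have "stein_Psi \<theta> t x \<le> stein_Psi \<theta> t x + b x" by simp
  with * show ?thesis by simp
qed

lemma ennreal_phi:
  assumes "\<theta> > 0" "t > 0" "0 \<le> x"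
  shows "ennreal (stein_phi \<theta> t x) = ennreal (stein_phi0 \<theta> t x) + stein_Psi \<theta> t x"
proof -
  have "stein_Psi \<theta> t x < \<infinity>" using stein_Psi_le[OF assms] by (simp add: le_less_trans)
  then show ?thesis using assms by (simp add: stein_phi_def stein_phi0_nonneg)
qed

lemma stein_phi_le_env:
  assumes "\<theta> > 0" "t > 0" "0 \<le> x"
  shows "stein_phi \<theta> t x \<le> \<theta>\<^sup>2 + stein_env \<theta> t x"
proof -
  have "enn2real (stein_Psi \<theta> t x) \<le> \<theta>\<^sup>2"
    using stein_Psi_le[OF assms] by (simp add: enn2real_leI)
  then show ?thesis using stein_phi0_le_env[OF assms(1,2), of x] by (simp add: stein_phi_def)
qed

lemma stein_phi_le_const:
  assumes "\<theta> > 0" "t > 0" "0 \<le> x"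
  shows "stein_phi \<theta> t x \<le> \<theta>\<^sup>2 + \<theta> / t"
  using stein_phi_le_env[OF assms] stein_env_le[OF assms(1,2), of x] by simp

text \<open>The upward jump of \<phi>0 at t is put into \<open>A\<close> and its later decrease into
  \<open>B\<close>. On [s, \<infinity>) a step of height \<open>stein_env \<theta> t s\<close>
  suffices, which is smaller than \<theta>/t when s lies beyond t. This gain is what makes the final
  bound involve env at the random point S.\<close>

lemma stein_phi_decomp:
  assumes "\<theta> > 0" "t > 0" "0 \<le> s"
  obtains A B :: "real \<Rightarrow> real" where
    "\<And>x y. s \<le> x \<Longrightarrow> x \<le> y \<Longrightarrow> A x \<le> A y"
    "\<And>x y. s \<le> x \<Longrightarrow> x \<le> y \<Longrightarrow> B x \<le> B y"
    "\<And>x. s \<le> x \<Longrightarrow> stein_phi \<theta> t x = A x - B x"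
    "\<And>x. s \<le> x \<Longrightarrow> 0 \<le> B x"
    "\<And>x. s \<le> x \<Longrightarrow> A x \<le> \<theta>\<^sup>2 + stein_env \<theta> t s"
proof (rule stein_Psi_decomp[OF assms(1,2)])
  fix a b :: "real \<Rightarrow> ennreal"
  assume a: "\<And>x y. 0 \<le> x \<Longrightarrow> x \<le> y \<Longrightarrow> a x \<le> a y"
    and b: "\<And>x y. 0 \<le> x \<Longrightarrow> x \<le> y \<Longrightarrow> b x \<le> b y"
    and ab: "\<And>x. 0 \<le> x \<Longrightarrow> stein_Psi \<theta> t x + b x = a x"
    and ale: "\<And>x. 0 \<le> x \<Longrightarrow> a x \<le> ennreal (\<theta>\<^sup>2)"
  define A where "A x = (if t < x then stein_env \<theta> t s else 0) + enn2real (a x)" for x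
  define B where "B x = (if t < x then stein_env \<theta> t s - stein_phi0 \<theta> t x else 0) + enn2real (b x)" for x
  have afin: "a x < \<infinity>" if "0 \<le> x" for x
    using ale[OF that] by (simp add: le_less_trans)
  have ble: "b x \<le> a x" "stein_Psi \<theta> t x \<le> a x" if "0 \<le> x" for x
    using ab[OF that, symmetric] by auto
  have bfin: "b x < \<infinity>" "stein_Psi \<theta> t x < \<infinity>" if "0 \<le> x" for x
    using ble[OF that] afin[OF that] by (auto simp: le_less_trans)
  have stein_phi0_G: "stein_phi0 \<theta> t x \<le> stein_env \<theta> t s" if "s \<le> x" for x
    using stein_phi0_le_env[OF assms(1,2), of x] stein_env_antimono[OF assms(1,2) that] by simp
  show thesis
  proof (rule that[of A B])
    fix x y :: real assume xy: "s \<le> x" "x \<le> y"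
    have "enn2real (a x) \<le> enn2real (a y)" "enn2real (b x) \<le> enn2real (b y)"
      using xy assms a[of x y] b[of x y] afin[of y] bfin[of y] by (auto intro!: enn2real_mono)
    then show "A x \<le> A y" "B x \<le> B y"
      using xy assms stein_env_nonneg[of \<theta> t s] stein_phi0_antimono[of \<theta> t x y] stein_phi0_G[of y]
      by (auto simp: A_def B_def intro!: add_mono add_increasing)
  next
    fix x :: real assume x: "s \<le> x"
    have "enn2real (stein_Psi \<theta> t x) + enn2real (b x) = enn2real (a x)"
      using ab[of x] bfin[of x] x assms by (simp add: enn2real_plus[symmetric])
    then show "stein_phi \<theta> t x = A x - B x"
      by (auto simp: stein_phi_def A_def B_def stein_phi0_def)
    show "0 \<le> B x" using stein_phi0_G[OF x] by (auto simp: B_def)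
    have "enn2real (a x) \<le> \<theta>\<^sup>2"
      using ale[of x] x assms by (intro enn2real_leI) auto
    then show "A x \<le> \<theta>\<^sup>2 + stein_env \<theta> t s"
      using stein_env_nonneg[OF assms(1,2), of s] by (auto simp: A_def)
  qed
qed

text \<open>With F(x) = P(V x > t) this is F + (x/\<theta>) F' = 1{x > t}, written with nonnegative
  terms.\<close>

lemma stein_phi0_identity:
  assumes "\<theta> > 0" "t > 0" "x > 0"
  shows "(\<integral>\<^sup>+y. ennreal (stein_phi0 \<theta> t y) * indicator {0<..<x} y \<partial>lborel)
    + ennreal (x / \<theta>) * ennreal (stein_phi0 \<theta> t x) + indicator {..t} x = 1"
proof (cases "x \<le> t")
  case True
  then have "(\<integral>\<^sup>+y. ennreal (stein_phi0 \<theta> t y) * indicator {0<..<x} y \<partial>lborel) = (\<integral>\<^sup>+y. 0 \<partial>(lborel::real measure))"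
    by (intro nn_integral_cong) (auto simp: stein_phi0_def indicator_def)
  with True show ?thesis by (simp add: stein_phi0_def)
next
  case False
  have "(\<integral>\<^sup>+y. ennreal (stein_phi0 \<theta> t y) * indicator {0<..<x} y \<partial>lborel)
    = (\<integral>\<^sup>+y. ennreal (\<theta> * t powr \<theta> * y powr (- \<theta> - 1)) * indicator {t<..<x} y \<partial>lborel)"
    using assms by (intro nn_integral_cong) (auto simp: stein_phi0_def indicator_def)
  also have "\<dots> = ennreal (- (t powr \<theta> * x powr (- \<theta>)) - (- (t powr \<theta> * t powr (- \<theta>))))"
    by (rule nn_integral_FTC_Ioo[where F = "\<lambda>y. - (t powr \<theta> * y powr (- \<theta>))"])
       (use assms False in \<open>auto intro!: continuous_intros derivative_eq_intros\<close>)
  also have "\<dots> = ennreal (1 - (t / x) powr \<theta>)"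
    using assms by (simp add: powr_minus powr_divide field_simps)
  finally have 1: "(\<integral>\<^sup>+y. ennreal (stein_phi0 \<theta> t y) * indicator {0<..<x} y \<partial>lborel) = ennreal (1 - (t / x) powr \<theta>)" .
  have "x / \<theta> * stein_phi0 \<theta> t x = (t / x) powr \<theta>"
    using assms False by (simp add: stein_phi0_def powr_diff powr_minus powr_divide field_simps)
  then have 2: "ennreal (x / \<theta>) * ennreal (stein_phi0 \<theta> t x) = ennreal ((t / x) powr \<theta>)"
    using assms by (subst ennreal_mult[symmetric]) (auto simp: stein_phi0_nonneg)
  have "(t / x) powr \<theta> \<le> 1" using assms False by (intro powr_le1) auto
  then show ?thesis using 1 2 False by (simp add: ennreal_plus[symmetric] del: ennreal_plus)
qed

text \<open>The identities for \<phi>0 and for the operator applied to \<phi> add up to an equation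
  between the integral over (0,x) and 1 plus the integral over (1,x+1). Adding the integral over
  (0,1) to both sides makes the integral over (0,x) a common term, which is cancelled. Every term
  stands on the side where it is positive, so that \<open>ennreal\<close> can be used
  throughout.\<close>

lemma stein_phi_identity:
  assumes "\<theta> > 0" "t > 0" "x \<ge> 0"
  shows "indicator {..t} x + ennreal (x / \<theta> * stein_phi \<theta> t x)
      + (\<integral>\<^sup>+y. ennreal (stein_phi \<theta> t y) * indicator {0<..<1} y \<partial>lborel)
    = 1 + (\<integral>\<^sup>+y. ennreal (stein_phi \<theta> t y) * indicator {x<..<x+1} y \<partial>lborel)"
proof (cases "x = 0")
  case True
  then show ?thesis using assms by simp
next
  case False
  then have x: "x > 0" using assms by simp
  let ?f = "\<lambda>y. ennreal (stein_phi \<theta> t y)"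
  let ?I = "\<lambda>a b. (\<integral>\<^sup>+y. ?f y * indicator {a<..<b} y \<partial>lborel)"
  have split: "?I a b + ?I b c = ?I a c" if "a \<le> b" "b \<le> c" for a b c
  proof -
    have "?I a c = (\<integral>\<^sup>+y. ?f y * indicator {a<..<b} y + ?f y * indicator {b<..<c} y \<partial>lborel)"
      by (intro nn_integral_cong_AE, use AE_lborel_singleton[of b] in eventually_elim)
         (use that in \<open>auto simp: indicator_def\<close>)
    then show ?thesis by (simp add: nn_integral_add)
  qed
  have stein_Psi_T: "stein_Psi \<theta> t y = dickman_op \<theta> ?f y" if "0 \<le> y" for y
    unfolding stein_Psi_fixpoint[of \<theta> t y] by (rule dickman_op_cong) (use assms that in \<open>auto simp: ennreal_phi\<close>)
  have "?I 0 x = (\<integral>\<^sup>+y. ennreal (stein_phi0 \<theta> t y) * indicator {0<..<x} y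
        + dickman_op \<theta> ?f y * indicator {0<..<x} y \<partial>lborel)"
    using assms by (intro nn_integral_cong) (auto simp: indicator_def ennreal_phi stein_Psi_T)
  then have I0: "?I 0 x = (\<integral>\<^sup>+y. ennreal (stein_phi0 \<theta> t y) * indicator {0<..<x} y \<partial>lborel)
      + (\<integral>\<^sup>+y. dickman_op \<theta> ?f y * indicator {0<..<x} y \<partial>lborel)"
    by (simp add: nn_integral_add)
  have "(\<integral>\<^sup>+y. ?f (y + 1) * indicator {0<..<x} y \<partial>lborel) = ?I 1 (x + 1)"
    by (subst (2) nn_integral_real_affine[where c = 1 and t = 1])
       (auto intro!: nn_integral_cong simp: indicator_def add.commute)
  with dickman_op_identity[of ?f \<theta> x] x assms
  have T: "(\<integral>\<^sup>+s. dickman_op \<theta> ?f s * indicator {0<..<x} s \<partial>lborel) + ennreal (x / \<theta>) * dickman_op \<theta> ?f x = ?I 1 (x + 1)"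
    by simp
  have xphi: "ennreal (x / \<theta> * stein_phi \<theta> t x)
      = ennreal (x / \<theta>) * ennreal (stein_phi0 \<theta> t x) + ennreal (x / \<theta>) * dickman_op \<theta> ?f x"
    using assms
    by (simp add: ennreal_mult stein_phi_nonneg ennreal_phi stein_Psi_T distrib_left del: times_divide_eq_left)
  have "?I 0 x + (indicator {..t} x + ennreal (x / \<theta> * stein_phi \<theta> t x))
    = ((\<integral>\<^sup>+y. ennreal (stein_phi0 \<theta> t y) * indicator {0<..<x} y \<partial>lborel)
        + ennreal (x / \<theta>) * ennreal (stein_phi0 \<theta> t x) + indicator {..t} x)
      + ((\<integral>\<^sup>+s. dickman_op \<theta> ?f s * indicator {0<..<x} s \<partial>lborel) + ennreal (x / \<theta>) * dickman_op \<theta> ?f x)"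
    unfolding I0 xphi by (simp add: ac_simps)
  then have "?I 0 x + (indicator {..t} x + ennreal (x / \<theta> * stein_phi \<theta> t x)) = 1 + ?I 1 (x + 1)"
    unfolding stein_phi0_identity[OF assms(1,2) x] T .
  then have "?I 0 x + (indicator {..t} x + ennreal (x / \<theta> * stein_phi \<theta> t x) + ?I 0 1)
    = 1 + (?I 0 1 + ?I 1 (x + 1))"
    by (simp add: add.assoc[symmetric])
  also have "?I 0 1 + ?I 1 (x + 1) = ?I 0 x + ?I x (x + 1)"
    using x by (simp add: split)
  finally have *: "?I 0 x + (indicator {..t} x + ennreal (x / \<theta> * stein_phi \<theta> t x) + ?I 0 1)
    = ?I 0 x + (1 + ?I x (x + 1))" by (simp add: ac_simps)
  \<comment> \<open>Cancellation in \<open>ennreal\<close> requires the common term to be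
    finite.\<close>
  have "?I 0 x \<le> (\<integral>\<^sup>+y. ennreal (\<theta>\<^sup>2 + \<theta> / t) * indicator {0<..<x} y \<partial>lborel)"
    using stein_phi_le_const[OF assms(1,2)]
    by (intro nn_integral_mono) (auto simp: indicator_def intro!: ennreal_leI)
  also have "\<dots> < \<infinity>"
    using x by (subst nn_integral_cmult) (auto simp: ennreal_mult_less_top)
  finally have "?I 0 x \<noteq> \<infinity>" by simp
  with * show ?thesis
    by (simp add: ennreal_add_left_cancel)
qed

section \<open>The generalized Dickman law\<close>

lemma nn_integral_Vdens_le:
  assumes "\<theta> > 0" "0 \<le> a" "a \<le> 1"
  shows "(\<integral>\<^sup>+v. Vdens \<theta> v * indicator {..a} v \<partial>lborel) = ennreal (a powr \<theta>)"
proof -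
  have "(\<integral>\<^sup>+v. Vdens \<theta> v * indicator {..a} v \<partial>lborel)
      = (\<integral>\<^sup>+v. ennreal (\<theta> * v powr (\<theta> - 1)) * indicator {0<..<a} v \<partial>lborel)"
    by (intro nn_integral_cong_AE, use AE_lborel_singleton[of a] in eventually_elim)
       (use assms in \<open>auto simp: Vdens_def indicator_def\<close>)
  also have "\<dots> = ennreal (a powr \<theta>)"
    using nn_integral_powr_Ioo[of \<theta> 0 a] assms by simp
  finally show ?thesis .
qed

lemma prob_space_Vdens: "\<theta> > 0 \<Longrightarrow> prob_space (density lborel (Vdens \<theta>))"
proof
  assume "\<theta> > 0"
  have "(\<integral>\<^sup>+v. Vdens \<theta> v * indicator UNIV v \<partial>lborel) = (\<integral>\<^sup>+v. Vdens \<theta> v * indicator {..1} v \<partial>lborel)"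
    by (intro nn_integral_cong) (auto simp: Vdens_def indicator_def)
  then show "emeasure (density lborel (Vdens \<theta>)) (space (density lborel (Vdens \<theta>))) = 1"
    using nn_integral_Vdens_le[of \<theta> 1] \<open>\<theta> > 0\<close> by (simp add: emeasure_density)
qed

lemma distr_uniform_powr:
  assumes "\<theta> > 0"
  shows "distr (uniform_measure lborel {0..1}) borel (\<lambda>u. u powr (1 / \<theta>)) = density lborel (Vdens \<theta>)"
    (is "?L = ?R")
proof -
  interpret U: prob_space "uniform_measure lborel {0..1::real}"
    by (rule prob_space_uniform_measure) auto
  interpret L: prob_space ?L by (rule U.prob_space_distr) simp
  interpret R: prob_space ?R by (rule prob_space_Vdens[OF assms])
  have "real_distribution ?L" "real_distribution ?R"
    by unfold_locales (auto simp: space_density)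
  moreover have "emeasure ?L {..x} = emeasure ?R {..x}" for x
  proof -
    have L: "emeasure ?L {..x} = emeasure lborel ({0..1} \<inter> {u. u powr (1 / \<theta>) \<le> x})"
      by (subst emeasure_distr) (auto simp: vimage_def divide_ennreal_def)
    have R: "emeasure ?R {..x} = (\<integral>\<^sup>+v. Vdens \<theta> v * indicator {..x} v \<partial>lborel)"
      by (simp add: emeasure_density)
    consider "x < 0" | "0 \<le> x" "x < 1" | "1 \<le> x" by linarith
    then show ?thesis
    proof cases
      case 1
      then have "\<not> u powr (1 / \<theta>) \<le> x" for u
        using powr_ge_zero[of u "1 / \<theta>"] by linarith
      then have "{0..1} \<inter> {u. u powr (1 / \<theta>) \<le> x} = {}" by simp
      moreover have "(\<integral>\<^sup>+v. Vdens \<theta> v * indicator {..x} v \<partial>lborel) = (\<integral>\<^sup>+v. 0 \<partial>(lborel::real measure))"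
        using 1 by (intro nn_integral_cong) (auto simp: Vdens_def indicator_def)
      ultimately show ?thesis unfolding L R by simp
    next
      case 2
      have "u powr (1 / \<theta>) \<le> x \<longleftrightarrow> u \<le> x powr \<theta>" if "0 \<le> u" for u
      proof
        assume "u powr (1 / \<theta>) \<le> x"
        then have "(u powr (1 / \<theta>)) powr \<theta> \<le> x powr \<theta>"
          using assms by (intro powr_mono2) auto
        then show "u \<le> x powr \<theta>" using that assms by (simp add: powr_powr)
      next
        assume "u \<le> x powr \<theta>"
        then have "u powr (1 / \<theta>) \<le> (x powr \<theta>) powr (1 / \<theta>)"
          using assms that by (intro powr_mono2) auto
        then show "u powr (1 / \<theta>) \<le> x" using 2 assms by (simp add: powr_powr)
      qed
      moreover have "x powr \<theta> \<le> 1" using 2 assms by (intro powr_le1) auto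
      ultimately have "{0..1} \<inter> {u. u powr (1 / \<theta>) \<le> x} = {0..x powr \<theta>}" by auto
      then show ?thesis unfolding L R using nn_integral_Vdens_le[of \<theta> x] 2 assms by simp
    next
      case 3
      have "u powr (1 / \<theta>) \<le> 1" if "0 \<le> u" "u \<le> 1" for u
        using that assms by (intro powr_le1) auto
      then have "{0..1} \<inter> {u. u powr (1 / \<theta>) \<le> x} = {0..1}" using 3 by fastforce
      moreover have "(\<integral>\<^sup>+v. Vdens \<theta> v * indicator {..x} v \<partial>lborel) = (\<integral>\<^sup>+v. Vdens \<theta> v * indicator {..1} v \<partial>lborel)"
        using 3 by (intro nn_integral_cong) (auto simp: Vdens_def indicator_def)
      ultimately show ?thesis unfolding L R using nn_integral_Vdens_le[of \<theta> 1] assms by simp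
    qed
  qed
  then have "cdf ?L = cdf ?R" by (auto simp: cdf_def measure_def)
  ultimately show ?thesis by (rule cdf_unique)
qed

locale dickman =
  fixes \<theta> :: real and D :: "real measure"
  assumes theta_pos: "\<theta> > 0" and gen_dickman: "gen_dickman \<theta> D"
begin

sublocale prob_space D
  using gen_dickman by (simp add: gen_dickman_def)

lemma sets_D [measurable_cong, simp]: "sets D = sets borel"
  using gen_dickman by (simp add: gen_dickman_def)

lemma space_D [simp]: "space D = UNIV"
  using sets_eq_imp_space_eq[OF sets_D] by simp

lemma emeasure_UNIV [simp]: "emeasure D UNIV = 1"
  using emeasure_space_1 by simp

lemma AE_nonneg: "AE x in D. 0 \<le> x"
  using gen_dickman by (simp add: gen_dickman_def)

text \<open>The distributional equation enters the later facts about \<open>D\<close> in this form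
  only, with the uniform variable replaced by V and its density.\<close>

lemma nn_integral_fixpoint:
  assumes [measurable]: "f \<in> borel_measurable borel"
  shows "(\<integral>\<^sup>+x. f x \<partial>D) = (\<integral>\<^sup>+d. \<integral>\<^sup>+v. Vdens \<theta> v * f (v * (d + 1)) \<partial>lborel \<partial>D)"
proof -
  let ?U = "uniform_measure lborel {0..1::real}"
  interpret U: prob_space ?U by (rule prob_space_uniform_measure) auto
  interpret UD: pair_sigma_finite ?U D ..
  have "(\<integral>\<^sup>+x. f x \<partial>D) = (\<integral>\<^sup>+x. f x \<partial>distr (?U \<Otimes>\<^sub>M D) borel (\<lambda>(u, d). u powr (1 / \<theta>) * (d + 1)))"
    using gen_dickman by (simp add: gen_dickman_def)
  also have "\<dots> = (\<integral>\<^sup>+z. f (fst z powr (1 / \<theta>) * (snd z + 1)) \<partial>(?U \<Otimes>\<^sub>M D))"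
    by (subst nn_integral_distr) (auto simp: case_prod_beta)
  also have "\<dots> = (\<integral>\<^sup>+d. \<integral>\<^sup>+u. f (u powr (1 / \<theta>) * (d + 1)) \<partial>?U \<partial>D)"
    by (subst UD.nn_integral_snd[symmetric]) auto
  also have "\<dots> = (\<integral>\<^sup>+d. \<integral>\<^sup>+v. Vdens \<theta> v * f (v * (d + 1)) \<partial>lborel \<partial>D)"
  proof (rule nn_integral_cong)
    fix d :: real
    have "(\<integral>\<^sup>+u. f (u powr (1 / \<theta>) * (d + 1)) \<partial>?U)
      = (\<integral>\<^sup>+v. f (v * (d + 1)) \<partial>distr ?U borel (\<lambda>u. u powr (1 / \<theta>)))"
      by (subst nn_integral_distr) auto
    also have "\<dots> = (\<integral>\<^sup>+v. Vdens \<theta> v * f (v * (d + 1)) \<partial>lborel)"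
      unfolding distr_uniform_powr[OF theta_pos] by (subst nn_integral_density) auto
    finally show "(\<integral>\<^sup>+u. f (u powr (1 / \<theta>) * (d + 1)) \<partial>?U) = \<dots>" .
  qed
  finally show ?thesis .
qed

section \<open>An explicit density of D and the Stein identity\<close>

definition tail_moment :: "real \<Rightarrow> ennreal" where
  "tail_moment s = (\<integral>\<^sup>+d. ennreal ((d + 1) powr (- \<theta>)) * indicator {s - 1<..} d \<partial>D)"

text \<open>Given D = d, the variable V (d + 1) has density \<theta> s^(\<theta>-1)
  (d+1)^(-\<theta>) on (0, d+1). Averaging this over d gives the formula, in which the dependence on
  s splits into a power and a nonincreasing factor.\<close>

definition rho :: "real \<Rightarrow> ennreal" where
  "rho s = ennreal (\<theta> * s powr (\<theta> - 1)) * indicator {0<..} s * tail_moment s"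

lemma tail_moment_measurable [measurable]: "tail_moment \<in> borel_measurable borel"
  unfolding tail_moment_def[abs_def] by measurable

lemma rho_measurable [measurable]: "rho \<in> borel_measurable borel"
  unfolding rho_def[abs_def] by measurable

lemma tail_moment_antimono: "s \<le> s' \<Longrightarrow> tail_moment s' \<le> tail_moment s"
  unfolding tail_moment_def by (intro nn_integral_mono mult_left_mono) (auto simp: indicator_def)

lemma nn_integral_D:
  assumes [measurable]: "f \<in> borel_measurable borel"
  shows "(\<integral>\<^sup>+x. f x \<partial>D) = (\<integral>\<^sup>+s. rho s * f s \<partial>lborel)"
proof -
  interpret DL: pair_sigma_finite D "lborel :: real measure" ..
  let ?k = "\<lambda>s d. ennreal (\<theta> * s powr (\<theta> - 1)) * indicator {0<..} s * (ennreal ((d + 1) powr (- \<theta>)) * indicator {s - 1<..} d) * f s"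
  have "(\<integral>\<^sup>+x. f x \<partial>D) = (\<integral>\<^sup>+d. \<integral>\<^sup>+v. Vdens \<theta> v * f (v * (d + 1)) \<partial>lborel \<partial>D)"
    by (rule nn_integral_fixpoint) simp
  also have "\<dots> = (\<integral>\<^sup>+d. \<integral>\<^sup>+s. ?k s d \<partial>lborel \<partial>D)"
  proof (rule nn_integral_cong_AE, use AE_nonneg in eventually_elim)
    fix d :: real assume d: "0 \<le> d"
    have "(\<integral>\<^sup>+s. ?k s d \<partial>lborel) = ennreal (d + 1) * (\<integral>\<^sup>+v. ?k ((d + 1) * v) d \<partial>lborel)"
      using d by (subst nn_integral_real_affine[where c = "d + 1" and t = 0]) auto
    also have "\<dots> = (\<integral>\<^sup>+v. ennreal (d + 1) * ?k ((d + 1) * v) d \<partial>lborel)"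
      by (rule nn_integral_cmult[symmetric]) simp
    also have "\<dots> = (\<integral>\<^sup>+v. Vdens \<theta> v * f (v * (d + 1)) \<partial>lborel)"
    proof (rule nn_integral_cong)
      fix v :: real
      show "ennreal (d + 1) * ?k ((d + 1) * v) d = Vdens \<theta> v * f (v * (d + 1))"
      proof (cases "0 < v \<and> v < 1")
        case True
        have "(d + 1) * (\<theta> * ((d + 1) * v) powr (\<theta> - 1)) * (d + 1) powr (- \<theta>)
            = \<theta> * v powr (\<theta> - 1) * ((d + 1) powr 1 * (d + 1) powr (\<theta> - 1) * (d + 1) powr (- \<theta>))"
          using True d by (simp add: powr_mult)
        also have "\<dots> = \<theta> * v powr (\<theta> - 1)"
          using d by (simp only: powr_add[symmetric]) simp
        finally have e: "(d + 1) * (\<theta> * ((d + 1) * v) powr (\<theta> - 1)) * (d + 1) powr (- \<theta>)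
            = \<theta> * v powr (\<theta> - 1)" .
        have "ennreal (d + 1) * ennreal (\<theta> * ((d + 1) * v) powr (\<theta> - 1)) * ennreal ((d + 1) powr (- \<theta>))
            = ennreal (\<theta> * v powr (\<theta> - 1))"
          using d theta_pos
          by (subst ennreal_mult[symmetric], simp, simp, subst ennreal_mult[symmetric], simp, simp)
             (simp only: e)
        moreover have "(d + 1) * v < (d + 1) * 1"
          using True d by (intro mult_strict_left_mono) auto
        then have "(d + 1) * v - 1 < d" by simp
        ultimately show ?thesis
          using True d by (simp add: Vdens_def zero_less_mult_iff mult.assoc[symmetric] mult.commute[of v])
      next
        case False
        moreover have "(d + 1) * 1 \<le> (d + 1) * v" if "1 \<le> v"
          using d that by (intro mult_left_mono) auto
        ultimately have "v \<le> 0 \<or> d \<le> (d + 1) * v - 1" by auto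
        then show ?thesis using False d
          by (auto simp: Vdens_def zero_less_mult_iff)
      qed
    qed
    finally show "(\<integral>\<^sup>+v. Vdens \<theta> v * f (v * (d + 1)) \<partial>lborel) = (\<integral>\<^sup>+s. ?k s d \<partial>lborel)" by simp
  qed
  also have "\<dots> = (\<integral>\<^sup>+s. \<integral>\<^sup>+d. ?k s d \<partial>D \<partial>lborel)"
    by (rule DL.Fubini'[symmetric]) simp
  also have "\<dots> = (\<integral>\<^sup>+s. rho s * f s \<partial>lborel)"
    unfolding rho_def tail_moment_def by (simp add: nn_integral_cmult nn_integral_multc)
  finally show ?thesis .
qed

lemma D_eq_density: "D = density lborel rho"
proof (rule measure_eqI)
  fix A assume "A \<in> sets D"
  then show "emeasure D A = emeasure (density lborel rho) A"
    using nn_integral_D[of "indicator A"] by (simp add: emeasure_density)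
qed simp

text \<open>P(V (D + 1) \<le> s) is split according to whether D \<le> s - 1, where the event is
  certain, or D > s - 1, where it has conditional probability (s/(D+1))^\<theta>. Together with the
  formula for \<open>rho\<close> this is the delay equation s rho(s) = \<theta> P(s - 1 < D \<le>
  s).\<close>

lemma emeasure_window:
  assumes "s > 0"
  shows "emeasure D {s - 1<..s} = ennreal (s powr \<theta>) * tail_moment s"
proof -
  have "emeasure D {..s} = (\<integral>\<^sup>+d. \<integral>\<^sup>+v. Vdens \<theta> v * indicator {..s} (v * (d + 1)) \<partial>lborel \<partial>D)"
    using nn_integral_fixpoint[of "indicator {..s}"] by simp
  also have "\<dots> = (\<integral>\<^sup>+d. indicator {..s - 1} d
      + ennreal (s powr \<theta>) * (ennreal ((d + 1) powr (- \<theta>)) * indicator {s - 1<..} d) \<partial>D)"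
  proof (rule nn_integral_cong_AE, use AE_nonneg in eventually_elim)
    fix d :: real assume d: "0 \<le> d"
    define a where "a = min 1 (s / (d + 1))"
    have "(\<integral>\<^sup>+v. Vdens \<theta> v * indicator {..s} (v * (d + 1)) \<partial>lborel) = (\<integral>\<^sup>+v. Vdens \<theta> v * indicator {..a} v \<partial>lborel)"
      using d by (intro nn_integral_cong) (auto simp: Vdens_def indicator_def a_def field_simps)
    also have "\<dots> = ennreal (a powr \<theta>)"
      using d assms theta_pos by (intro nn_integral_Vdens_le) (auto simp: a_def)
    also have "\<dots> = indicator {..s - 1} d
      + ennreal (s powr \<theta>) * (ennreal ((d + 1) powr (- \<theta>)) * indicator {s - 1<..} d)"
    proof (cases "d + 1 \<le> s")
      case True
      then have "a = 1" using d by (auto simp: a_def min_def field_simps)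
      then show ?thesis using True by simp
    next
      case False
      then have "a = s / (d + 1)" using d by (auto simp: a_def min_def field_simps)
      then have "a powr \<theta> = s powr \<theta> * (d + 1) powr (- \<theta>)"
        using d assms by (simp add: powr_divide powr_minus_divide)
      then show ?thesis using False by (simp add: ennreal_mult)
    qed
    finally show "(\<integral>\<^sup>+v. Vdens \<theta> v * indicator {..s} (v * (d + 1)) \<partial>lborel) = \<dots>" .
  qed
  also have "\<dots> = emeasure D {..s - 1} + ennreal (s powr \<theta>) * tail_moment s"
    unfolding tail_moment_def by (simp add: nn_integral_add nn_integral_cmult)
  finally have "emeasure D {..s} = emeasure D {..s - 1} + ennreal (s powr \<theta>) * tail_moment s" .
  moreover have "emeasure D {..s} = emeasure D {..s - 1} + emeasure D {s - 1<..s}"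
    by (subst plus_emeasure) (auto intro!: arg_cong[where f = "emeasure D"])
  ultimately show ?thesis by (simp add: ennreal_add_left_cancel)
qed

text \<open>By the delay equation, (s/\<theta>) rho(s) is the probability of s - 1 < D \<le> s.
  Exchanging the integrals reads this condition as D \<le> s < D + 1.\<close>

lemma stein_identity:
  assumes [measurable]: "u \<in> borel_measurable borel"
  shows "(\<integral>\<^sup>+x. ennreal (x / \<theta>) * u x \<partial>D)
    = (\<integral>\<^sup>+x. \<integral>\<^sup>+y. u y * indicator {x<..<x + 1} y \<partial>lborel \<partial>D)"
proof -
  interpret DL: pair_sigma_finite D "lborel :: real measure" ..
  have "(\<integral>\<^sup>+x. ennreal (x / \<theta>) * u x \<partial>D) = (\<integral>\<^sup>+s. rho s * (ennreal (s / \<theta>) * u s) \<partial>lborel)"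
    by (rule nn_integral_D) simp
  also have "\<dots> = (\<integral>\<^sup>+s. \<integral>\<^sup>+d. u s * indicator {0<..} s * indicator {s - 1<..s} d \<partial>D \<partial>lborel)"
  proof (rule nn_integral_cong)
    fix s :: real
    show "rho s * (ennreal (s / \<theta>) * u s) = (\<integral>\<^sup>+d. u s * indicator {0<..} s * indicator {s - 1<..s} d \<partial>D)"
    proof (cases "s > 0")
      case True
      have "ennreal (\<theta> * s powr (\<theta> - 1)) * ennreal (s / \<theta>) = ennreal (s powr \<theta>)"
        using True theta_pos by (simp add: ennreal_mult[symmetric] powr_diff)
      then have "rho s * (ennreal (s / \<theta>) * u s) = ennreal (s powr \<theta>) * tail_moment s * u s"
        using True unfolding rho_def by (simp add: mult_ac)
      also have "\<dots> = emeasure D {s - 1<..s} * u s" using emeasure_window[OF True] by simp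
      finally show ?thesis using True by (simp add: nn_integral_cmult mult.commute)
    qed (simp add: rho_def)
  qed
  also have "\<dots> = (\<integral>\<^sup>+d. \<integral>\<^sup>+s. u s * indicator {0<..} s * indicator {s - 1<..s} d \<partial>lborel \<partial>D)"
    by (rule DL.Fubini') simp
  also have "\<dots> = (\<integral>\<^sup>+x. \<integral>\<^sup>+y. u y * indicator {x<..<x + 1} y \<partial>lborel \<partial>D)"
  proof (rule nn_integral_cong_AE, use AE_nonneg in eventually_elim)
    fix d :: real assume d: "0 \<le> d"
    show "(\<integral>\<^sup>+s. u s * indicator {0<..} s * indicator {s - 1<..s} d \<partial>lborel)
      = (\<integral>\<^sup>+y. u y * indicator {d<..<d + 1} y \<partial>lborel)"
      by (intro nn_integral_cong_AE, use AE_lborel_singleton[of d] in eventually_elim)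
         (use d in \<open>auto simp: indicator_def\<close>)
  qed
  finally show ?thesis .
qed

text \<open>When \<open>stein_phi_identity\<close> is integrated over D, the term with x \<phi>(x)
  and the integral over (x,x+1) agree by \<open>stein_identity\<close>. What remains is P(D \<le> t)
  plus the integral of \<phi> over (0,1), equal to 1. Thus the constant of the Stein equation is
  found without computing the distribution function of D.\<close>

lemma stein_phi_identity_D:
  assumes "t > 0" "x \<ge> 0"
  shows "indicator {..t} x + ennreal (x / \<theta> * stein_phi \<theta> t x)
    = emeasure D {..t} + (\<integral>\<^sup>+y. ennreal (stein_phi \<theta> t y) * indicator {x<..<x+1} y \<partial>lborel)"
proof -
  let ?I = "\<lambda>a. (\<integral>\<^sup>+y. ennreal (stein_phi \<theta> t y) * indicator {a<..<a + 1} y \<partial>lborel)"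
  have Ile: "?I a \<le> ennreal (\<theta>\<^sup>2 + \<theta> / t)" if "0 \<le> a" for a
  proof -
    have "?I a \<le> (\<integral>\<^sup>+y. ennreal (\<theta>\<^sup>2 + \<theta> / t) * indicator {a<..<a + 1} y \<partial>lborel)"
      using stein_phi_le_const[OF theta_pos \<open>t > 0\<close>] that
      by (intro nn_integral_mono) (auto simp: indicator_def intro!: ennreal_leI)
    also have "\<dots> = ennreal (\<theta>\<^sup>2 + \<theta> / t)" by (subst nn_integral_cmult) auto
    finally show ?thesis .
  qed
  have J: "(\<integral>\<^sup>+x. ?I x \<partial>D) < \<infinity>"
  proof -
    have "(\<integral>\<^sup>+x. ?I x \<partial>D) \<le> (\<integral>\<^sup>+x. ennreal (\<theta>\<^sup>2 + \<theta> / t) \<partial>D)"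
      by (rule nn_integral_mono_AE, use AE_nonneg in eventually_elim) (rule Ile)
    also have "\<dots> < \<infinity>" by (simp add: emeasure_space_1)
    finally show ?thesis .
  qed
  have st: "indicator {..t} x + ennreal (x / \<theta> * stein_phi \<theta> t x) + ?I 0 = 1 + ?I x" if "0 \<le> x" for x
    using stein_phi_identity[OF theta_pos \<open>t > 0\<close> that] by simp
  have "emeasure D {..t} + (\<integral>\<^sup>+x. ?I x \<partial>D) + ?I 0
    = (\<integral>\<^sup>+x. indicator {..t} x + ennreal (x / \<theta>) * ennreal (stein_phi \<theta> t x) + ?I 0 \<partial>D)"
    using stein_identity[of "\<lambda>x. ennreal (stein_phi \<theta> t x)"]
    by (simp add: nn_integral_add emeasure_space_1)
  also have "\<dots> = (\<integral>\<^sup>+x. 1 + ?I x \<partial>D)"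
  proof (rule nn_integral_cong_AE, use AE_nonneg in eventually_elim)
    fix x :: real assume "0 \<le> x"
    then show "indicator {..t} x + ennreal (x / \<theta>) * ennreal (stein_phi \<theta> t x) + ?I 0 = 1 + ?I x"
      using st[of x] theta_pos by (simp add: ennreal_mult[symmetric] stein_phi_nonneg)
  qed
  also have "\<dots> = 1 + (\<integral>\<^sup>+x. ?I x \<partial>D)"
    by (simp add: nn_integral_add emeasure_space_1)
  finally have "(\<integral>\<^sup>+x. ?I x \<partial>D) + (emeasure D {..t} + ?I 0) = (\<integral>\<^sup>+x. ?I x \<partial>D) + 1"
    by (simp add: ac_simps)
  with J have c: "emeasure D {..t} + ?I 0 = 1" by (auto simp: ennreal_add_left_cancel)
  have "?I 0 + (indicator {..t} x + ennreal (x / \<theta> * stein_phi \<theta> t x)) = ?I 0 + (emeasure D {..t} + ?I x)"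
    using st[OF assms(2)] unfolding c[symmetric] by (simp add: ac_simps)
  moreover have "?I 0 < \<infinity>" using Ile[of 0] by (simp add: le_less_trans)
  ultimately show ?thesis by (auto simp: ennreal_add_left_cancel)
qed

section \<open>Upper bounds for interval probabilities of D\<close>

lemma measure_atMost_le_powr:
  assumes "t > 0"
  shows "measure D {..t} \<le> t powr \<theta>"
proof (cases "t \<ge> 1")
  case True
  then have "1 \<le> t powr \<theta>" using theta_pos by (simp add: ge_one_powr_ge_zero)
  then show ?thesis using prob_le_1[of "{..t}"] by linarith
next
  case False
  have "emeasure D {..t} = (\<integral>\<^sup>+d. \<integral>\<^sup>+v. Vdens \<theta> v * indicator {..t} (v * (d + 1)) \<partial>lborel \<partial>D)"
    using nn_integral_fixpoint[of "indicator {..t}"] by simp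
  also have "\<dots> \<le> (\<integral>\<^sup>+d. ennreal (t powr \<theta>) \<partial>D)"
  proof (rule nn_integral_mono_AE, use AE_nonneg in eventually_elim)
    fix d :: real assume d: "0 \<le> d"
    \<comment> \<open>Since V (D + 1) is at least V, it can be at most t only if V is, which has
      probability t^\<theta>.\<close>
    have *: "v \<le> v * (d + 1)" if "0 < v" for v using that d by simp
    have "(\<integral>\<^sup>+v. Vdens \<theta> v * indicator {..t} (v * (d + 1)) \<partial>lborel) \<le> (\<integral>\<^sup>+v. Vdens \<theta> v * indicator {..t} v \<partial>lborel)"
      by (intro nn_integral_mono) (auto simp: Vdens_def indicator_def dest: order_trans[OF *])
    also have "\<dots> = ennreal (t powr \<theta>)"
      using False assms theta_pos by (intro nn_integral_Vdens_le) auto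
    finally show "(\<integral>\<^sup>+v. Vdens \<theta> v * indicator {..t} (v * (d + 1)) \<partial>lborel) \<le> ennreal (t powr \<theta>)" .
  qed
  also have "\<dots> = ennreal (t powr \<theta>)" by (simp add: emeasure_space_1)
  finally show ?thesis by (simp add: emeasure_eq_measure)
qed

lemma emeasure_D: "A \<in> sets borel \<Longrightarrow> emeasure D A = (\<integral>\<^sup>+s. rho s * indicator A s \<partial>lborel)"
  using nn_integral_D[of "indicator A"] by simp

lemma measure_atMost_eq: "measure D {..t} = measure D {0<..t}"
proof -
  have "emeasure D {..t} = emeasure D {0<..t}"
    by (subst (1 2) emeasure_D) (auto intro!: nn_integral_cong simp: rho_def indicator_def)
  then show ?thesis by (simp add: measure_def)
qed

text \<open>For \<theta> < 1 both factors of \<open>rho\<close> are nonincreasing on (0,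
  \<infinity>), so among intervals of length t the one starting at 0 carries the most mass.\<close>

lemma measure_interval_le_powr:
  assumes "\<theta> < 1" "t > 0" "x \<ge> 0"
  shows "measure D {x<..x + t} \<le> t powr \<theta>"
proof -
  have "emeasure D {x<..x + t} = (\<integral>\<^sup>+s. rho s * indicator {x<..x + t} s \<partial>lborel)"
    by (simp add: emeasure_D)
  also have "\<dots> = (\<integral>\<^sup>+s. rho (x + s) * indicator {x<..x + t} (x + s) \<partial>lborel)"
    by (subst nn_integral_real_affine[where c = 1 and t = x]) auto
  also have "\<dots> \<le> (\<integral>\<^sup>+s. rho s * indicator {..t} s \<partial>lborel)"
  proof (rule nn_integral_mono)
    fix s :: real
    show "rho (x + s) * indicator {x<..x + t} (x + s) \<le> rho s * indicator {..t} s"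
    proof (cases "0 < s")
      case True
      have "(x + s) powr (\<theta> - 1) \<le> s powr (\<theta> - 1)"
        using assms True by (intro powr_mono2') auto
      then have "rho (x + s) \<le> rho s"
        unfolding rho_def using True assms theta_pos tail_moment_antimono[of s "x + s"]
        by (auto intro!: mult_mono ennreal_leI)
      then show ?thesis by (auto simp: indicator_def)
    qed simp
  qed
  also have "\<dots> = emeasure D {..t}" by (simp add: emeasure_D)
  finally have "measure D {x<..x + t} \<le> measure D {..t}" by (simp add: emeasure_eq_measure)
  then show ?thesis using measure_atMost_le_powr[OF \<open>t > 0\<close>] by simp
qed

text \<open>On \<open>(0,1]\<close> the density \<open>rho\<close> is at most \<open>\<theta> * tail_moment 0\<close>, which is its limit at \<open>1\<close>
  from the right. Thus the constant \<open>exp (- \<theta> \<gamma>) / \<Gamma> \<theta>\<close> never has to be identified.\<close>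

lemma rho_le_of_density_le:
  assumes \<theta>: "\<theta> \<ge> 1"
    and [measurable]: "p \<in> borel_measurable borel"
    and D: "D = density lborel (\<lambda>x. ennreal (p x))"
    and \<kappa>: "\<And>x. 1 \<le> x \<Longrightarrow> p x \<le> \<kappa>"
  shows "AE s in lborel. rho s \<le> ennreal \<kappa>"
proof -
  have "AE s in lborel. rho s = ennreal (p s)"
    by (rule sigma_finite_measure.density_unique[OF sigma_finite_lborel])
       (simp, simp, rule trans[OF D_eq_density[symmetric] D])
  then have ge1: "AE s in lborel. 1 \<le> s \<longrightarrow> rho s \<le> ennreal \<kappa>"
    by eventually_elim (use \<kappa> in \<open>auto intro!: ennreal_leI\<close>)
  \<comment> \<open>The densities agree almost everywhere only, so the bound is read off at some
    point slightly to the right of 1 and carried over to 1 + \<eta> by monotonicity of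
    \<open>tail_moment\<close>.\<close>
  have "ennreal \<theta> * tail_moment (1 + \<eta>) \<le> ennreal \<kappa>" if "\<eta> > 0" for \<eta>
  proof -
    have "\<exists>s\<in>{1<..<1 + \<eta>}. 1 \<le> s \<longrightarrow> rho s \<le> ennreal \<kappa>"
    proof (rule ccontr)
      assume "\<not> ?thesis"
      with ge1 have "AE s in lborel. s \<notin> {1<..<1 + \<eta>}" by (auto elim: eventually_mono)
      then have "emeasure lborel {1<..<1 + \<eta>} = 0"
        by (subst (asm) AE_iff_measurable[where N = "{1<..<1 + \<eta>}"]) auto
      then show False using that by simp
    qed
    then obtain s where s: "1 < s" "s < 1 + \<eta>" "rho s \<le> ennreal \<kappa>" by auto
    have "\<theta> * 1 \<le> \<theta> * s powr (\<theta> - 1)"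
      using s \<theta> by (intro mult_left_mono ge_one_powr_ge_zero) auto
    then have "ennreal \<theta> * tail_moment (1 + \<eta>) \<le> ennreal (\<theta> * s powr (\<theta> - 1)) * tail_moment s"
      using s by (intro mult_mono ennreal_leI tail_moment_antimono) auto
    with s show ?thesis by (auto simp: rho_def)
  qed
  note tail_moment_le = this
  \<comment> \<open>\<open>tail_moment 0\<close> and the limit of \<open>tail_moment\<close> at 1
    from the right differ only by the contribution of -1 < D \<le> 0, a null event.\<close>
  have pos: "AE d in D. 0 < d"
    by (subst D_eq_density, subst AE_density) (auto simp: rho_def indicator_def)
  have "tail_moment 0 \<le> (SUP n. tail_moment (1 + 1 / real (Suc n)))"
  proof -
    let ?f = "\<lambda>n d. ennreal ((d + 1) powr (- \<theta>)) * indicator {1 / real (Suc n)<..} d"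
    have "tail_moment 0 \<le> (\<integral>\<^sup>+d. (SUP n. ?f n d) \<partial>D)"
      unfolding tail_moment_def
    proof (rule nn_integral_mono_AE, use pos in eventually_elim)
      fix d :: real assume "0 < d"
      then obtain n where "1 / real (Suc n) < d"
        using nat_approx_posE by blast
      then show "ennreal ((d + 1) powr (- \<theta>)) * indicator {0 - 1<..} d \<le> (SUP n. ?f n d)"
        by (intro SUP_upper2[of n]) (auto simp: indicator_def)
    qed
    also have "\<dots> = (SUP n. \<integral>\<^sup>+d. ?f n d \<partial>D)"
    proof (rule nn_integral_monotone_convergence_SUP)
      show "incseq ?f"
      proof (intro incseq_SucI le_funI mult_left_mono)
        fix n and d :: real
        have "1 / real (Suc (Suc n)) \<le> 1 / real (Suc n)" by (simp add: field_simps)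
        then show "indicator {1 / real (Suc n)<..} d \<le> (indicator {1 / real (Suc (Suc n))<..} d :: ennreal)"
          by (auto simp: indicator_def simp del: of_nat_Suc)
      qed simp
    qed simp
    finally show ?thesis by (simp add: tail_moment_def)
  qed
  then have "ennreal \<theta> * tail_moment 0 \<le> ennreal \<theta> * (SUP n. tail_moment (1 + 1 / real (Suc n)))"
    by (rule mult_left_mono) simp
  also have "\<dots> = (SUP n. ennreal \<theta> * tail_moment (1 + 1 / real (Suc n)))"
    by (simp add: SUP_mult_left_ennreal)
  also have "\<dots> \<le> ennreal \<kappa>"
    by (intro SUP_least tail_moment_le) simp
  finally have H0: "ennreal \<theta> * tail_moment 0 \<le> ennreal \<kappa>" .
  show ?thesis
    using ge1
  proof eventually_elim
    fix s :: real assume s: "1 \<le> s \<longrightarrow> rho s \<le> ennreal \<kappa>"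
    show "rho s \<le> ennreal \<kappa>"
    proof (cases "0 < s \<and> s < 1")
      case True
      have "s powr (\<theta> - 1) \<le> 1" using True \<theta> by (intro powr_le1) auto
      then have "rho s \<le> ennreal \<theta> * tail_moment 0"
        unfolding rho_def using True \<theta> theta_pos tail_moment_antimono[of 0 s]
        by (auto intro!: mult_mono ennreal_leI mult_left_le)
      with H0 show ?thesis by simp
    qed (use s in \<open>auto simp: rho_def\<close>)
  qed
qed

lemma measure_interval_le_linear:
  assumes "\<theta> \<ge> 1" "p \<in> borel_measurable borel" "D = density lborel (\<lambda>x. ennreal (p x))"
    and "\<And>x. 1 \<le> x \<Longrightarrow> p x \<le> \<kappa>" "\<kappa> > 0" "t > 0"
  shows "measure D {x<..x + t} \<le> \<kappa> * t"
proof -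
  have "emeasure D {x<..x + t} = (\<integral>\<^sup>+s. rho s * indicator {x<..x + t} s \<partial>lborel)"
    by (simp add: emeasure_D)
  also have "\<dots> \<le> (\<integral>\<^sup>+s. ennreal \<kappa> * indicator {x<..x + t} s \<partial>lborel)"
  proof (rule nn_integral_mono_AE)
    have "AE s in lborel. rho s \<le> ennreal \<kappa>"
      by (rule rho_le_of_density_le) (use assms in auto)
    then show "AE s in lborel. rho s * indicator {x<..x + t} s \<le> ennreal \<kappa> * indicator {x<..x + t} s"
      by eventually_elim (auto intro!: mult_right_mono)
  qed
  also have "\<dots> = ennreal (\<kappa> * t)"
    using assms by (subst nn_integral_cmult) (auto simp: ennreal_mult)
  finally show ?thesis using assms(5,6) by (simp add: emeasure_eq_measure)
qed

end

lemma stein_phi_integrable_on: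
  assumes "\<theta> > 0" "t > 0" "0 \<le> a"
  shows "stein_phi \<theta> t integrable_on {a..b}"
proof (rule measurable_bounded_by_integrable_imp_integrable)
  show "stein_phi \<theta> t \<in> borel_measurable (lebesgue_on {a..b})"
    by (intro borel_measurable_if_D measurable_completion measurable_restrict_space1) simp
  show "(\<lambda>_. \<theta>\<^sup>2 + \<theta> / t) integrable_on {a..b}" by (rule integrable_const_ivl)
  show "norm (stein_phi \<theta> t x) \<le> \<theta>\<^sup>2 + \<theta> / t" if "x \<in> {a..b}" for x
    using stein_phi_le_const[of \<theta> t x] stein_phi_nonneg[of \<theta> t x] assms that by simp
qed simp

lemma (in dickman) stein_equation:
  assumes "t > 0" "x \<ge> 0"
  shows "integral {x..x + 1} (stein_phi \<theta> t) = indicator {..t} x + x / \<theta> * stein_phi \<theta> t x - measure D {..t}"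
proof -
  have "(stein_phi \<theta> t has_integral integral {x..x + 1} (stein_phi \<theta> t)) {x..x + 1}"
    by (intro integrable_integral stein_phi_integrable_on theta_pos assms)
  then have I: "(\<integral>\<^sup>+y. ennreal (stein_phi \<theta> t y) * indicator {x<..<x+1} y \<partial>lborel)
      = ennreal (integral {x..x + 1} (stein_phi \<theta> t))"
    by (intro nn_integral_Ioo_has_integral) (auto simp: stein_phi_nonneg theta_pos)
  have nn: "0 \<le> integral {x..x + 1} (stein_phi \<theta> t)" "0 \<le> x / \<theta> * stein_phi \<theta> t x"
    using theta_pos assms by (auto intro!: integral_nonneg stein_phi_integrable_on stein_phi_nonneg divide_nonneg_nonneg mult_nonneg_nonneg)
  have "ennreal (indicator {..t} x + x / \<theta> * stein_phi \<theta> t x)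
    = ennreal (measure D {..t} + integral {x..x + 1} (stein_phi \<theta> t))"
    using stein_phi_identity_D[OF assms] nn unfolding I
    by (simp add: emeasure_eq_measure ennreal_indicator[symmetric] ennreal_plus[symmetric]
        del: ennreal_plus ennreal_indicator)
  then show ?thesis using nn by (subst (asm) ennreal_inj) auto
qed

section \<open>Pointwise estimates for deterministic weights\<close>

text \<open>Summation by parts: partial sums of d are bounded by K, increments of f by those of A
  and B. The boundary term stays on the left so that its bound can later be combined with the
  variation on the right.\<close>

lemma abel_sum_bound:
  fixes d f A B :: "nat \<Rightarrow> real"
  assumes P: "\<And>k. k \<in> {1..n} \<Longrightarrow> \<bar>\<Sum>j=1..k. d j\<bar> \<le> K"
    and f: "\<And>k. f k = A k - B k"
    and A: "\<And>k. k \<in> {2..n} \<Longrightarrow> A (k - 1) \<le> A k"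
    and B: "\<And>k. k \<in> {2..n} \<Longrightarrow> B (k - 1) \<le> B k"
    and "1 \<le> m" "m \<le> n"
  shows "\<bar>(\<Sum>k=1..m. d k * f k) - (\<Sum>k=1..m. d k) * f m\<bar> \<le> K * (A m - A 1 + B m - B 1)"
  using \<open>1 \<le> m\<close> \<open>m \<le> n\<close>
proof (induction m rule: dec_induct)
  case (step m)
  have K: "\<bar>\<Sum>k=1..m. d k\<bar> \<le> K" using step P by auto
  have AB: "A m \<le> A (Suc m)" "B m \<le> B (Suc m)" using A[of "Suc m"] B[of "Suc m"] step by auto
  have "(\<Sum>k=1..Suc m. d k * f k) - (\<Sum>k=1..Suc m. d k) * f (Suc m)
    = ((\<Sum>k=1..m. d k * f k) - (\<Sum>k=1..m. d k) * f m) - (\<Sum>k=1..m. d k) * (f (Suc m) - f m)"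
    by (simp add: algebra_simps)
  also have "\<bar>\<dots>\<bar> \<le> K * (A m - A 1 + B m - B 1) + K * (A (Suc m) - A m + B (Suc m) - B m)"
  proof (rule order_trans[OF abs_triangle_ineq4 add_mono])
    show "\<bar>(\<Sum>k=1..m. d k * f k) - (\<Sum>k=1..m. d k) * f m\<bar> \<le> K * (A m - A 1 + B m - B 1)"
      using step by simp
    show "\<bar>(\<Sum>k=1..m. d k) * (f (Suc m) - f m)\<bar> \<le> K * (A (Suc m) - A m + B (Suc m) - B m)"
      unfolding abs_mult using AB by (intro mult_mono K order_trans[OF abs_ge_zero K]) (auto simp: f)
  qed
  finally show ?case by (simp add: algebra_simps)
qed simp

text \<open>On [a,b], \<phi> = A - B differs from its value at b by at most the increase of A in one
  direction and of B in the other. Keeping the two directions apart costs one variation instead of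
  the sum of two.\<close>

lemma stein_phi_riemann_interval:
  fixes A B :: "real \<Rightarrow> real"
  assumes "\<theta> > 0" "t > 0" "0 \<le> s" "s \<le> a" "a \<le> b"
    and A: "\<And>x y. s \<le> x \<Longrightarrow> x \<le> y \<Longrightarrow> A x \<le> A y"
    and B: "\<And>x y. s \<le> x \<Longrightarrow> x \<le> y \<Longrightarrow> B x \<le> B y"
    and AB: "\<And>x. s \<le> x \<Longrightarrow> stein_phi \<theta> t x = A x - B x"
  shows "(b - a) * stein_phi \<theta> t b - integral {a..b} (stein_phi \<theta> t) \<le> (b - a) * (A b - A a)"
    and "- ((b - a) * (B b - B a)) \<le> (b - a) * stein_phi \<theta> t b - integral {a..b} (stein_phi \<theta> t)"
proof -
  have int: "stein_phi \<theta> t integrable_on {a..b}" using assms by (intro stein_phi_integrable_on) auto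
  have "integral {a..b} (\<lambda>_. stein_phi \<theta> t b - (A b - A a)) \<le> integral {a..b} (stein_phi \<theta> t)"
  proof (rule integral_le)
    fix x assume "x \<in> {a..b}"
    then have "A a \<le> A x" "B x \<le> B b" using assms by auto
    then show "stein_phi \<theta> t b - (A b - A a) \<le> stein_phi \<theta> t x"
      using AB[of b] AB[of x] \<open>x \<in> {a..b}\<close> assms(4,5) by auto
  qed (use int in auto)
  then show "(b - a) * stein_phi \<theta> t b - integral {a..b} (stein_phi \<theta> t) \<le> (b - a) * (A b - A a)"
    using \<open>a \<le> b\<close> by (simp add: algebra_simps)
  have "integral {a..b} (stein_phi \<theta> t) \<le> integral {a..b} (\<lambda>_. stein_phi \<theta> t b + (B b - B a))"
  proof (rule integral_le)
    fix x assume "x \<in> {a..b}"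
    then have "B a \<le> B x" "A x \<le> A b" using assms by auto
    then show "stein_phi \<theta> t x \<le> stein_phi \<theta> t b + (B b - B a)"
      using AB[of b] AB[of x] \<open>x \<in> {a..b}\<close> assms(4,5) by auto
  qed (use int in auto)
  then show "- ((b - a) * (B b - B a)) \<le> (b - a) * stein_phi \<theta> t b - integral {a..b} (stein_phi \<theta> t)"
    using \<open>a \<le> b\<close> by (simp add: algebra_simps)
qed

text \<open>The one-sided errors of the intervals telescope once each length is bounded by \<delta>.
  Nonnegativity of \<open>w m\<close> is carried through the induction because the intervals must
  lie to the right of s.\<close>

lemma stein_phi_riemann_sum:
  fixes A B :: "real \<Rightarrow> real" and w :: "nat \<Rightarrow> real"
  assumes "\<theta> > 0" "t > 0" "0 \<le> s"
    and w0: "w 0 = 0" and w: "\<And>k. k \<in> {1..n} \<Longrightarrow> w (k - 1) \<le> w k"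
    and \<delta>: "\<And>k. k \<in> {1..n} \<Longrightarrow> w k - w (k - 1) \<le> \<delta>"
    and A: "\<And>x y. s \<le> x \<Longrightarrow> x \<le> y \<Longrightarrow> A x \<le> A y"
    and B: "\<And>x y. s \<le> x \<Longrightarrow> x \<le> y \<Longrightarrow> B x \<le> B y"
    and AB: "\<And>x. s \<le> x \<Longrightarrow> stein_phi \<theta> t x = A x - B x"
    and "m \<le> n"
  shows "0 \<le> w m \<and>
    (\<Sum>k=1..m. (w k - w (k - 1)) * stein_phi \<theta> t (s + w k)) - integral {s..s + w m} (stein_phi \<theta> t) \<le> \<delta> * (A (s + w m) - A s) \<and>
    - (\<delta> * (B (s + w m) - B s)) \<le> (\<Sum>k=1..m. (w k - w (k - 1)) * stein_phi \<theta> t (s + w k)) - integral {s..s + w m} (stein_phi \<theta> t)"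
  using \<open>m \<le> n\<close>
proof (induction m)
  case 0
  then show ?case by (simp add: w0)
next
  case (Suc m)
  have le: "w m \<le> w (Suc m)" "w (Suc m) - w m \<le> \<delta>" using w[of "Suc m"] \<delta>[of "Suc m"] Suc.prems by auto
  note IH = Suc.IH[OF Suc_leD[OF Suc.prems]]
  let ?a = "s + w m" and ?b = "s + w (Suc m)"
  have "integral {s..?b} (stein_phi \<theta> t) = integral {s..?a} (stein_phi \<theta> t) + integral {?a..?b} (stein_phi \<theta> t)"
    using IH le assms(1-3) by (intro Henstock_Kurzweil_Integration.integral_combine[symmetric] stein_phi_integrable_on) auto
  moreover have "(?b - ?a) * stein_phi \<theta> t ?b - integral {?a..?b} (stein_phi \<theta> t) \<le> (?b - ?a) * (A ?b - A ?a)"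
    and "- ((?b - ?a) * (B ?b - B ?a)) \<le> (?b - ?a) * stein_phi \<theta> t ?b - integral {?a..?b} (stein_phi \<theta> t)"
    by (rule stein_phi_riemann_interval[OF assms(1-3)]; use IH le A B AB in auto)+
  moreover have "(?b - ?a) * (A ?b - A ?a) \<le> \<delta> * (A ?b - A ?a)" "(?b - ?a) * (B ?b - B ?a) \<le> \<delta> * (B ?b - B ?a)"
    using IH le A[of ?a ?b] B[of ?a ?b] by (auto intro!: mult_right_mono)
  ultimately show ?case
    using IH le by (auto simp: algebra_simps)
qed

text \<open>Write \<open>l k * w k\<close> as \<theta> times an increment of w plus a discrepancy.
  The discrepancies are handled by summation by parts (the term with K), the increments form a
  Riemann sum of \<phi> over [s, s + w n] (the term with \<delta>), and the right endpoint is moved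
  to s + 1 (the last term).\<close>

lemma stein_pointwise:
  fixes w l :: "nat \<Rightarrow> real"
  assumes "\<theta> > 0" "t > 0" "0 \<le> s" "1 \<le> n"
    and w0: "w 0 = 0" and w: "\<And>k. k \<in> {1..n} \<Longrightarrow> w (k - 1) \<le> w k"
    and \<delta>: "\<And>k. k \<in> {1..n} \<Longrightarrow> w k - w (k - 1) \<le> \<delta>"
    and K: "\<And>k. k \<in> {1..n} \<Longrightarrow> \<bar>\<Sum>j=1..k. l j * w j - \<theta> * (w j - w (j - 1))\<bar> \<le> K"
  shows "\<bar>integral {s..s + 1} (stein_phi \<theta> t) - (\<Sum>k=1..n. l k * w k * stein_phi \<theta> t (s + w k)) / \<theta>\<bar>
    \<le> (\<delta> + 2 / \<theta> * K + \<bar>w n - 1\<bar>) * (\<theta>\<^sup>2 + stein_env \<theta> t s)"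
proof (rule stein_phi_decomp[OF assms(1-3)])
  fix A B :: "real \<Rightarrow> real"
  assume A: "\<And>x y. s \<le> x \<Longrightarrow> x \<le> y \<Longrightarrow> A x \<le> A y"
    and B: "\<And>x y. s \<le> x \<Longrightarrow> x \<le> y \<Longrightarrow> B x \<le> B y"
    and AB: "\<And>x. s \<le> x \<Longrightarrow> stein_phi \<theta> t x = A x - B x"
    and B0: "\<And>x. s \<le> x \<Longrightarrow> 0 \<le> B x"
    and AG: "\<And>x. s \<le> x \<Longrightarrow> A x \<le> \<theta>\<^sup>2 + stein_env \<theta> t s"
  define G where "G = \<theta>\<^sup>2 + stein_env \<theta> t s"
  define R where "R = (\<Sum>k=1..n. (w k - w (k - 1)) * stein_phi \<theta> t (s + w k))"
  have BA: "B x \<le> A x" if "s \<le> x" for x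
    using AB[OF that] stein_phi_nonneg[OF assms(1), of t x] by simp
  have sum: "0 \<le> w m \<and>
      (\<Sum>k=1..m. (w k - w (k - 1)) * stein_phi \<theta> t (s + w k)) - integral {s..s + w m} (stein_phi \<theta> t) \<le> \<delta> * (A (s + w m) - A s) \<and>
      - (\<delta> * (B (s + w m) - B s)) \<le> (\<Sum>k=1..m. (w k - w (k - 1)) * stein_phi \<theta> t (s + w k)) - integral {s..s + w m} (stein_phi \<theta> t)"
    if "m \<le> n" for m
    by (rule stein_phi_riemann_sum[of \<theta> t s w n \<delta> A B m]) (use assms(1-3) w0 w \<delta> A B AB that in auto)
  have w_nn: "0 \<le> w m" if "m \<le> n" for m
    using sum[OF that] by blast
  have \<delta>0: "0 \<le> \<delta>" using w[of 1] \<delta>[of 1] \<open>1 \<le> n\<close> by simp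
  have "\<delta> * (A (s + w n) - A s) \<le> \<delta> * G" "\<delta> * (B (s + w n) - B s) \<le> \<delta> * G"
    using \<delta>0 AG[of "s + w n"] BA[of "s + w n"] BA[of s] B0[of s] w_nn[of n]
    by (auto simp: G_def intro!: mult_left_mono)
  then have 1: "\<bar>R - integral {s..s + w n} (stein_phi \<theta> t)\<bar> \<le> \<delta> * G"
    using sum[OF order_refl] unfolding R_def by linarith
  have phiG: "stein_phi \<theta> t x \<le> G" if "s \<le> x" for x
    using AB[OF that] AG[OF that] B0[OF that] by (simp add: G_def)
  have 2: "\<bar>integral {s..s + w n} (stein_phi \<theta> t) - integral {s..s + 1} (stein_phi \<theta> t)\<bar> \<le> \<bar>w n - 1\<bar> * G"
  proof -
    have *: "\<bar>integral {s..s + b} (stein_phi \<theta> t) - integral {s..s + a} (stein_phi \<theta> t)\<bar> \<le> \<bar>b - a\<bar> * G"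
      if "0 \<le> a" "a \<le> b" for a b
    proof -
      have "integral {s..s + b} (stein_phi \<theta> t) = integral {s..s + a} (stein_phi \<theta> t) + integral {s + a..s + b} (stein_phi \<theta> t)"
        using that assms(1-3) by (intro Henstock_Kurzweil_Integration.integral_combine[symmetric] stein_phi_integrable_on) auto
      moreover have "integral {s + a..s + b} (stein_phi \<theta> t) \<le> integral {s + a..s + b} (\<lambda>_. G)"
        using that assms(1-3) by (intro integral_le stein_phi_integrable_on phiG) auto
      moreover have "0 \<le> integral {s + a..s + b} (stein_phi \<theta> t)"
        using that assms(1-3) by (intro integral_nonneg stein_phi_integrable_on stein_phi_nonneg) auto
      ultimately show ?thesis using that by simp
    qed
    show ?thesis
      using *[of 1 "w n"] *[of "w n" 1] w_nn[of n] by (cases "1 \<le> w n") (auto simp: abs_minus_commute)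
  qed
  let ?d = "\<lambda>k. l k * w k - \<theta> * (w k - w (k - 1))"
  have 3: "\<bar>\<Sum>k=1..n. ?d k * stein_phi \<theta> t (s + w k)\<bar> \<le> 2 * K * G"
  proof -
    have K0: "0 \<le> K" using K[of 1] \<open>1 \<le> n\<close> by auto
    let ?A = "\<lambda>k. A (s + w (min k n))" and ?B = "\<lambda>k. B (s + w (min k n))"
    have mono: "w (k - 1) \<le> w k" "0 \<le> w (k - 1)" if "k \<in> {2..n}" for k
      using that w[of k] w_nn[of "k - 1"] by auto
    have "\<bar>(\<Sum>k=1..n. ?d k * (?A k - ?B k)) - (\<Sum>k=1..n. ?d k) * (?A n - ?B n)\<bar> \<le> K * (?A n - ?A 1 + ?B n - ?B 1)"
      by (rule abel_sum_bound[where n = n]) (use K mono A B \<open>1 \<le> n\<close> in auto)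
    moreover have "(\<Sum>k=1..n. ?d k * (?A k - ?B k)) = (\<Sum>k=1..n. ?d k * stein_phi \<theta> t (s + w k))"
      using AB w_nn by (intro sum.cong) auto
    moreover have "\<bar>(\<Sum>k=1..n. ?d k) * (?A n - ?B n)\<bar> \<le> K * (?A n - ?B n)"
      unfolding abs_mult using K[of n] \<open>1 \<le> n\<close> BA w_nn by (intro mult_mono) auto
    \<comment> \<open>The boundary term contributes A - B at n, so B at n cancels and at most 2 A at
      n remains. This is the origin of the factor 2 in front of K.\<close>
    moreover have "K * (?A n - ?A 1 + ?B n - ?B 1) + K * (?A n - ?B n) \<le> K * (2 * G)"
      unfolding distrib_left[symmetric] using K0 \<open>1 \<le> n\<close> AG[of "s + w n"] w_nn[of n] w_nn[of 1] B0[of "s + w 1"] BA[of "s + w 1"]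
      by (intro mult_left_mono) (auto simp: G_def)
    ultimately show ?thesis by linarith
  qed
  have "(\<Sum>k=1..n. l k * w k * stein_phi \<theta> t (s + w k)) = (\<Sum>k=1..n. ?d k * stein_phi \<theta> t (s + w k)) + \<theta> * R"
    unfolding R_def sum_distrib_left sum.distrib[symmetric] by (intro sum.cong) (auto simp: algebra_simps)
  then have eq: "(\<Sum>k=1..n. l k * w k * stein_phi \<theta> t (s + w k)) / \<theta> = (\<Sum>k=1..n. ?d k * stein_phi \<theta> t (s + w k)) / \<theta> + R"
    using \<open>\<theta> > 0\<close> by (simp add: field_simps)
  have "\<bar>(\<Sum>k=1..n. ?d k * stein_phi \<theta> t (s + w k)) / \<theta>\<bar> \<le> 2 / \<theta> * K * G"
    using 3 \<open>\<theta> > 0\<close> by (simp add: field_simps)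
  moreover have "\<bar>x - (y + R)\<bar> \<le> b" if "\<bar>R - z\<bar> \<le> b1" "\<bar>z - x\<bar> \<le> b2" "\<bar>y\<bar> \<le> b3" "b = b1 + b3 + b2"
    for x y z b b1 b2 b3 :: real using that by linarith
  ultimately show ?thesis
    unfolding eq G_def[symmetric] using 1 2 by (auto simp: distrib_right)
qed

section \<open>Size-biased laws and independence\<close>

lemma tv_dist_upper:
  assumes "prob_space \<nu>" "prob_space \<mu>" "A \<in> sets \<nu>"
  shows "\<bar>measure \<nu> A - measure \<mu> A\<bar> \<le> tv_dist \<nu> \<mu>"
  unfolding tv_dist_def
proof (rule cSUP_upper[OF assms(3)])
  interpret N: prob_space \<nu> by fact
  interpret P: prob_space \<mu> by fact
  have "\<bar>measure \<nu> A - measure \<mu> A\<bar> \<le> 1" for A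
    using N.prob_le_1[of A] P.prob_le_1[of A] measure_nonneg[of \<nu> A] measure_nonneg[of \<mu> A]
    unfolding abs_le_iff by linarith
  then show "bdd_above ((\<lambda>A. \<bar>measure \<nu> A - measure \<mu> A\<bar>) ` sets \<nu>)"
    by (intro bdd_aboveI2)
qed

lemma tv_dist_nonneg: "prob_space \<nu> \<Longrightarrow> prob_space \<mu> \<Longrightarrow> 0 \<le> tv_dist \<nu> \<mu>"
  using tv_dist_upper[of \<nu> \<mu> "{}"] by simp

lemma nat_measure_eq_density:
  fixes \<nu> :: "nat measure"
  assumes "prob_space \<nu>" "sets \<nu> = UNIV"
  shows "\<nu> = density (count_space UNIV) (\<lambda>x. ennreal (measure \<nu> {x}))"
proof (rule measure_eqI_countable[where A = UNIV])
  interpret prob_space \<nu> by fact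
  show "emeasure \<nu> {a} = emeasure (density (count_space UNIV) (\<lambda>x. ennreal (measure \<nu> {x}))) {a}" for a
    by (subst emeasure_density) (auto simp: emeasure_eq_measure)
qed (use assms in auto)

text \<open>Among functions with values in [0,m], the difference of the integrals is largest for m
  times the indicator of the set where one law has the larger point masses. Because f is
  nonnegative, the factor is m and not 2m.\<close>

lemma integral_diff_le_tv_dist:
  fixes \<nu> \<mu> :: "nat measure" and f :: "nat \<Rightarrow> real"
  assumes P: "prob_space \<nu>" "prob_space \<mu>" and S: "sets \<nu> = UNIV" "sets \<mu> = UNIV"
    and c: "AE x in \<nu>. c \<le> x" "AE x in \<mu>. c \<le> x"
    and f: "\<And>x. c \<le> x \<Longrightarrow> 0 \<le> f x" "\<And>x. c \<le> x \<Longrightarrow> f x \<le> m"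
  shows "\<bar>(\<integral>x. f x \<partial>\<nu>) - (\<integral>x. f x \<partial>\<mu>)\<bar> \<le> m * tv_dist \<nu> \<mu>"
proof -
  have m: "0 \<le> m" using f[of c] by simp
  \<comment> \<open>The bounds on f hold from c onwards only; below c both laws have no mass, so f
    may be replaced by 0 there.\<close>
  define h where "h x = (if c \<le> x then f x else 0)" for x
  have h: "0 \<le> h x" "h x \<le> m" for x using f[of x] m by (auto simp: h_def)
  have conv: "integrable (count_space UNIV) (\<lambda>x. measure N {x} * u x)"
      "(\<integral>x. measure N {x} * u x \<partial>count_space UNIV) = (\<integral>x. u x \<partial>N)"
    if "prob_space N" "sets N = UNIV" "\<And>x. 0 \<le> u x" "\<And>x. u x \<le> b" for N :: "nat measure" and u :: "nat \<Rightarrow> real" and b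
  proof -
    interpret N: prob_space N by fact
    have "integrable N u"
      by (rule N.integrable_const_bound[of _ b]) (use that in \<open>auto simp: measurable_def\<close>)
    then have "integrable (density (count_space UNIV) (\<lambda>x. ennreal (measure N {x}))) u"
      using nat_measure_eq_density[OF that(1,2)] by simp
    then show "integrable (count_space UNIV) (\<lambda>x. measure N {x} * u x)"
      by (subst (asm) integrable_density) auto
    have "(\<integral>x. u x \<partial>N) = (\<integral>x. u x \<partial>density (count_space UNIV) (\<lambda>x. ennreal (measure N {x})))"
      using nat_measure_eq_density[OF that(1,2)] by simp
    also have "\<dots> = (\<integral>x. measure N {x} * u x \<partial>count_space UNIV)"
      by (subst integral_density) auto
    finally show "(\<integral>x. measure N {x} * u x \<partial>count_space UNIV) = (\<integral>x. u x \<partial>N)" ..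
  qed
  have one: "\<exists>A. (\<integral>x. h x \<partial>N) - (\<integral>x. h x \<partial>N') \<le> m * (measure N A - measure N' A)"
    if N: "prob_space N" "sets N = UNIV" "prob_space N'" "sets N' = UNIV" for N N' :: "nat measure"
  proof
    let ?A = "{x. measure N' {x} \<le> measure N {x}}"
    let ?i = "\<lambda>x. m * indicator ?A x :: real"
    have i: "0 \<le> ?i x" "?i x \<le> m" for x using m by (auto simp: indicator_def)
    note [simp] = conv[OF N(1,2) h] conv[OF N(3,4) h] conv[OF N(1,2) i] conv[OF N(3,4) i]
    have "(\<integral>x. h x \<partial>N) - (\<integral>x. h x \<partial>N')
      = (\<integral>x. measure N {x} * h x - measure N' {x} * h x \<partial>count_space UNIV)"
      by (subst Bochner_Integration.integral_diff) simp_all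
    also have "\<dots> \<le> (\<integral>x. measure N {x} * ?i x - measure N' {x} * ?i x \<partial>count_space UNIV)"
    proof (rule integral_mono)
      fix x :: nat
      have "(measure N {x} - measure N' {x}) * h x \<le> (measure N {x} - measure N' {x}) * ?i x"
        using h[of x] by (auto simp: indicator_def intro: mult_left_mono mult_nonpos_nonneg)
      then show "measure N {x} * h x - measure N' {x} * h x \<le> measure N {x} * ?i x - measure N' {x} * ?i x"
        by (simp add: algebra_simps)
    qed (auto intro: Bochner_Integration.integrable_diff simp del: mult.left_commute)
    also have "\<dots> = (\<integral>x. ?i x \<partial>N) - (\<integral>x. ?i x \<partial>N')"
      by (subst Bochner_Integration.integral_diff) simp_all
    also have "\<dots> = m * (measure N ?A - measure N' ?A)"
      using N by (simp add: right_diff_distrib)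
    finally show "(\<integral>x. h x \<partial>N) - (\<integral>x. h x \<partial>N') \<le> m * (measure N ?A - measure N' ?A)" .
  qed
  have eq: "(\<integral>x. f x \<partial>\<nu>) = (\<integral>x. h x \<partial>\<nu>)" "(\<integral>x. f x \<partial>\<mu>) = (\<integral>x. h x \<partial>\<mu>)"
    using c S by (auto intro!: integral_cong_AE simp: measurable_def h_def elim!: eventually_mono)
  have le: "m * (measure \<nu> A - measure \<mu> A) \<le> m * tv_dist \<nu> \<mu>" "m * (measure \<mu> A - measure \<nu> A) \<le> m * tv_dist \<nu> \<mu>" for A
    using tv_dist_upper[OF P, of A] S m by (auto intro!: mult_left_mono)
  show ?thesis
    unfolding eq abs_le_iff
    using one[OF P(1) S(1) P(2) S(2)] one[OF P(2) S(2) P(1) S(1)] le by (auto intro: order_trans)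
qed

context prob_space
begin

text \<open>Fubini for the product of the two laws, pulled back to the same probability space:
  \<omega>' plays the role of an independent copy on which Z is evaluated.\<close>

lemma indep_expectation:
  fixes h :: "'b \<times> 'b \<Rightarrow> real"
  assumes I: "indep_var N Y L Z"
    and h [measurable]: "h \<in> borel_measurable (N \<Otimes>\<^sub>M L)"
    and int: "integrable M (\<lambda>\<omega>. h (Y \<omega>, Z \<omega>))"
  shows "integrable M (\<lambda>\<omega>'. \<integral>\<omega>. h (Y \<omega>, Z \<omega>') \<partial>M)" (is ?i)
    and "(\<integral>\<omega>. h (Y \<omega>, Z \<omega>) \<partial>M) = (\<integral>\<omega>'. \<integral>\<omega>. h (Y \<omega>, Z \<omega>') \<partial>M \<partial>M)" (is ?e)
proof -
  have [measurable]: "Y \<in> measurable M N" "Z \<in> measurable M L"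
    using I by (auto dest: indep_var_rv1 indep_var_rv2)
  interpret Y: prob_space "distr M N Y" by (rule prob_space_distr) simp
  interpret Z: prob_space "distr M L Z" by (rule prob_space_distr) simp
  interpret YZ: pair_sigma_finite "distr M N Y" "distr M L Z" ..
  have eq: "distr M N Y \<Otimes>\<^sub>M distr M L Z = distr M (N \<Otimes>\<^sub>M L) (\<lambda>\<omega>. (Y \<omega>, Z \<omega>))"
    using I by (simp add: indep_var_distribution_eq)
  have "integrable (distr M N Y \<Otimes>\<^sub>M distr M L Z) h"
    unfolding eq using int by (subst integrable_distr_eq) auto
  then have hi: "integrable (distr M N Y \<Otimes>\<^sub>M distr M L Z) (\<lambda>(y, z). h (y, z))" by simp
  have inner: "(\<integral>y. h (y, Z \<omega>') \<partial>distr M N Y) = (\<integral>\<omega>. h (Y \<omega>, Z \<omega>') \<partial>M)" if "\<omega>' \<in> space M" for \<omega>'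
    using measurable_space[OF \<open>Z \<in> measurable M L\<close> that] by (intro integral_distr) auto
  have "integrable (distr M L Z) (\<lambda>z. \<integral>y. h (y, z) \<partial>distr M N Y)"
    using YZ.integrable_snd[OF hi] by simp
  then have "integrable M (\<lambda>\<omega>'. \<integral>y. h (y, Z \<omega>') \<partial>distr M N Y)"
    by (rule integrable_distr[rotated]) simp
  then show ?i
    by (subst (asm) Bochner_Integration.integrable_cong[OF refl inner]) auto
  have "(\<integral>\<omega>. h (Y \<omega>, Z \<omega>) \<partial>M) = (\<integral>x. h x \<partial>(distr M N Y \<Otimes>\<^sub>M distr M L Z))"
    unfolding eq by (subst integral_distr) auto
  also have "\<dots> = (\<integral>z. (\<integral>y. h (y, z) \<partial>distr M N Y) \<partial>distr M L Z)"
    using YZ.integral_snd[OF hi] by simp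
  also have "\<dots> = (\<integral>\<omega>'. (\<integral>y. h (y, Z \<omega>') \<partial>distr M N Y) \<partial>M)"
    by (rule integral_distr) measurable
  also have "\<dots> = (\<integral>\<omega>'. \<integral>\<omega>. h (Y \<omega>, Z \<omega>') \<partial>M \<partial>M)"
    by (intro Bochner_Integration.integral_cong refl inner)
  finally show ?e .
qed

text \<open>Countably many values exhaust the probability, so one of them is charged and the
  \<open>LEAST\<close> in \<open>x_min\<close> is attained. This makes the division by this
  probability meaningful.\<close>

lemma prob_x_min_pos:
  assumes [measurable]: "Y \<in> measurable M (count_space UNIV)"
  shows "0 < prob {\<omega> \<in> space M. Y \<omega> = x_min M Y}"
proof -
  have "\<exists>x. 0 < prob {\<omega> \<in> space M. Y \<omega> = x}"
  proof (rule ccontr)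
    assume "\<not> ?thesis"
    then have "prob {\<omega> \<in> space M. Y \<omega> = x} = 0" for x
      by (simp add: zero_less_measure_iff)
    then have "AE \<omega> in M. Y \<omega> \<noteq> x" for x
      by (subst AE_iff_measurable[where N = "{\<omega> \<in> space M. Y \<omega> = x}"]) (auto simp: emeasure_eq_measure)
    then have "AE \<omega> in M. \<forall>x. Y \<omega> \<noteq> x" by (intro AE_all_countable[THEN iffD2] allI)
    then have "AE \<omega> in M. False" by (rule eventually_mono) simp
    then show False by simp
  qed
  then show ?thesis unfolding x_min_def by (rule LeastI_ex)
qed

lemma AE_x_min_le:
  assumes [measurable]: "Y \<in> measurable M (count_space UNIV)"
  shows "AE \<omega> in M. x_min M Y \<le> Y \<omega>"
proof -
  have "AE \<omega> in M. x < x_min M Y \<longrightarrow> Y \<omega> \<noteq> x" for x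
  proof (cases "x < x_min M Y")
    case True
    then have "\<not> 0 < prob {\<omega> \<in> space M. Y \<omega> = x}"
      unfolding x_min_def by (rule not_less_Least)
    then have "prob {\<omega> \<in> space M. Y \<omega> = x} = 0"
      by (simp add: zero_less_measure_iff)
    then have "AE \<omega> in M. Y \<omega> \<noteq> x"
      by (subst AE_iff_measurable[where N = "{\<omega> \<in> space M. Y \<omega> = x}"]) (auto simp: emeasure_eq_measure)
    then show ?thesis by eventually_elim simp
  qed simp
  then have "AE \<omega> in M. \<forall>x. x < x_min M Y \<longrightarrow> Y \<omega> \<noteq> x" by (simp add: AE_all_countable)
  then show ?thesis by eventually_elim (auto simp: not_le[symmetric])
qed

text \<open>The bound b serves for integrability only; the bound that enters the estimate is m,
  valid from the smallest possible value of Y onwards. Both the size-biased law and the law of Y + 1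
  live there.\<close>

lemma size_biased_tv_bound:
  fixes Y :: "'a \<Rightarrow> nat" and g :: "nat \<Rightarrow> real"
  assumes Y [measurable]: "Y \<in> measurable M (count_space UNIV)"
    and int: "integrable M (\<lambda>\<omega>. real (Y \<omega>))"
    and pos: "0 < (\<integral>\<omega>. real (Y \<omega>) \<partial>M)"
    and sb: "size_biased M Y \<nu>"
    and g: "\<And>x. 0 \<le> g x" "\<And>x. g x \<le> b" "\<And>x. x_min M Y \<le> x \<Longrightarrow> g x \<le> m"
  shows "\<bar>(\<integral>\<omega>. real (Y \<omega>) * g (Y \<omega>) \<partial>M) - (\<integral>\<omega>. real (Y \<omega>) \<partial>M) * (\<integral>\<omega>. g (Y \<omega> + 1) \<partial>M)\<bar>
    \<le> (\<integral>\<omega>. real (Y \<omega>) \<partial>M) * (m * tv_dist \<nu> (distr M (count_space UNIV) (\<lambda>\<omega>. Y \<omega> + 1)))"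
proof -
  let ?lam = "\<integral>\<omega>. real (Y \<omega>) \<partial>M" and ?mu = "distr M (count_space UNIV) (\<lambda>\<omega>. Y \<omega> + 1)"
  interpret N: prob_space \<nu> using sb by (simp add: size_biased_def)
  interpret P: prob_space ?mu by (rule prob_space_distr) simp
  have sets_\<nu>: "sets \<nu> = UNIV" using sb by (simp add: size_biased_def)
  have sb_eq: "(\<integral>\<omega>. real (Y \<omega>) * f (Y \<omega>) \<partial>M) = ?lam * (\<integral>x. f x \<partial>\<nu>)"
    if "\<And>x. 0 \<le> f x" "\<And>x. f x \<le> c" for f :: "nat \<Rightarrow> real" and c
  proof -
    have "integrable \<nu> f"
      by (rule N.integrable_const_bound[of _ c]) (use that sets_\<nu> in \<open>auto simp: measurable_def\<close>)
    moreover have "integrable M (\<lambda>\<omega>. real (Y \<omega>) * f (Y \<omega>))"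
    proof (rule Bochner_Integration.integrable_bound[where f = "\<lambda>\<omega>. c * real (Y \<omega>)"])
      show "integrable M (\<lambda>\<omega>. c * real (Y \<omega>))" using int by simp
      have "\<bar>real (Y \<omega>) * f (Y \<omega>)\<bar> \<le> \<bar>c * real (Y \<omega>)\<bar>" for \<omega>
        using that[of "Y \<omega>"] by (auto simp: abs_mult mult.commute[of c] intro!: mult_left_mono)
      then show "AE \<omega> in M. norm (real (Y \<omega>) * f (Y \<omega>)) \<le> norm (c * real (Y \<omega>))" by simp
    qed measurable
    ultimately show ?thesis using sb by (simp add: size_biased_def)
  qed
  \<comment> \<open>The defining identity, tested with the indicator of the values below the
    minimum, shows that \<nu> gives them no mass.\<close>
  have "AE x in \<nu>. x_min M Y \<le> x"
  proof -
    let ?f = "indicator {..<x_min M Y} :: nat \<Rightarrow> real"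
    have "(\<integral>\<omega>. real (Y \<omega>) * ?f (Y \<omega>) \<partial>M) = (\<integral>\<omega>. 0 \<partial>M)"
    proof (rule integral_cong_AE)
      show "AE \<omega> in M. real (Y \<omega>) * ?f (Y \<omega>) = 0"
        using AE_x_min_le[OF Y] by eventually_elim (auto simp: indicator_def)
      show "(\<lambda>\<omega>. real (Y \<omega>) * ?f (Y \<omega>)) \<in> borel_measurable M"
        by (rule measurable_compose[OF Y]) simp
    qed simp
    with sb_eq[of ?f 1] have "?lam * (\<integral>x. ?f x \<partial>\<nu>) = 0" by (simp add: indicator_def)
    with pos sets_\<nu> have "measure \<nu> {..<x_min M Y} = 0" by simp
    then show ?thesis
      by (subst AE_iff_measurable[where N = "{..<x_min M Y}"])
         (use sets_\<nu> sets_eq_imp_space_eq[of \<nu> "count_space UNIV"] in \<open>auto simp: N.emeasure_eq_measure\<close>)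
  qed
  moreover have "AE x in ?mu. x_min M Y \<le> x"
    by (subst AE_distr_iff) (use AE_x_min_le[OF Y] in \<open>auto elim: eventually_mono\<close>)
  ultimately have "\<bar>(\<integral>x. g x \<partial>\<nu>) - (\<integral>x. g x \<partial>?mu)\<bar> \<le> m * tv_dist \<nu> ?mu"
    using sets_\<nu> g by (intro integral_diff_le_tv_dist[where c = "x_min M Y"] N.prob_space_axioms P.prob_space_axioms) auto
  moreover have "(\<integral>x. g x \<partial>?mu) = (\<integral>\<omega>. g (Y \<omega> + 1) \<partial>M)"
    by (subst integral_distr) auto
  moreover have "(\<integral>\<omega>. real (Y \<omega>) * g (Y \<omega>) \<partial>M) = ?lam * (\<integral>x. g x \<partial>\<nu>)"
    by (rule sb_eq[OF g(1,2)])
  ultimately show ?thesis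
    using pos by (simp add: right_diff_distrib[symmetric] abs_mult)
qed

end

section \<open>Independent summands with deterministic weights\<close>

locale weighted_sum = prob_space M for M :: "'a measure" +
  fixes X :: "nat \<Rightarrow> 'a \<Rightarrow> nat" and w :: "nat \<Rightarrow> real" and n :: nat
  assumes indep: "indep_vars (\<lambda>_. count_space UNIV) X {1..n}"
    and int_X: "\<And>k. k \<in> {1..n} \<Longrightarrow> integrable M (\<lambda>\<omega>. real (X k \<omega>))"
    and w_nonneg: "\<And>k. k \<in> {1..n} \<Longrightarrow> 0 \<le> w k"
begin

definition S :: "'a \<Rightarrow> real" where
  "S \<omega> = (\<Sum>k=1..n. w k * real (X k \<omega>))"

lemma X_measurable: "k \<in> {1..n} \<Longrightarrow> X k \<in> measurable M (count_space UNIV)"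
  using indep by (auto simp: indep_vars_def)

lemma S_measurable [measurable]: "S \<in> borel_measurable M"
  unfolding S_def[abs_def] using X_measurable by (intro borel_measurable_sum borel_measurable_times) auto

lemma S_nonneg: "0 \<le> S \<omega>"
  unfolding S_def by (intro sum_nonneg mult_nonneg_nonneg w_nonneg) auto

lemma integrable_phi_S:
  assumes "\<theta> > 0" "t > 0" "0 \<le> c"
  shows "integrable M (\<lambda>\<omega>. stein_phi \<theta> t (S \<omega> + c))"
  by (rule integrable_const_bound[of _ "\<theta>\<^sup>2 + \<theta> / t"])
     (use assms S_nonneg stein_phi_nonneg[of \<theta> t] stein_phi_le_const[of \<theta> t] in auto)

lemma integrable_X_phi_S:
  assumes "\<theta> > 0" "t > 0" "k \<in> {1..n}"
  shows "integrable M (\<lambda>\<omega>. real (X k \<omega>) * stein_phi \<theta> t (S \<omega>))"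
proof (rule Bochner_Integration.integrable_bound[where f = "\<lambda>\<omega>. (\<theta>\<^sup>2 + \<theta> / t) * real (X k \<omega>)"])
  show "integrable M (\<lambda>\<omega>. (\<theta>\<^sup>2 + \<theta> / t) * real (X k \<omega>))" using int_X[OF assms(3)] by simp
  show "(\<lambda>\<omega>. real (X k \<omega>) * stein_phi \<theta> t (S \<omega>)) \<in> borel_measurable M"
    using X_measurable[OF assms(3)] by measurable
  have "\<bar>real (X k \<omega>) * stein_phi \<theta> t (S \<omega>)\<bar> \<le> \<bar>(\<theta>\<^sup>2 + \<theta> / t) * real (X k \<omega>)\<bar>" for \<omega>
    using stein_phi_nonneg[OF assms(1), of t "S \<omega>"] stein_phi_le_const[OF assms(1,2) S_nonneg]
    by (auto simp: abs_mult mult.commute intro!: mult_left_mono order_trans[OF _ abs_ge_self])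
  then show "AE \<omega> in M. norm (real (X k \<omega>) * stein_phi \<theta> t (S \<omega>)) \<le> norm ((\<theta>\<^sup>2 + \<theta> / t) * real (X k \<omega>))"
    by simp
qed

lemma integrable_env_S:
  assumes "\<theta> > 0" "t > 0"
  shows "integrable M (\<lambda>\<omega>. stein_env \<theta> t (S \<omega>))"
  by (rule integrable_const_bound[of _ "\<theta> / t"])
     (use assms stein_env_nonneg[of \<theta> t] stein_env_le[of \<theta> t] in auto)

text \<open>Replacing the size-biased \<open>X\<close> by \<open>X + 1\<close> costs \<open>env\<close> at the smallest possible value of \<open>X\<close>; since \<open>X\<close> attains it
  with positive probability, independence turns this into \<open>env\<close> at \<open>S\<close>.\<close>

lemma exchange_bound:
  assumes \<theta>: "\<theta> > 0" "t > 0" and k: "k \<in> {1..n}"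
    and pos: "0 < (\<integral>\<omega>. real (X k \<omega>) \<partial>M)" and sb: "size_biased M (X k) \<nu>"
  shows "\<bar>(\<integral>\<omega>. real (X k \<omega>) * stein_phi \<theta> t (S \<omega>) \<partial>M) - (\<integral>\<omega>. real (X k \<omega>) \<partial>M) * (\<integral>\<omega>. stein_phi \<theta> t (S \<omega> + w k) \<partial>M)\<bar>
    \<le> (\<integral>\<omega>. real (X k \<omega>) \<partial>M)
      * (tv_dist \<nu> (distr M (count_space UNIV) (\<lambda>\<omega>. X k \<omega> + 1)) / prob {\<omega> \<in> space M. X k \<omega> = x_min M (X k)})
      * (\<integral>\<omega>. \<theta>\<^sup>2 + stein_env \<theta> t (S \<omega>) \<partial>M)"
proof -
  let ?Y = "\<lambda>\<omega>. real (X k \<omega>)"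
  define Z where "Z \<omega> = (\<Sum>j\<in>{1..n} - {k}. w j * real (X j \<omega>))" for \<omega>
  define x0 where "x0 = x_min M (X k)"
  let ?lam = "\<integral>\<omega>. ?Y \<omega> \<partial>M" and ?tv = "tv_dist \<nu> (distr M (count_space UNIV) (\<lambda>\<omega>. X k \<omega> + 1))"
  let ?p = "prob {\<omega> \<in> space M. X k \<omega> = x0}"
  let ?G = "\<lambda>y. \<theta>\<^sup>2 + stein_env \<theta> t y"
  note [measurable] = X_measurable[OF k]
  have S_eq: "S \<omega> = Z \<omega> + w k * ?Y \<omega>" for \<omega>
    unfolding S_def Z_def using k by (subst sum.remove[of _ k]) auto
  have Z_nn: "0 \<le> Z \<omega>" for \<omega>
    unfolding Z_def by (intro sum_nonneg mult_nonneg_nonneg w_nonneg) auto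
  have wk: "0 \<le> w k" by (rule w_nonneg[OF k])
  have I: "indep_var borel ?Y borel Z"
  proof -
    let ?U = "\<lambda>j \<omega>. if j = k then real (X j \<omega>) else w j * real (X j \<omega>)"
    have "indep_vars (\<lambda>_. borel) (\<lambda>j \<omega>. (\<lambda>j x. if j = k then real x else w j * real x) j (X j \<omega>)) {1..n}"
      by (rule indep_vars_compose2[OF indep]) auto
    then have "indep_vars (\<lambda>_. borel) ?U (insert k ({1..n} - {k}))"
      using k by (simp add: insert_absorb)
    then have "indep_var borel (?U k) borel (\<lambda>\<omega>. \<Sum>j\<in>{1..n} - {k}. ?U j \<omega>)"
      by (intro indep_vars_sum) auto
    moreover have "(\<lambda>\<omega>. \<Sum>j\<in>{1..n} - {k}. ?U j \<omega>) = Z"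
      unfolding Z_def by (intro ext sum.cong) auto
    ultimately show ?thesis by simp
  qed
  have [measurable]: "Z \<in> borel_measurable M" using I by (rule indep_var_rv2)
  let ?h1 = "\<lambda>(y, z). y * stein_phi \<theta> t (z + w k * y)"
  let ?h2 = "\<lambda>(y, z). stein_phi \<theta> t (z + w k * y + w k)"
  \<comment> \<open>On the event that X k takes its minimal value x0, the point z + w k * x0 is S
    itself. Hence the expectation of \<open>?h3\<close> in y is the probability of this event times
    the envelope at z + w k * x0, and dropping the indicator at the end bounds the whole by the
    envelope at S.\<close>
  let ?h3 = "\<lambda>(y, z). indicator {real x0} y * ?G (z + w k * y)"
  have GS: "integrable M (\<lambda>\<omega>. ?G (S \<omega>))" using integrable_env_S[OF \<theta>] by simp
  have h3i: "integrable M (\<lambda>\<omega>. ?h3 (?Y \<omega>, Z \<omega>))"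
  proof (rule Bochner_Integration.integrable_bound[OF GS])
    show "(\<lambda>\<omega>. ?h3 (?Y \<omega>, Z \<omega>)) \<in> borel_measurable M" by simp
    show "AE \<omega> in M. norm (?h3 (?Y \<omega>, Z \<omega>)) \<le> norm (?G (S \<omega>))"
      by (auto simp: S_eq indicator_def)
  qed
  have 1: "integrable M (\<lambda>\<omega>'. \<integral>\<omega>. ?h1 (?Y \<omega>, Z \<omega>') \<partial>M)"
      "(\<integral>\<omega>. ?h1 (?Y \<omega>, Z \<omega>) \<partial>M) = (\<integral>\<omega>'. \<integral>\<omega>. ?h1 (?Y \<omega>, Z \<omega>') \<partial>M \<partial>M)"
    using indep_expectation[OF I, of ?h1] integrable_X_phi_S[OF \<theta> k] by (simp_all add: S_eq)
  have 2: "integrable M (\<lambda>\<omega>'. \<integral>\<omega>. ?h2 (?Y \<omega>, Z \<omega>') \<partial>M)"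
      "(\<integral>\<omega>. ?h2 (?Y \<omega>, Z \<omega>) \<partial>M) = (\<integral>\<omega>'. \<integral>\<omega>. ?h2 (?Y \<omega>, Z \<omega>') \<partial>M \<partial>M)"
    using indep_expectation[OF I, of ?h2] integrable_phi_S[OF \<theta> wk] by (simp_all add: S_eq)
  have 3: "integrable M (\<lambda>\<omega>'. \<integral>\<omega>. ?h3 (?Y \<omega>, Z \<omega>') \<partial>M)"
      "(\<integral>\<omega>. ?h3 (?Y \<omega>, Z \<omega>) \<partial>M) = (\<integral>\<omega>'. \<integral>\<omega>. ?h3 (?Y \<omega>, Z \<omega>') \<partial>M \<partial>M)"
    using indep_expectation[OF I _ h3i] by simp_all
  have p: "?p > 0" unfolding x0_def by (rule prob_x_min_pos) simp
  have tv: "0 \<le> ?tv"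
    using sb by (intro tv_dist_nonneg prob_space_distr) (auto simp: size_biased_def)
  have in3: "(\<integral>\<omega>. ?h3 (?Y \<omega>, z) \<partial>M) = ?p * ?G (z + w k * real x0)" for z
  proof -
    have "(\<integral>\<omega>. ?h3 (?Y \<omega>, z) \<partial>M) = (\<integral>\<omega>. indicator {\<omega> \<in> space M. X k \<omega> = x0} \<omega> * ?G (z + w k * real x0) \<partial>M)"
      by (intro Bochner_Integration.integral_cong) (auto simp: indicator_def)
    then show ?thesis by simp
  qed
  have "\<bar>(\<integral>\<omega>. ?h1 (?Y \<omega>, Z \<omega>') \<partial>M) - ?lam * (\<integral>\<omega>. ?h2 (?Y \<omega>, Z \<omega>') \<partial>M)\<bar>
      \<le> ?lam * (?tv / ?p) * (\<integral>\<omega>. ?h3 (?Y \<omega>, Z \<omega>') \<partial>M)" for \<omega>'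
  proof -
    let ?g = "\<lambda>x. stein_phi \<theta> t (Z \<omega>' + w k * real x)"
    have "\<bar>(\<integral>\<omega>. real (X k \<omega>) * ?g (X k \<omega>) \<partial>M) - ?lam * (\<integral>\<omega>. ?g (X k \<omega> + 1) \<partial>M)\<bar>
      \<le> ?lam * (?G (Z \<omega>' + w k * real x0) * ?tv)"
    proof (rule size_biased_tv_bound[OF _ int_X[OF k] pos sb])
      fix x :: nat
      have nn: "0 \<le> Z \<omega>' + w k * real x" using Z_nn wk by simp
      show "0 \<le> ?g x" by (rule stein_phi_nonneg[OF \<theta>(1)])
      show "?g x \<le> \<theta>\<^sup>2 + \<theta> / t" by (rule stein_phi_le_const[OF \<theta> nn])
      assume "x_min M (X k) \<le> x"
      then have "Z \<omega>' + w k * real x0 \<le> Z \<omega>' + w k * real x"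
        unfolding x0_def using wk by (auto intro: mult_left_mono)
      then have "stein_env \<theta> t (Z \<omega>' + w k * real x) \<le> stein_env \<theta> t (Z \<omega>' + w k * real x0)"
        by (rule stein_env_antimono[OF \<theta>])
      then show "?g x \<le> ?G (Z \<omega>' + w k * real x0)"
        using stein_phi_le_env[OF \<theta> nn] by linarith
    qed simp
    then show ?thesis
      using p unfolding in3 by (simp add: algebra_simps)
  qed
  note ptw = this
  have "\<bar>(\<integral>\<omega>. ?h1 (?Y \<omega>, Z \<omega>) \<partial>M) - ?lam * (\<integral>\<omega>. ?h2 (?Y \<omega>, Z \<omega>) \<partial>M)\<bar>
    = \<bar>\<integral>\<omega>'. (\<integral>\<omega>. ?h1 (?Y \<omega>, Z \<omega>') \<partial>M) - ?lam * (\<integral>\<omega>. ?h2 (?Y \<omega>, Z \<omega>') \<partial>M) \<partial>M\<bar>"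
    unfolding 1(2) 2(2) using 1(1) 2(1) by (subst Bochner_Integration.integral_diff) auto
  also have "\<dots> \<le> (\<integral>\<omega>'. \<bar>(\<integral>\<omega>. ?h1 (?Y \<omega>, Z \<omega>') \<partial>M) - ?lam * (\<integral>\<omega>. ?h2 (?Y \<omega>, Z \<omega>') \<partial>M)\<bar> \<partial>M)"
    by (rule integral_abs_bound)
  also have "\<dots> \<le> (\<integral>\<omega>'. ?lam * (?tv / ?p) * (\<integral>\<omega>. ?h3 (?Y \<omega>, Z \<omega>') \<partial>M) \<partial>M)"
    by (intro integral_mono ptw integrable_abs Bochner_Integration.integrable_diff
        integrable_mult_right 1(1) 2(1) 3(1))
  also have "\<dots> = ?lam * (?tv / ?p) * (\<integral>\<omega>. ?h3 (?Y \<omega>, Z \<omega>) \<partial>M)"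
    unfolding 3(2) by (rule integral_mult_right_zero)
  also have "\<dots> \<le> ?lam * (?tv / ?p) * (\<integral>\<omega>. ?G (S \<omega>) \<partial>M)"
    using pos tv p stein_env_nonneg[OF \<theta>]
    by (intro mult_left_mono integral_mono h3i GS) (auto simp: S_eq indicator_def)
  finally show ?thesis by (simp add: S_eq x0_def)
qed

end

section \<open>The Kolmogorov distance for deterministic weights\<close>

lemma summable_zeta_real:
  assumes "\<theta> > 0"
  shows "summable (\<lambda>n. 1 / real (Suc n) powr (1 + \<theta>))"
proof -
  have "summable (\<lambda>n. real (Suc n) powr - (1 + \<theta>))"
    using summable_real_powr_iff[of "- (1 + \<theta>)"] assms by (subst summable_Suc_iff) simp
  then show ?thesis unfolding powr_minus_divide .
qed

text \<open>For y > t the envelope is (\<theta>/t) (y/t)^(-1-\<theta>), and on each interval it is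
  bounded by its value at the left end. The sum is cut at N with an explicit remainder, so that only
  finite sums have to be integrated; the remainder vanishes in the limit.\<close>

lemma stein_env_le_sum:
  assumes "\<theta> > 0" "t > 0"
  shows "stein_env \<theta> t y \<le> \<theta> / t * (indicator {..t} y
    + (\<Sum>j<N. 1 / real (Suc j) powr (1 + \<theta>) * indicator {real (Suc j) * t<..real (Suc j) * t + t} y)
    + 1 / real (Suc N) powr (1 + \<theta>))"
proof (cases "y \<le> t")
  case True
  have "\<theta> / t * 1 \<le> \<theta> / t * (1
    + (\<Sum>j<N. 1 / real (Suc j) powr (1 + \<theta>) * indicator {real (Suc j) * t<..real (Suc j) * t + t} y)
    + 1 / real (Suc N) powr (1 + \<theta>))"
    using assms by (intro mult_left_mono) (auto simp: sum_nonneg add.assoc)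
  then show ?thesis using True by (simp add: stein_env_def)
next
  case False
  have G: "stein_env \<theta> t y = \<theta> / t * (1 / (y / t) powr (1 + \<theta>))"
    using False assms by (simp add: stein_env_def stein_phi0_def powr_diff powr_minus powr_divide powr_add field_simps)
  \<comment> \<open>The offset 2 makes \<open>Suc j\<close> equal to the ceiling of y/t minus 1, so
    that y lies in the half-open interval starting at \<open>Suc j * t\<close>.\<close>
  define j where "j = nat (\<lceil>y / t\<rceil> - 2)"
  have "1 < y / t" using False assms by simp
  then have "2 \<le> \<lceil>y / t\<rceil>" by (simp add: le_ceiling_iff)
  then have "real (Suc j) = real_of_int (\<lceil>y / t\<rceil> - 1)" by (simp add: j_def)
  then have j: "real (Suc j) < y / t" "y / t \<le> real (Suc j) + 1"
    using ceiling_correct[of "y / t"] by linarith+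
  have le: "1 / (y / t) powr (1 + \<theta>) \<le> 1 / real (Suc i) powr (1 + \<theta>)" if "i \<le> j" for i
    using j assms that by (intro divide_left_mono powr_mono2 mult_pos_pos) auto
  have "1 / (y / t) powr (1 + \<theta>) \<le>
    (\<Sum>j<N. 1 / real (Suc j) powr (1 + \<theta>) * indicator {real (Suc j) * t<..real (Suc j) * t + t} y)
    + 1 / real (Suc N) powr (1 + \<theta>)"
  proof (cases "j < N")
    case True
    have "1 / (y / t) powr (1 + \<theta>) \<le> 1 / real (Suc j) powr (1 + \<theta>) * indicator {real (Suc j) * t<..real (Suc j) * t + t} y"
      using le[of j] j assms by (auto simp: indicator_def field_simps)
    also have "\<dots> \<le> (\<Sum>j<N. 1 / real (Suc j) powr (1 + \<theta>) * indicator {real (Suc j) * t<..real (Suc j) * t + t} y)"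
      using True by (intro member_le_sum) auto
    finally show ?thesis by (simp add: add_increasing2)
  next
    case False
    then show ?thesis using le[of N] by (intro add_increasing sum_nonneg) auto
  qed
  then show ?thesis unfolding G using False assms by (intro mult_left_mono) auto
qed

text \<open>The situation for one frozen value of the weights. Here \<delta> and K stand for the
  largest gap and the largest absolute partial sum, of which only the upper bounds
  \<open>gap\<close> and \<open>part\<close> are assumed.\<close>

locale dickman_approx = weighted_sum M X w n + D: dickman \<theta> D
  for M :: "'a measure" and X w n \<theta> D +
  fixes Xs :: "nat \<Rightarrow> nat measure" and \<delta> K :: real
  assumes n_pos: "1 \<le> n" and w0: "w 0 = 0"
    and w_mono: "\<And>k. k \<in> {1..n} \<Longrightarrow> w (k - 1) \<le> w k"
    and gap: "\<And>k. k \<in> {1..n} \<Longrightarrow> w k - w (k - 1) \<le> \<delta>"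
    and part: "\<And>k. k \<in> {1..n} \<Longrightarrow> \<bar>\<Sum>j=1..k. lam M X j * w j - \<theta> * (w j - w (j - 1))\<bar> \<le> K"
    and sb: "\<And>k. k \<in> {1..n} \<Longrightarrow> lam M X k > 0 \<Longrightarrow> size_biased M (X k) (Xs k)"
begin

definition tau :: "nat \<Rightarrow> real" where
  "tau k = tv_dist (Xs k) (distr M (count_space UNIV) (\<lambda>\<omega>. X k \<omega> + 1))
     / prob {\<omega> \<in> space M. X k \<omega> = x_min M (X k)}"

definition err :: real where
  "err = \<delta> + 2 / \<theta> * K + 2 / \<theta> * (\<Sum>k=1..n. lam M X k * w k * tau k) + \<bar>w n - 1\<bar>"

lemmas theta_pos = D.theta_pos

lemma lam_nonneg: "0 \<le> lam M X k"
  unfolding lam_def by (intro integral_nonneg_AE) simp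

text \<open>Only the product is controlled: if the mean is 0, nothing is known about
  \<open>Xs k\<close> and \<open>tau k\<close> may be any number.\<close>

lemma lam_tau_nonneg:
  assumes "k \<in> {1..n}"
  shows "0 \<le> lam M X k * tau k"
proof (cases "lam M X k = 0")
  case False
  then have "size_biased M (X k) (Xs k)" using sb[OF assms] lam_nonneg[of k] by simp
  then have "0 \<le> tv_dist (Xs k) (distr M (count_space UNIV) (\<lambda>\<omega>. X k \<omega> + 1))"
    using X_measurable[OF assms] by (intro tv_dist_nonneg prob_space_distr) (auto simp: size_biased_def)
  then show ?thesis using lam_nonneg[of k] by (simp add: tau_def)
qed simp

lemma sum_tau_nonneg: "0 \<le> (\<Sum>k=1..n. lam M X k * w k * tau k)"
  using lam_tau_nonneg w_nonneg by (intro sum_nonneg) (simp add: mult.commute mult.left_commute mult_nonneg_nonneg)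

text \<open>Since w n is at most n \<delta>, one has 1 \<le> w n + |w n - 1| \<le> n (\<delta> + |w
  n - 1|). A positive error is needed for the threshold in \<open>dist_self_bound\<close> and, with
  random weights, for the tangent inequality; the bound does not depend on the weights.\<close>

lemma err_ge: "1 / real n \<le> err"
proof -
  have w_le: "w k \<le> real k * \<delta>" if "k \<le> n" for k
    using that
  proof (induction k)
    case (Suc k)
    then show ?case using gap[of "Suc k"] by (simp add: algebra_simps)
  qed (simp add: w0)
  have "\<delta> \<ge> 0" using gap[of 1] w_mono[of 1] n_pos by simp
  have "1 * \<bar>w n - 1\<bar> \<le> real n * \<bar>w n - 1\<bar>" using n_pos by (intro mult_right_mono) auto
  then have "1 \<le> real n * (\<delta> + \<bar>w n - 1\<bar>)"
    using w_le[of n] by (simp add: distrib_left)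
  then have "1 / real n \<le> \<delta> + \<bar>w n - 1\<bar>" using n_pos by (simp add: field_simps)
  moreover have "0 \<le> K" using part[of 1] n_pos by auto
  then have "0 \<le> 2 / \<theta> * K" using theta_pos by simp
  moreover have "0 \<le> 2 / \<theta> * (\<Sum>k=1..n. lam M X k * w k * tau k)"
    using sum_tau_nonneg theta_pos by (intro mult_nonneg_nonneg) auto
  ultimately show ?thesis unfolding err_def by linarith
qed

lemma err_pos: "0 < err"
  using n_pos by (intro less_le_trans[OF _ err_ge]) simp

lemma exchange:
  assumes "t > 0" and k: "k \<in> {1..n}"
  shows "\<bar>(\<integral>\<omega>. real (X k \<omega>) * stein_phi \<theta> t (S \<omega>) \<partial>M) - lam M X k * (\<integral>\<omega>. stein_phi \<theta> t (S \<omega> + w k) \<partial>M)\<bar>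
    \<le> lam M X k * tau k * (\<integral>\<omega>. \<theta>\<^sup>2 + stein_env \<theta> t (S \<omega>) \<partial>M)"
proof (cases "lam M X k = 0")
  case True
  then have "AE \<omega> in M. real (X k \<omega>) = 0"
    using int_X[OF k] unfolding lam_def by (subst (asm) integral_nonneg_eq_0_iff_AE) auto
  moreover have [measurable]: "X k \<in> measurable M (count_space UNIV)" by (rule X_measurable[OF k])
  ultimately have "(\<integral>\<omega>. real (X k \<omega>) * stein_phi \<theta> t (S \<omega>) \<partial>M) = (\<integral>\<omega>. 0 \<partial>M)"
    by (intro integral_cong_AE) (auto elim: eventually_mono)
  with True show ?thesis by simp
next
  case False
  then have "lam M X k > 0" using lam_nonneg[of k] by simp
  then show ?thesis
    using exchange_bound[OF theta_pos assms(1) k _ sb[OF k]] by (simp add: lam_def tau_def)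
qed

lemma expectation_indicator_S:
  assumes "A \<in> sets borel"
  shows "(\<integral>\<omega>. indicator A (S \<omega>) \<partial>M) = prob {\<omega> \<in> space M. S \<omega> \<in> A}"
proof -
  have "(\<integral>\<omega>. indicator A (S \<omega>) \<partial>M) = (\<integral>\<omega>. indicator {\<omega> \<in> space M. S \<omega> \<in> A} \<omega> \<partial>M)"
    by (intro Bochner_Integration.integral_cong) (auto simp: indicator_def)
  also have "\<dots> = prob ({\<omega> \<in> space M. S \<omega> \<in> A} \<inter> space M)"
    by (rule Bochner_Integration.integral_indicator)
  also have "{\<omega> \<in> space M. S \<omega> \<in> A} \<inter> space M = {\<omega> \<in> space M. S \<omega> \<in> A}" by auto
  finally show ?thesis .
qed

text \<open>The Stein equation is taken at S and integrated. \<open>J\<close> is the integral of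
  \<phi> over [S, S + 1] and \<open>T\<close> the weighted sum compared with it in
  \<open>stein_pointwise\<close>; the expectation of S \<phi>(S)/\<theta> differs from that of
  \<open>T\<close> by the exchange errors of the single summands.\<close>

lemma stein_bound:
  assumes t: "t > 0"
  shows "\<bar>prob {\<omega> \<in> space M. S \<omega> \<le> t} - measure D {..t}\<bar> \<le> err * (\<theta>\<^sup>2 + (\<integral>\<omega>. stein_env \<theta> t (S \<omega>) \<partial>M))"
proof -
  let ?G = "\<lambda>\<omega>. \<theta>\<^sup>2 + stein_env \<theta> t (S \<omega>)"
  define J where "J \<omega> = indicator {..t} (S \<omega>) + S \<omega> / \<theta> * stein_phi \<theta> t (S \<omega>) - measure D {..t}" for \<omega>
  define T where "T \<omega> = (\<Sum>k=1..n. lam M X k * w k * stein_phi \<theta> t (S \<omega> + w k)) / \<theta>" for \<omega>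
  define E where "E = (\<integral>\<omega>. ?G \<omega> \<partial>M)"
  have E: "E = \<theta>\<^sup>2 + (\<integral>\<omega>. stein_env \<theta> t (S \<omega>) \<partial>M)"
    unfolding E_def using integrable_env_S[OF theta_pos t] by (subst Bochner_Integration.integral_add) (auto simp: prob_space)
  have E0: "0 \<le> E"
    unfolding E_def using stein_env_nonneg[OF theta_pos t] by (intro integral_nonneg_AE AE_I2) simp
  have Gi: "integrable M ?G" using integrable_env_S[OF theta_pos t] by simp
  have Sphi: "S \<omega> / \<theta> * stein_phi \<theta> t (S \<omega>) = (\<Sum>k=1..n. w k / \<theta> * (real (X k \<omega>) * stein_phi \<theta> t (S \<omega>)))" for \<omega>
    by (simp add: S_def sum_distrib_right sum_divide_distrib mult.assoc)
  have Sphi_i: "integrable M (\<lambda>\<omega>. S \<omega> / \<theta> * stein_phi \<theta> t (S \<omega>))"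
    unfolding Sphi using integrable_X_phi_S[OF theta_pos t]
    by (intro Bochner_Integration.integrable_sum integrable_mult_right) auto
  have ind_i: "integrable M (\<lambda>\<omega>. indicator {..t} (S \<omega>) :: real)"
    by (rule integrable_const_bound[of _ 1]) (auto simp: indicator_def)
  have Ji: "integrable M J" unfolding J_def using Sphi_i ind_i by simp
  have Ti: "integrable M T"
    unfolding T_def using integrable_phi_S[OF theta_pos t] w_nonneg
    by (intro integrable_divide Bochner_Integration.integrable_sum integrable_mult_right) auto
  have EJ: "(\<integral>\<omega>. J \<omega> \<partial>M) = prob {\<omega> \<in> space M. S \<omega> \<le> t} + (\<integral>\<omega>. S \<omega> / \<theta> * stein_phi \<theta> t (S \<omega>) \<partial>M) - measure D {..t}"
    unfolding J_def using Sphi_i ind_i expectation_indicator_S[of "{..t}"] by (simp add: prob_space)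
  have ESphi: "(\<integral>\<omega>. S \<omega> / \<theta> * stein_phi \<theta> t (S \<omega>) \<partial>M) = (\<Sum>k=1..n. w k / \<theta> * (\<integral>\<omega>. real (X k \<omega>) * stein_phi \<theta> t (S \<omega>) \<partial>M))"
    unfolding Sphi using integrable_X_phi_S[OF theta_pos t] by (subst Bochner_Integration.integral_sum) auto
  have ET: "(\<integral>\<omega>. T \<omega> \<partial>M) = (\<Sum>k=1..n. w k / \<theta> * (lam M X k * (\<integral>\<omega>. stein_phi \<theta> t (S \<omega> + w k) \<partial>M)))"
    unfolding T_def sum_divide_distrib using integrable_phi_S[OF theta_pos t] w_nonneg
    by (subst Bochner_Integration.integral_sum) (auto intro!: sum.cong)
  define c where "c = \<delta> + 2 / \<theta> * K + \<bar>w n - 1\<bar>"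
  have "\<bar>(\<integral>\<omega>. J \<omega> \<partial>M) - (\<integral>\<omega>. T \<omega> \<partial>M)\<bar> = \<bar>\<integral>\<omega>. J \<omega> - T \<omega> \<partial>M\<bar>"
    using Ji Ti by simp
  also have "\<dots> \<le> (\<integral>\<omega>. \<bar>J \<omega> - T \<omega>\<bar> \<partial>M)" by (rule integral_abs_bound)
  also have "\<dots> \<le> (\<integral>\<omega>. c * ?G \<omega> \<partial>M)"
  proof (rule integral_mono)
    fix \<omega>
    have "J \<omega> = integral {S \<omega>..S \<omega> + 1} (stein_phi \<theta> t)"
      unfolding J_def by (rule D.stein_equation[OF t S_nonneg, symmetric])
    then show "\<bar>J \<omega> - T \<omega>\<bar> \<le> c * ?G \<omega>"
      using stein_pointwise[of \<theta> t "S \<omega>" n w \<delta> "lam M X" K, OF theta_pos t S_nonneg n_pos w0 w_mono gap part]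
      by (simp only: T_def c_def)
  qed (use Ji Ti Gi in simp_all)
  finally have 1: "\<bar>(\<integral>\<omega>. J \<omega> \<partial>M) - (\<integral>\<omega>. T \<omega> \<partial>M)\<bar> \<le> c * E" by (simp add: E_def)
  have diff: "(\<integral>\<omega>. S \<omega> / \<theta> * stein_phi \<theta> t (S \<omega>) \<partial>M) - (\<integral>\<omega>. T \<omega> \<partial>M)
    = (\<Sum>k=1..n. w k / \<theta> * ((\<integral>\<omega>. real (X k \<omega>) * stein_phi \<theta> t (S \<omega>) \<partial>M) - lam M X k * (\<integral>\<omega>. stein_phi \<theta> t (S \<omega> + w k) \<partial>M)))"
    unfolding ESphi ET by (simp add: sum_subtractf right_diff_distrib)
  have "\<bar>(\<integral>\<omega>. S \<omega> / \<theta> * stein_phi \<theta> t (S \<omega>) \<partial>M) - (\<integral>\<omega>. T \<omega> \<partial>M)\<bar>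
    \<le> (\<Sum>k=1..n. w k / \<theta> * (lam M X k * tau k * E))"
    unfolding diff
  proof (rule order_trans[OF sum_abs sum_mono])
    fix k assume k: "k \<in> {1..n}"
    have "0 \<le> w k / \<theta>" using w_nonneg[OF k] theta_pos by simp
    then show "\<bar>w k / \<theta> * ((\<integral>\<omega>. real (X k \<omega>) * stein_phi \<theta> t (S \<omega>) \<partial>M) - lam M X k * (\<integral>\<omega>. stein_phi \<theta> t (S \<omega> + w k) \<partial>M))\<bar>
      \<le> w k / \<theta> * (lam M X k * tau k * E)"
      unfolding abs_mult E_def using exchange[OF t k] by (simp only: abs_of_nonneg) (rule mult_left_mono)
  qed
  also have "\<dots> = (1 / \<theta> * (\<Sum>k=1..n. lam M X k * w k * tau k)) * E"
    unfolding sum_distrib_left sum_distrib_right by (intro sum.cong) auto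
  \<comment> \<open>The exchange yields the factor 1/\<theta>; it is enlarged to 2/\<theta> to match
    \<open>err\<close>.\<close>
  also have "\<dots> \<le> (2 / \<theta> * (\<Sum>k=1..n. lam M X k * w k * tau k)) * E"
    using sum_tau_nonneg theta_pos E0 by (intro mult_right_mono divide_right_mono) auto
  finally have 2: "\<bar>(\<integral>\<omega>. S \<omega> / \<theta> * stein_phi \<theta> t (S \<omega>) \<partial>M) - (\<integral>\<omega>. T \<omega> \<partial>M)\<bar>
    \<le> (2 / \<theta> * (\<Sum>k=1..n. lam M X k * w k * tau k)) * E" .
  have "err * E = c * E + (2 / \<theta> * (\<Sum>k=1..n. lam M X k * w k * tau k)) * E"
    unfolding err_def c_def by (simp only: distrib_right)
  with 1 2 EJ show ?thesis unfolding E[symmetric] by linarith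
qed

text \<open>Interval probabilities of S are compared with those of D. An interval (x, x + t] has two
  endpoints and costs 2d, while {..t} costs d only; the coefficients of the intervals sum to at most
  zeta(1+\<theta>).\<close>

lemma expectation_env_le:
  assumes t: "t > 0"
    and d: "\<And>x. 0 \<le> x \<Longrightarrow> \<bar>prob {\<omega> \<in> space M. S \<omega> \<le> x} - measure D {..x}\<bar> \<le> d"
    and q: "measure D {..t} \<le> q" "\<And>x. 0 \<le> x \<Longrightarrow> measure D {x<..x + t} \<le> q"
  shows "(\<integral>\<omega>. stein_env \<theta> t (S \<omega>) \<partial>M) \<le> \<theta> / t * ((q + d) + zeta_real (1 + \<theta>) * (q + 2 * d))"
proof -
  let ?z = "\<lambda>j. 1 / real (Suc j) powr (1 + \<theta>)"
  have q0: "0 \<le> q" using q(1) measure_nonneg order_trans by blast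
  have d0: "0 \<le> d" using d[of 0] by simp
  have ind_i: "integrable M (\<lambda>\<omega>. indicator A (S \<omega>) :: real)" if [measurable]: "A \<in> sets borel" for A
    by (rule integrable_const_bound[of _ 1]) (auto simp: indicator_def)
  have P_int: "prob {\<omega> \<in> space M. S \<omega> \<in> {x<..x + t}} \<le> q + 2 * d" if "0 \<le> x" for x
  proof -
    have "prob {\<omega> \<in> space M. S \<omega> \<le> x + t} = prob {\<omega> \<in> space M. S \<omega> \<le> x} + prob {\<omega> \<in> space M. S \<omega> \<in> {x<..x + t}}"
      using t by (subst finite_measure_Union[symmetric]) (auto intro!: arg_cong[where f = prob])
    moreover have "measure D {..x + t} = measure D {..x} + measure D {x<..x + t}"
      using t by (subst D.finite_measure_Union[symmetric]) (auto intro!: arg_cong[where f = "measure D"])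
    ultimately show ?thesis
      using d[of x] d[of "x + t"] q(2)[OF that] t that by linarith
  qed
  have bound: "(\<integral>\<omega>. stein_env \<theta> t (S \<omega>) \<partial>M) \<le> \<theta> / t * ((q + d) + zeta_real (1 + \<theta>) * (q + 2 * d) + ?z N)" for N
  proof -
    let ?R = "\<lambda>\<omega>. \<theta> / t * (indicator {..t} (S \<omega>)
      + (\<Sum>j<N. ?z j * indicator {real (Suc j) * t<..real (Suc j) * t + t} (S \<omega>)) + ?z N)"
    have "(\<integral>\<omega>. stein_env \<theta> t (S \<omega>) \<partial>M) \<le> (\<integral>\<omega>. ?R \<omega> \<partial>M)"
    proof (rule integral_mono)
      show "integrable M ?R"
        by (intro integrable_mult_right Bochner_Integration.integrable_add Bochner_Integration.integrable_sum ind_i) auto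
      show "stein_env \<theta> t (S \<omega>) \<le> ?R \<omega>" for \<omega> by (rule stein_env_le_sum[OF theta_pos t])
    qed (rule integrable_env_S[OF theta_pos t])
    also have "\<dots> = \<theta> / t * (prob {\<omega> \<in> space M. S \<omega> \<in> {..t}}
      + (\<Sum>j<N. ?z j * prob {\<omega> \<in> space M. S \<omega> \<in> {real (Suc j) * t<..real (Suc j) * t + t}}) + ?z N)"
      using ind_i by (simp add: expectation_indicator_S prob_space Bochner_Integration.integral_sum del: of_nat_Suc greaterThanAtMost_iff atMost_iff)
    also have "\<dots> \<le> \<theta> / t * ((q + d) + (\<Sum>j<N. ?z j * (q + 2 * d)) + ?z N)"
      using d[of t] q(1) t theta_pos
      by (intro mult_left_mono add_mono sum_mono P_int order_refl) auto
    also have "\<dots> \<le> \<theta> / t * ((q + d) + zeta_real (1 + \<theta>) * (q + 2 * d) + ?z N)"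
    proof (intro mult_left_mono add_mono order_refl)
      show "(\<Sum>j<N. ?z j * (q + 2 * d)) \<le> zeta_real (1 + \<theta>) * (q + 2 * d)"
        unfolding sum_distrib_right[symmetric] zeta_real_def
        using q0 d0 theta_pos by (intro mult_right_mono sum_le_suminf summable_zeta_real) auto
    qed (use t theta_pos in auto)
    finally show ?thesis .
  qed
  have "(\<lambda>N. \<theta> / t * ((q + d) + zeta_real (1 + \<theta>) * (q + 2 * d) + ?z N))
    \<longlonglongrightarrow> \<theta> / t * ((q + d) + zeta_real (1 + \<theta>) * (q + 2 * d) + 0)"
    by (intro tendsto_intros summable_LIMSEQ_zero summable_zeta_real theta_pos)
  then show ?thesis
    using bound by (intro LIMSEQ_le_const[of _ _ "\<integral>\<omega>. stein_env \<theta> t (S \<omega>) \<partial>M"]) auto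
qed

text \<open>The supremum d of the distance occurs on the right with the coefficient err \<theta> (1
  + 2 zeta) / t. The threshold a is chosen so that this is at most 1/2 for t \<ge> a. As d is
  finite, being at most 1, half of it can be moved to the left, which doubles all other
  terms.\<close>

lemma dist_self_bound:
  fixes q :: "real \<Rightarrow> real"
  assumes q: "\<And>t. 0 < t \<Longrightarrow> measure D {..t} \<le> q t"
      "\<And>t x. 0 < t \<Longrightarrow> 0 \<le> x \<Longrightarrow> measure D {x<..x + t} \<le> q t"
    and a: "a = (2 * \<theta> + 4 * \<theta> * zeta_real (1 + \<theta>)) * err"
    and r: "\<And>t. a \<le> t \<Longrightarrow> q t / t \<le> r"
    and "0 \<le> x"
  shows "\<bar>prob {\<omega> \<in> space M. S \<omega> \<le> x} - measure D {..x}\<bar>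
    \<le> 2 * (err * (\<theta>\<^sup>2 + \<theta> * (1 + zeta_real (1 + \<theta>)) * r)) + 2 * q a"
proof -
  let ?\<Delta> = "\<lambda>x. \<bar>prob {\<omega> \<in> space M. S \<omega> \<le> x} - measure D {..x}\<bar>" and ?z = "zeta_real (1 + \<theta>)"
  define d where "d = (SUP x\<in>{0..}. ?\<Delta> x)"
  have le1: "?\<Delta> x \<le> 1" for x
    using prob_le_1[of "{\<omega> \<in> space M. S \<omega> \<le> x}"] D.prob_le_1[of "{..x}"]
      measure_nonneg[of M "{\<omega> \<in> space M. S \<omega> \<le> x}"] measure_nonneg[of D "{..x}"]
    unfolding abs_le_iff by linarith
  have d: "?\<Delta> x \<le> d" if "0 \<le> x" for x
    unfolding d_def using that le1 by (intro cSUP_upper bdd_aboveI2) auto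
  have d0: "0 \<le> d" using d[of 0] by simp
  have z0: "0 \<le> ?z" unfolding zeta_real_def by (intro suminf_nonneg summable_zeta_real theta_pos) auto
  have apos: "0 < a" unfolding a using theta_pos z0 err_pos by (intro mult_pos_pos add_pos_nonneg) auto
  have main: "?\<Delta> t \<le> err * (\<theta>\<^sup>2 + \<theta> * (1 + ?z) * r) + d / 2" if "a \<le> t" for t
  proof -
    have t: "0 < t" using that apos by simp
    have "?\<Delta> t \<le> err * (\<theta>\<^sup>2 + \<theta> / t * ((q t + d) + ?z * (q t + 2 * d)))"
      using stein_bound[OF t] expectation_env_le[OF t d q(1)[OF t] q(2)[OF t]] err_pos
      by (meson add_left_mono less_imp_le mult_left_mono order_trans)
    also have "\<dots> = err * (\<theta>\<^sup>2 + \<theta> * (1 + ?z) * (q t / t)) + (err * \<theta> * (1 + 2 * ?z)) * d / t"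
      using t by (simp add: field_simps)
    also have "\<dots> \<le> err * (\<theta>\<^sup>2 + \<theta> * (1 + ?z) * r) + (err * \<theta> * (1 + 2 * ?z)) * d / a"
      using err_pos theta_pos z0 r[OF that] d0 apos that
      by (intro add_mono mult_left_mono divide_left_mono mult_nonneg_nonneg mult_pos_pos) auto
    also have "(err * \<theta> * (1 + 2 * ?z)) * d / a = d / 2"
    proof -
      have e: "err * \<theta> * (1 + 2 * ?z) = a / 2" unfolding a by (simp add: algebra_simps)
      show ?thesis unfolding e using apos by simp
    qed
    finally show ?thesis .
  qed
  let ?B = "err * (\<theta>\<^sup>2 + \<theta> * (1 + ?z) * r) + d / 2 + q a"
  have qa: "0 \<le> q a" using q(1)[OF apos] measure_nonneg order_trans by blast
  have "?\<Delta> x \<le> ?B" if "0 \<le> x" for x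
  proof (cases "a \<le> x")
    case True
    then show ?thesis using main[OF True] qa by simp
  next
    \<comment> \<open>Below the threshold both distribution functions lie between 0 and their values
      at a. The one of D is at most q(a) there, the one of S at most q(a) plus the distance at
      a.\<close>
    case False
    have "measure D {..x} \<le> measure D {..a}" "prob {\<omega> \<in> space M. S \<omega> \<le> x} \<le> prob {\<omega> \<in> space M. S \<omega> \<le> a}"
      using False by (auto intro!: D.finite_measure_mono finite_measure_mono)
    moreover have "0 \<le> measure D {..x}" "0 \<le> prob {\<omega> \<in> space M. S \<omega> \<le> x}" by auto
    moreover have "0 \<le> err * (\<theta>\<^sup>2 + \<theta> * (1 + ?z) * r) + d / 2"
      using main[OF order_refl] by linarith
    ultimately show ?thesis using main[OF order_refl] q(1)[OF apos] by linarith
  qed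
  then have "d \<le> ?B" unfolding d_def[of] by (intro cSUP_least) auto
  then show ?thesis using d[OF \<open>0 \<le> x\<close>] by (simp add: field_simps)
qed

lemma kolmogorov_bound_ge_1:
  assumes "\<theta> \<ge> 1" and p: "p \<in> borel_measurable borel" "D = density lborel (\<lambda>x. ennreal (p x))"
    and \<kappa>: "\<And>x. 1 \<le> x \<Longrightarrow> p x \<le> \<kappa>" "\<kappa> > 0" and x: "0 \<le> x"
  shows "\<bar>prob {\<omega> \<in> space M. S \<omega> \<le> x} - measure D {..x}\<bar>
    \<le> (2 * \<theta>\<^sup>2 + (6 * \<theta> + 10 * \<theta> * zeta_real (1 + \<theta>)) * \<kappa>) * err"
proof -
  define a where "a = (2 * \<theta> + 4 * \<theta> * zeta_real (1 + \<theta>)) * err"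
  have a0: "0 < a"
    unfolding a_def zeta_real_def using theta_pos err_pos
    by (intro mult_pos_pos add_pos_nonneg mult_nonneg_nonneg suminf_nonneg summable_zeta_real) auto
  have int: "measure D {y<..y + t} \<le> \<kappa> * t" if "0 < t" for y t
    by (rule D.measure_interval_le_linear[OF assms(1) p \<kappa> that])
  have "\<bar>prob {\<omega> \<in> space M. S \<omega> \<le> x} - measure D {..x}\<bar>
    \<le> 2 * (err * (\<theta>\<^sup>2 + \<theta> * (1 + zeta_real (1 + \<theta>)) * \<kappa>)) + 2 * (\<kappa> * a)"
  proof (rule dist_self_bound[where q = "\<lambda>t. \<kappa> * t" and a = a])
    show "measure D {..t} \<le> \<kappa> * t" if "0 < t" for t
      using int[OF that, of 0] by (simp add: D.measure_atMost_eq)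
    show "measure D {y<..y + t} \<le> \<kappa> * t" if "0 < t" "0 \<le> y" for t y
      by (rule int) fact
  qed (use a0 x in \<open>auto simp: a_def\<close>)
  \<comment> \<open>The first part contributes 2 \<theta> (1 + zeta) \<kappa> and the term 2
    \<kappa> a contributes (4 \<theta> + 8 \<theta> zeta) \<kappa>, which explains the constants 6
    and 10.\<close>
  also have "\<dots> = (2 * \<theta>\<^sup>2 + (6 * \<theta> + 10 * \<theta> * zeta_real (1 + \<theta>)) * \<kappa>) * err"
    unfolding a_def by (simp add: algebra_simps)
  finally show ?thesis .
qed

lemma kolmogorov_bound_less_1:
  assumes "\<theta> < 1" and x: "0 \<le> x"
  shows "\<bar>prob {\<omega> \<in> space M. S \<omega> \<le> x} - measure D {..x}\<bar> \<le> 2 * \<theta>\<^sup>2 * err + C2 \<theta> * err powr \<theta>"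
proof -
  let ?z = "zeta_real (1 + \<theta>)"
  define a where "a = (2 * \<theta> + 4 * \<theta> * ?z) * err"
  have z0: "0 \<le> ?z" unfolding zeta_real_def by (intro suminf_nonneg summable_zeta_real theta_pos) auto
  have a0: "0 < a" unfolding a_def using theta_pos err_pos z0 by (intro mult_pos_pos add_pos_nonneg) auto
  have "\<bar>prob {\<omega> \<in> space M. S \<omega> \<le> x} - measure D {..x}\<bar>
    \<le> 2 * (err * (\<theta>\<^sup>2 + \<theta> * (1 + ?z) * (a powr (\<theta> - 1)))) + 2 * (a powr \<theta>)"
  proof (rule dist_self_bound[where q = "\<lambda>t. t powr \<theta>" and a = a])
    show "t powr \<theta> / t \<le> a powr (\<theta> - 1)" if "a \<le> t" for t
    proof -
      have "t powr \<theta> / t = t powr (\<theta> - 1)" using that a0 by (simp add: powr_diff)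
      also have "\<dots> \<le> a powr (\<theta> - 1)" using that a0 assms by (intro powr_mono2') auto
      finally show ?thesis .
    qed
  qed (use a0 x assms D.measure_atMost_le_powr D.measure_interval_le_powr in \<open>auto simp: a_def\<close>)
  also have "\<dots> = 2 * \<theta>\<^sup>2 * err + (2 * \<theta> + 2 * \<theta> * ?z) * err * (a powr (\<theta> - 1)) + 2 * (a powr \<theta>)"
    by (simp add: algebra_simps)
  \<comment> \<open>Because (2 \<theta> + 2 \<theta> zeta) err is at most a, the middle term is at
    most a^\<theta>. Together with 2 a^\<theta> this gives the factor 3 in
    \<open>C2\<close>.\<close>
  also have "\<dots> \<le> 2 * \<theta>\<^sup>2 * err + a * (a powr (\<theta> - 1)) + 2 * (a powr \<theta>)"
    unfolding a_def using theta_pos z0 err_pos by (intro add_mono mult_right_mono) auto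
  also have "a * (a powr (\<theta> - 1)) = a powr \<theta>" using a0 by (simp add: powr_diff)
  also have "a powr \<theta> = (2 * \<theta> + 4 * \<theta> * ?z) powr \<theta> * err powr \<theta>"
    unfolding a_def by (rule powr_mult)
  finally show ?thesis by (simp add: C2_def algebra_simps)
qed

end

section \<open>Random weights\<close>

text \<open>A concave function lies below its tangent; here by the weighted arithmetic-geometric
  mean inequality for x/m and 1. Integrated with m equal to the mean of x, it plays the role of
  Jensen's inequality.\<close>

lemma powr_le_tangent:
  fixes x m \<theta> :: real
  assumes "0 < x" "0 < m" "0 < \<theta>" "\<theta> < 1"
  shows "x powr \<theta> \<le> m powr \<theta> + \<theta> * m powr (\<theta> - 1) * (x - m)"
proof -
  have "(x / m) powr \<theta> * 1 powr (1 - \<theta>) \<le> \<theta> * (x / m) + (1 - \<theta>) * 1"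
    using assms by (intro Youngs_inequality_0) auto
  then have "m powr \<theta> * (x / m) powr \<theta> \<le> m powr \<theta> * (\<theta> * (x / m) + (1 - \<theta>))"
    using assms by (intro mult_left_mono) auto
  moreover have "m powr \<theta> * (x / m) powr \<theta> = x powr \<theta>"
    using assms by (simp add: powr_divide)
  moreover have "m powr \<theta> * (\<theta> * (x / m) + (1 - \<theta>)) = m powr \<theta> + \<theta> * m powr (\<theta> - 1) * (x - m)"
    using assms by (simp add: powr_diff field_simps)
  ultimately show ?thesis by simp
qed

text \<open>Both tuples are functions of the array and of the sequence respectively, so their
  sigma-algebras are contained in the independent ones. The X k are cast to reals so that both
  tuples have the same type, as \<open>indep_var\<close> demands.\<close>

lemma (in prob_space) indep_var_row_prefix:
  assumes indep: "array_indep_seq M W X"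
    and W: "\<And>n k. 1 \<le> k \<Longrightarrow> k \<le> n \<Longrightarrow> W n k \<in> borel_measurable M"
    and X: "\<And>k. 1 \<le> k \<Longrightarrow> X k \<in> measurable M (count_space UNIV)"
  shows "indep_var (Pi\<^sub>M {1..n} (\<lambda>_. borel)) (\<lambda>\<omega>. \<lambda>k\<in>{1..n}. real (X k \<omega>))
    (Pi\<^sub>M {1..n} (\<lambda>_. borel)) (\<lambda>\<omega>. \<lambda>k\<in>{1..n}. W n k \<omega>)"
proof -
  let ?N = "Pi\<^sub>M {1..n} (\<lambda>_. borel) :: (nat \<Rightarrow> real) measure"
  let ?f = "\<lambda>\<omega>. \<lambda>(n, k)\<in>tri_index. W n k \<omega>" and ?g = "\<lambda>\<omega>. \<lambda>k\<in>{1..}. X k \<omega>"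
  let ?A = "vimage_algebra (space M) ?f (Pi\<^sub>M tri_index (\<lambda>_. borel))"
  let ?B = "vimage_algebra (space M) ?g (Pi\<^sub>M {1..} (\<lambda>_. count_space UNIV))"
  let ?X = "\<lambda>\<omega>. \<lambda>k\<in>{1..n}. real (X k \<omega>)" and ?W = "\<lambda>\<omega>. \<lambda>k\<in>{1..n}. W n k \<omega>"
  have AB: "indep_set (sets ?A) (sets ?B)" using indep by (simp add: array_indep_seq_def)
  have "?f \<in> measurable ?A (Pi\<^sub>M tri_index (\<lambda>_. borel))"
    by (rule measurable_vimage_algebra1) (auto simp: space_PiM PiE_def extensional_def)
  moreover have "(\<lambda>u. \<lambda>k\<in>{1..n}. u (n, k)) \<in> measurable (Pi\<^sub>M tri_index (\<lambda>_. borel)) ?N"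
    by (intro measurable_restrict measurable_component_singleton) (auto simp: tri_index_def)
  ultimately have "(\<lambda>\<omega>. \<lambda>k\<in>{1..n}. ?f \<omega> (n, k)) \<in> measurable ?A ?N"
    by (rule measurable_compose)
  also have "(\<lambda>\<omega>. \<lambda>k\<in>{1..n}. ?f \<omega> (n, k)) = ?W"
    by (intro ext) (auto simp: tri_index_def restrict_def)
  finally have W_A: "?W \<in> measurable ?A ?N" .
  have "?g \<in> measurable ?B (Pi\<^sub>M {1..} (\<lambda>_. count_space UNIV))"
    by (rule measurable_vimage_algebra1) (auto simp: space_PiM PiE_def extensional_def)
  moreover have "(\<lambda>u. \<lambda>k\<in>{1..n}. real (u k)) \<in> measurable (Pi\<^sub>M {1..} (\<lambda>_. count_space UNIV)) ?N"
    by (intro measurable_restrict measurable_compose[OF measurable_component_singleton]) auto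
  ultimately have "(\<lambda>\<omega>. \<lambda>k\<in>{1..n}. real (?g \<omega> k)) \<in> measurable ?B ?N"
    by (rule measurable_compose)
  also have "(\<lambda>\<omega>. \<lambda>k\<in>{1..n}. real (?g \<omega> k)) = ?X"
    by (intro ext) (auto simp: restrict_def)
  finally have X_B: "?X \<in> measurable ?B ?N" .
  have sub: "sigma_sets (space M) {Y -` C \<inter> space M |C. C \<in> sets ?N} \<subseteq> sets V"
    if "Y \<in> measurable V ?N" "space V = space M" for V :: "'a measure" and Y
    unfolding that(2)[symmetric] by (rule sets.sigma_sets_subset) (auto intro: measurable_sets[OF that(1)])
  have "indep_set (sigma_sets (space M) {?X -` C \<inter> space M |C. C \<in> sets ?N})
      (sigma_sets (space M) {?W -` C \<inter> space M |C. C \<in> sets ?N})"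
  proof (rule indep_setI)
    have evA: "sets ?A \<subseteq> events" and evB: "sets ?B \<subseteq> events"
      using AB indep_setD_ev1 indep_setD_ev2 by blast+
    show "sigma_sets (space M) {?X -` C \<inter> space M |C. C \<in> sets ?N} \<subseteq> events"
      by (rule order_trans[OF sub[OF X_B] evB]) simp
    show "sigma_sets (space M) {?W -` C \<inter> space M |C. C \<in> sets ?N} \<subseteq> events"
      by (rule order_trans[OF sub[OF W_A] evA]) simp
    fix a b
    assume "a \<in> sigma_sets (space M) {?X -` C \<inter> space M |C. C \<in> sets ?N}"
      and "b \<in> sigma_sets (space M) {?W -` C \<inter> space M |C. C \<in> sets ?N}"
    then have "a \<in> sets ?B" "b \<in> sets ?A" using sub[OF X_B] sub[OF W_A] by auto
    then show "prob (a \<inter> b) = prob a * prob b"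
      using indep_setD[OF AB, of b a] by (simp add: Int_commute mult.commute)
  qed
  moreover have "?X \<in> measurable M ?N" "?W \<in> measurable M ?N"
    using X W by (auto intro!: measurable_restrict measurable_compose[OF X])
  ultimately show ?thesis by (simp add: indep_var_eq)
qed

theorem corollary1p2:
  fixes M :: "'a measure" and \<theta> \<kappa> :: real
    and W :: "nat \<Rightarrow> nat \<Rightarrow> 'a \<Rightarrow> real" and X :: "nat \<Rightarrow> 'a \<Rightarrow> nat"
    and Xs :: "nat \<Rightarrow> nat measure"
    and D :: "real measure" and p :: "real \<Rightarrow> real"
  assumes "prob_space M"
    and "\<theta> > 0"
    and "gen_dickman \<theta> D"
    and "p \<in> borel_measurable borel" and "\<And>x. 0 \<le> p x"
    and "D = density lborel (\<lambda>x. ennreal (p x))"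
    and "\<kappa> > 0" and "\<And>x. 1 \<le> x \<Longrightarrow> p x \<le> \<kappa>"
    and "\<And>n k. 1 \<le> k \<Longrightarrow> k \<le> n \<Longrightarrow> W n k \<in> borel_measurable M"
    and "\<And>n \<omega>. 1 \<le> n \<Longrightarrow> \<omega> \<in> space M \<Longrightarrow> W n 0 \<omega> = 0"
    and "\<And>n k \<omega>. 1 \<le> k \<Longrightarrow> k \<le> n \<Longrightarrow> \<omega> \<in> space M \<Longrightarrow> W n (k - 1) \<omega> \<le> W n k \<omega>"
    and "\<And>n. 1 \<le> n \<Longrightarrow> integrable M (W n n)"
    and "prob_space.indep_vars M (\<lambda>_. count_space UNIV) X {1..}"
    and "\<And>k. 1 \<le> k \<Longrightarrow> integrable M (\<lambda>\<omega>. real (X k \<omega>))"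
    and "array_indep_seq M W X"
    and "\<And>k. 1 \<le> k \<Longrightarrow> lam M X k > 0 \<Longrightarrow> size_biased M (X k) (Xs k)"
  shows "\<forall>n\<ge>1. kolmogorov_dist (distr M borel (wsum W X n)) D \<le>
    (let E = (\<integral>\<omega>. eps M \<theta> W X Xs n \<omega> \<partial>M) in
     if \<theta> \<ge> 1 then C1 \<theta> \<kappa> * E
     else 2 * \<theta>\<^sup>2 * E + C2 \<theta> * E powr \<theta>)"
proof (intro allI impI)
  fix n :: nat assume n: "1 \<le> n"
  note theta_pos = assms(2) and W_meas = assms(9) and W_0 = assms(10) and W_mono = assms(11)
    and indep_X = assms(13)
  interpret prob_space M by fact
  interpret D: dickman \<theta> D by standard (fact assms)+
  let ?e = "eps M \<theta> W X Xs n"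
  define E where "E = (\<integral>\<omega>. ?e \<omega> \<partial>M)"
  have X_meas: "X k \<in> measurable M (count_space UNIV)" if "1 \<le> k" for k
    using indep_X that by (auto simp: indep_vars_def)
  have W_le: "W n j \<omega> \<le> W n k \<omega>" if "\<omega> \<in> space M" "j \<le> k" "k \<le> n" for j k \<omega>
    using that(2,3)
  proof (induction k rule: dec_induct)
    case (step k)
    then show ?case using W_mono[of "Suc k" n \<omega>] that(1) by simp
  qed simp
  have W_nonneg: "0 \<le> W n k \<omega>" if "\<omega> \<in> space M" "k \<le> n" for k \<omega>
    using W_le[OF that(1), of 0 k] W_0[OF n that(1)] that(2) by simp
  have W_int: "integrable M (W n k)" if "k \<le> n" for k
  proof (rule Bochner_Integration.integrable_bound[OF assms(12)[OF n]])
    show "W n k \<in> borel_measurable M"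
    proof (cases "k = 0")
      case True
      have "W n 0 \<in> borel_measurable M \<longleftrightarrow> (\<lambda>_. 0 :: real) \<in> borel_measurable M"
        by (rule measurable_cong) (simp add: W_0[OF n])
      with True show ?thesis by simp
    qed (use W_meas that in auto)
    show "AE \<omega> in M. norm (W n k \<omega>) \<le> norm (W n n \<omega>)"
      using W_le W_nonneg that by (intro AE_I2) simp
  qed
  \<comment> \<open>The weights are frozen at \<omega>, while the X k remain random on the same
    space.\<close>
  have approx: "dickman_approx M X (\<lambda>k. W n k \<omega>) n \<theta> D Xs (max_gap W n \<omega>) (Dstar M \<theta> W X n \<omega>)"
    if \<omega>: "\<omega> \<in> space M" for \<omega>
  proof unfold_locales
    show "indep_vars (\<lambda>_. count_space UNIV) X {1..n}"
      by (rule indep_vars_subset[OF indep_X]) auto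
    fix k assume k: "k \<in> {1..n}"
    show "integrable M (\<lambda>\<omega>. real (X k \<omega>))" using assms(14) k by simp
    show "0 \<le> W n k \<omega>" "W n (k - 1) \<omega> \<le> W n k \<omega>" using W_nonneg W_mono \<omega> k by auto
    show "W n k \<omega> - W n (k - 1) \<omega> \<le> max_gap W n \<omega>"
      unfolding max_gap_def using k by (intro Max_ge) auto
    show "\<bar>\<Sum>j=1..k. lam M X j * W n j \<omega> - \<theta> * (W n j \<omega> - W n (j - 1) \<omega>)\<bar> \<le> Dstar M \<theta> W X n \<omega>"
      unfolding Dstar_def Delta_def[symmetric] Dpart_def[symmetric] using k by (intro Max_ge) auto
    show "size_biased M (X k) (Xs k)" if "0 < lam M X k" using assms(16) that k by simp
  qed (use n W_0[OF n \<omega>] in auto)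
  have err: "dickman_approx.err M X (\<lambda>k. W n k \<omega>) n \<theta> Xs (max_gap W n \<omega>) (Dstar M \<theta> W X n \<omega>) = ?e \<omega>"
    if "\<omega> \<in> space M" for \<omega>
    unfolding dickman_approx.err_def[OF approx[OF that]] dickman_approx.tau_def[OF approx[OF that]] eps_def ..
  have e_ge: "1 / real n \<le> ?e \<omega>" if "\<omega> \<in> space M" for \<omega>
    using dickman_approx.err_ge[OF approx[OF that]] err[OF that] by simp
  have e_int: "integrable M ?e"
  proof -
    have Wm: "W n k \<in> borel_measurable M" if "k \<le> n" for k
      using W_int[OF that] by (rule borel_measurable_integrable)
    have "integrable M (max_gap W n)"
    proof (rule Bochner_Integration.integrable_bound[OF assms(12)[OF n]])
      show "max_gap W n \<in> borel_measurable M"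
        unfolding max_gap_def[abs_def] using Wm by (intro borel_measurable_Max borel_measurable_diff) auto
      have "0 \<le> max_gap W n \<omega> \<and> max_gap W n \<omega> \<le> W n n \<omega>" if \<omega>: "\<omega> \<in> space M" for \<omega>
      proof
        have "0 \<le> W n 1 \<omega> - W n (1 - 1) \<omega>" using W_mono[of 1 n \<omega>] n \<omega> by simp
        also have "\<dots> \<le> max_gap W n \<omega>" unfolding max_gap_def using n by (intro Max_ge) (auto intro!: image_eqI[of _ _ 1])
        finally show "0 \<le> max_gap W n \<omega>" .
        have "W n k \<omega> - W n (k - 1) \<omega> \<le> W n n \<omega>" if "k \<in> {1..n}" for k
        proof -
          have "k \<le> n" "k - 1 \<le> n" using that by auto
          then show ?thesis using W_le[OF \<omega>, of k n] W_nonneg[OF \<omega>, of "k - 1"] by linarith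
        qed
        then show "max_gap W n \<omega> \<le> W n n \<omega>"
          unfolding max_gap_def using n by (subst Max_le_iff) auto
      qed
      note * = this
      show "AE \<omega> in M. norm (max_gap W n \<omega>) \<le> norm (W n n \<omega>)"
      proof (rule AE_I2)
        fix \<omega> assume "\<omega> \<in> space M"
        then show "norm (max_gap W n \<omega>) \<le> norm (W n n \<omega>)" using *[of \<omega>] by simp
      qed
    qed
    moreover have "integrable M (Dstar M \<theta> W X n)"
    proof (rule Bochner_Integration.integrable_bound)
      let ?R = "\<lambda>\<omega>. \<Sum>j=1..n. \<bar>lam M X j * W n j \<omega> - Delta \<theta> W n j \<omega>\<bar>"
      show "integrable M ?R"
        unfolding Delta_def using W_int by (intro Bochner_Integration.integrable_sum integrable_abs) auto
      have "Dpart M \<theta> W X n k \<in> borel_measurable M" if "k \<le> n" for k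
        unfolding Dpart_def[abs_def] Delta_def using that Wm by (intro borel_measurable_sum) auto
      then show "Dstar M \<theta> W X n \<in> borel_measurable M"
        unfolding Dstar_def[abs_def] by (intro borel_measurable_Max borel_measurable_abs) auto
      have "0 \<le> Dstar M \<theta> W X n \<omega> \<and> Dstar M \<theta> W X n \<omega> \<le> ?R \<omega>" for \<omega>
      proof
        have "0 \<le> \<bar>Dpart M \<theta> W X n 1 \<omega>\<bar>" by simp
        also have "\<dots> \<le> Dstar M \<theta> W X n \<omega>" unfolding Dstar_def using n by (intro Max_ge) (auto intro!: image_eqI[of _ _ 1])
        finally show "0 \<le> Dstar M \<theta> W X n \<omega>" .
        have "\<bar>Dpart M \<theta> W X n k \<omega>\<bar> \<le> ?R \<omega>" if "k \<in> {1..n}" for k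
          unfolding Dpart_def using that
          by (intro order_trans[OF sum_abs] sum_mono2) auto
        then show "Dstar M \<theta> W X n \<omega> \<le> ?R \<omega>"
          unfolding Dstar_def using n by (subst Max_le_iff) auto
      qed
      note * = this
      show "AE \<omega> in M. norm (Dstar M \<theta> W X n \<omega>) \<le> norm (?R \<omega>)"
      proof (rule AE_I2)
        fix \<omega>
        show "norm (Dstar M \<theta> W X n \<omega>) \<le> norm (?R \<omega>)" using *[of \<omega>] by simp
      qed
    qed
    ultimately show ?thesis
      unfolding eps_def[abs_def] using W_int
      by (intro Bochner_Integration.integrable_add integrable_mult_right integrable_mult_left
          Bochner_Integration.integrable_sum integrable_abs Bochner_Integration.integrable_diff) auto
  qed
  have E_pos: "0 < E"
  proof -
    have "(\<integral>\<omega>. 1 / real n \<partial>M) \<le> E"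
      unfolding E_def using e_int e_ge by (intro integral_mono) auto
    then have "1 / real n \<le> E" by (simp add: prob_space)
    moreover have "0 < 1 / real n" using n by simp
    ultimately show ?thesis by linarith
  qed
  \<comment> \<open>This is the conditional distribution function of the sum given the weights: they
    are taken at \<omega>, and the probability refers to a separate \<omega>'.\<close>
  define P where "P t \<omega> = prob {\<omega>' \<in> space M. (\<Sum>k=1..n. W n k \<omega> * real (X k \<omega>')) \<le> t}" for t \<omega>
  have decondition: "integrable M (P t)" "prob {\<omega> \<in> space M. wsum W X n \<omega> \<le> t} = (\<integral>\<omega>. P t \<omega> \<partial>M)" for t
  proof -
    let ?N = "Pi\<^sub>M {1..n} (\<lambda>_. borel) :: (nat \<Rightarrow> real) measure"
    let ?X = "\<lambda>\<omega>. \<lambda>k\<in>{1..n}. real (X k \<omega>)" and ?W = "\<lambda>\<omega>. \<lambda>k\<in>{1..n}. W n k \<omega>"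
    let ?h = "\<lambda>z. indicator {..t} (\<Sum>k=1..n. snd z k * fst z k) :: real"
    have I: "indep_var ?N ?X ?N ?W" by (rule indep_var_row_prefix[OF assms(15) W_meas X_meas])
    note [measurable] = indep_var_rv1[OF I] indep_var_rv2[OF I]
    have h: "?h \<in> borel_measurable (?N \<Otimes>\<^sub>M ?N)" by measurable
    have hi: "integrable M (\<lambda>\<omega>. ?h (?X \<omega>, ?W \<omega>))"
      by (rule integrable_const_bound[of _ 1])
         (simp add: indicator_def,
          rule measurable_compose[OF measurable_Pair[OF indep_var_rv1[OF I] indep_var_rv2[OF I]] h])
    have eq: "?h (?X \<omega>, ?W \<omega>') = indicator {\<omega> \<in> space M. (\<Sum>k=1..n. W n k \<omega>' * real (X k \<omega>)) \<le> t} \<omega>"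
      if "\<omega> \<in> space M" for \<omega> \<omega>'
      using that by (simp add: indicator_def)
    have in_eq: "(\<integral>\<omega>. ?h (?X \<omega>, ?W \<omega>') \<partial>M) = P t \<omega>'" for \<omega>'
    proof -
      have "(\<integral>\<omega>. ?h (?X \<omega>, ?W \<omega>') \<partial>M)
        = (\<integral>\<omega>. indicator {\<omega> \<in> space M. (\<Sum>k=1..n. W n k \<omega>' * real (X k \<omega>)) \<le> t} \<omega> \<partial>M)"
        by (intro Bochner_Integration.integral_cong refl eq)
      also have "\<dots> = prob ({\<omega> \<in> space M. (\<Sum>k=1..n. W n k \<omega>' * real (X k \<omega>)) \<le> t} \<inter> space M)"
        by (rule Bochner_Integration.integral_indicator)
      finally show ?thesis unfolding P_def by (simp add: Int_absorb2 Collect_mono)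
    qed
    have "(\<integral>\<omega>. ?h (?X \<omega>, ?W \<omega>) \<partial>M) = (\<integral>\<omega>. indicator {\<omega> \<in> space M. wsum W X n \<omega> \<le> t} \<omega> \<partial>M)"
      by (intro Bochner_Integration.integral_cong refl) (auto simp: wsum_def indicator_def)
    also have "\<dots> = prob ({\<omega> \<in> space M. wsum W X n \<omega> \<le> t} \<inter> space M)"
      by (rule Bochner_Integration.integral_indicator)
    also have "{\<omega> \<in> space M. wsum W X n \<omega> \<le> t} \<inter> space M = {\<omega> \<in> space M. wsum W X n \<omega> \<le> t}" by auto
    finally have out_eq: "(\<integral>\<omega>. ?h (?X \<omega>, ?W \<omega>) \<partial>M) = prob {\<omega> \<in> space M. wsum W X n \<omega> \<le> t}" .
    show "integrable M (P t)"
      using indep_expectation(1)[OF I h hi] unfolding in_eq .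
    show "prob {\<omega> \<in> space M. wsum W X n \<omega> \<le> t} = (\<integral>\<omega>. P t \<omega> \<partial>M)"
      using indep_expectation(2)[OF I h hi] unfolding in_eq out_eq .
  qed
  have wsum_meas: "wsum W X n \<in> borel_measurable M"
    unfolding wsum_def[abs_def]
    using W_meas X_meas by (intro borel_measurable_sum borel_measurable_times measurable_compose[OF X_meas]) auto
  \<comment> \<open>An affine bound in the random error passes to expectations directly. For
    \<theta> \<ge> 1 the deterministic bound is already linear; for \<theta> < 1 it is made affine
    by the tangent at E.\<close>
  have bound: "\<bar>prob {\<omega> \<in> space M. wsum W X n \<omega> \<le> t} - measure D {..t}\<bar> \<le> a * E + b"
    if "\<And>\<omega>. \<omega> \<in> space M \<Longrightarrow> \<bar>P t \<omega> - measure D {..t}\<bar> \<le> a * ?e \<omega> + b" for a b t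
  proof -
    have "prob {\<omega> \<in> space M. wsum W X n \<omega> \<le> t} - measure D {..t} = (\<integral>\<omega>. P t \<omega> - measure D {..t} \<partial>M)"
      using decondition by (simp add: prob_space)
    then have "\<bar>prob {\<omega> \<in> space M. wsum W X n \<omega> \<le> t} - measure D {..t}\<bar> \<le> (\<integral>\<omega>. \<bar>P t \<omega> - measure D {..t}\<bar> \<partial>M)"
      by simp
    also have "\<dots> \<le> (\<integral>\<omega>. a * ?e \<omega> + b \<partial>M)"
      using decondition e_int that by (intro integral_mono) auto
    also have "\<dots> = a * E + b"
      unfolding E_def using e_int by (simp add: prob_space)
    finally show ?thesis .
  qed
  have P_S: "P t \<omega> = prob {\<omega>' \<in> space M. weighted_sum.S X (\<lambda>k. W n k \<omega>) n \<omega>' \<le> t}" if "\<omega> \<in> space M" for t \<omega>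
  proof -
    interpret A: dickman_approx M X "\<lambda>k. W n k \<omega>" n \<theta> D Xs "max_gap W n \<omega>" "Dstar M \<theta> W X n \<omega>"
      by (rule approx[OF that])
    show ?thesis by (simp add: P_def A.S_def)
  qed
  have main: "\<bar>prob {\<omega> \<in> space M. wsum W X n \<omega> \<le> t} - measure D {..t}\<bar>
    \<le> (if \<theta> \<ge> 1 then C1 \<theta> \<kappa> * E else 2 * \<theta>\<^sup>2 * E + C2 \<theta> * E powr \<theta>)" if t: "0 \<le> t" for t
  proof (cases "\<theta> \<ge> 1")
    case True
    let ?c = "2 * \<theta>\<^sup>2 + (6 * \<theta> + 10 * \<theta> * zeta_real (1 + \<theta>)) * \<kappa>"
    have "\<bar>P t \<omega> - measure D {..t}\<bar> \<le> ?c * ?e \<omega> + 0" if "\<omega> \<in> space M" for \<omega>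
      using dickman_approx.kolmogorov_bound_ge_1[OF approx[OF that] True assms(4,6) _ assms(7) t] assms(8)
      by (simp add: P_S[OF that] err[OF that])
    then have "\<bar>prob {\<omega> \<in> space M. wsum W X n \<omega> \<le> t} - measure D {..t}\<bar> \<le> ?c * E"
      using bound[of t ?c 0] by simp
    also have "\<dots> \<le> C1 \<theta> \<kappa> * E"
    proof -
      have "0 \<le> zeta_real (1 + \<theta>)"
        unfolding zeta_real_def by (intro suminf_nonneg summable_zeta_real theta_pos) auto
      then have "?c \<le> C1 \<theta> \<kappa>"
        unfolding C1_def using theta_pos by (intro add_left_mono mult_left_mono) auto
      then show ?thesis using E_pos by (intro mult_right_mono) auto
    qed
    finally show ?thesis using True by simp
  next
    case False
    then have \<theta>1: "\<theta> < 1" by simp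
    \<comment> \<open>Slope and intercept of the deterministic bound after replacing the power by
      its tangent at E; at the argument E the tangent takes the value
      \<open>E powr \<theta>\<close>, so nothing is lost.\<close>
    let ?a = "2 * \<theta>\<^sup>2 + C2 \<theta> * (\<theta> * E powr (\<theta> - 1))"
    let ?b = "C2 \<theta> * (E powr \<theta> - \<theta> * E powr (\<theta> - 1) * E)"
    have "\<bar>P t \<omega> - measure D {..t}\<bar> \<le> ?a * ?e \<omega> + ?b" if \<omega>: "\<omega> \<in> space M" for \<omega>
    proof -
      have "0 < 1 / real n" using n by simp
      then have "0 < ?e \<omega>" using e_ge[OF \<omega>] by linarith
      then have "C2 \<theta> * ?e \<omega> powr \<theta> \<le> C2 \<theta> * (E powr \<theta> + \<theta> * E powr (\<theta> - 1) * (?e \<omega> - E))"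
        using E_pos theta_pos \<theta>1 by (intro mult_left_mono powr_le_tangent) (auto simp: C2_def)
      moreover have "\<bar>P t \<omega> - measure D {..t}\<bar> \<le> 2 * \<theta>\<^sup>2 * ?e \<omega> + C2 \<theta> * ?e \<omega> powr \<theta>"
        using dickman_approx.kolmogorov_bound_less_1[OF approx[OF \<omega>] \<theta>1 t] by (simp add: P_S[OF \<omega>] err[OF \<omega>])
      ultimately show ?thesis by (simp add: algebra_simps)
    qed
    then have "\<bar>prob {\<omega> \<in> space M. wsum W X n \<omega> \<le> t} - measure D {..t}\<bar> \<le> ?a * E + ?b"
      by (rule bound)
    also have "?a * E + ?b = 2 * \<theta>\<^sup>2 * E + C2 \<theta> * E powr \<theta>" by (simp add: algebra_simps)
    finally show ?thesis using False by simp
  qed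
  have "kolmogorov_dist (distr M borel (wsum W X n)) D
    \<le> (if \<theta> \<ge> 1 then C1 \<theta> \<kappa> * E else 2 * \<theta>\<^sup>2 * E + C2 \<theta> * E powr \<theta>)"
    unfolding kolmogorov_dist_def
  proof (rule cSUP_least)
    fix t :: real assume "t \<in> {0..}"
    moreover have "measure (distr M borel (wsum W X n)) {..t} = prob {\<omega> \<in> space M. wsum W X n \<omega> \<le> t}"
      using wsum_meas by (subst measure_distr) (auto intro!: arg_cong[where f = prob])
    ultimately show "\<bar>measure (distr M borel (wsum W X n)) {..t} - measure D {..t}\<bar>
      \<le> (if \<theta> \<ge> 1 then C1 \<theta> \<kappa> * E else 2 * \<theta>\<^sup>2 * E + C2 \<theta> * E powr \<theta>)"
      using main[of t] by simp
  qed simp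
  then show "kolmogorov_dist (distr M borel (wsum W X n)) D \<le>
    (let E = (\<integral>\<omega>. eps M \<theta> W X Xs n \<omega> \<partial>M) in
     if \<theta> \<ge> 1 then C1 \<theta> \<kappa> * E
     else 2 * \<theta>\<^sup>2 * E + C2 \<theta> * E powr \<theta>)"
    unfolding E_def Let_def .
qed

end
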